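(* Let $p,m,m_0\ge1$ be integers with $m\ge m_0$, let $f\colon\mathbb{R}^p\to\mathbb{R}$ be $2m$-times continuously differentiable, and let $F\colon\mathbb{R}^p\to\mathbb{R}$ be any antiderivative of $f$. Suppose that $$F^{(\boldsymbol{\alpha})}(\mathbf{x})\to0\ \text{ as }\ \max(x_1,\dots,x_p)\to\infty,\quad\text{for each }\boldsymbol{\alpha}\in\mathbb{Z}_+^p\text{ with }\|\boldsymbol{\alpha}\|=2m_0,$$ and that, for each $\boldsymbol{\alpha}\in\mathbb{Z}_+^p$ with $\|\boldsymbol{\alpha}\|=2m$, the series $\sum_{\mathbf{k}=\mathbf{0}}^{\infty\mathbf{1}}f^{(\boldsymbol{\alpha})}(\mathbf{k}+\mathbf{u})$ converges uniformly in $\mathbf{u}\in[-m\mathbf{1}/2,m\mathbf{1}/2]$, in the sense that $\sum_{\mathbf{k}=\mathbf{0}}^{\mathbf{n}-\mathbf{1}}f^{(\boldsymbol{\alpha})}(\mathbf{k}+\mathbf{u})$ converges uniformly in such $\mathbf{u}$ as $\wedge\mathbf{n}\to\infty$. Then $$\sum_{\mathbf{k}\ge\mathbf{0}}^{\mathsf{Alt}}f(\mathbf{k}):=\lim_{\wedge\mathbf{n}\to\infty}\Big(\sum_{\mathbf{k}=\mathbf{0}}^{\mathbf{n}-\mathbf{1}}f(\mathbf{k})-\tilde A_{m_0,F}(\mathbf{n})\Big)=(-1)^pA^{\emptyset}_{m,F}(\mathbf{0})-R_{m,f}(\infty),$$ where, for $\mathbf{n}\in\mathbb{Z}_+^p$,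 $$\tilde A_{m,F}(\mathbf{n}):=\sum_{\emptyset\ne J\subseteq[p]}(-1)^{p-|J|}A^J_{m,F}(\mathbf{n})$$ (and similarly with $m_0$ in place of $m$), $$A^J_{m,F}(\mathbf{n}):=\sum_{\mathbf{j}=\mathbf{1}}^{m\mathbf{1}}\gamma_{m,\mathbf{j}}\sum_{\mathbf{i}=\mathbf{0}}^{\mathbf{j}-\mathbf{1}}F(\mathbf{n}\mathbf{1}_J-\mathbf{1}+\mathbf{j}/2-\mathbf{i})=\sum_{\boldsymbol{\beta}=(1-m)\mathbf{1}}^{(m-1)\mathbf{1}}\tau_{m,\mathbf{1}+|\boldsymbol{\beta}|}F(\mathbf{n}\mathbf{1}_J-\mathbf{1}/2-\boldsymbol{\beta}/2)=\sum_{\boldsymbol{\alpha}=\mathbf{0}}^{(m-1)\mathbf{1}}\tau_{m,\mathbf{1}+\boldsymbol{\alpha}}\sum_{\boldsymbol{\beta}\colon|\boldsymbol{\beta}|=\boldsymbol{\alpha}}F(\mathbf{n}\mathbf{1}_J-\mathbf{1}/2-\boldsymbol{\beta}/2),$$ and $$R_{m,f}(\infty):=\frac{m}{2^{2m+p-1}}\sum_{\|\boldsymbol{\alpha}\|=2m}\frac1{\boldsymbol{\alpha}!}\int_0^1ds\,(1-s)^{2m-1}\int_{[-1,1]^p}d\mathbf{v}\,\mathbf{v}^{\boldsymbol{\alpha}}\sum_{\mathbf{j}=\mathbf{1}}^{m\mathbf{1}}\gamma_{m,\mathbf{j}}\,\mathbf{j}^{\boldsymbol{\alpha}+\mathbf{1}}\sum_{\mathbf{k}=\mathbf{0}}^{\infty\mathbf{1}}f^{(\boldsymbol{\alpha})}(\mathbf{k}+s\mathbf{j}\mathbf{v}/2).$$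 If, in addition, $M_{2m}$ is a real number such that $$\Big|\sum_{\mathbf{k}=\mathbf{0}}^{\mathbf{n}-\mathbf{1}}f^{(\boldsymbol{\alpha})}(\mathbf{k}+\mathbf{u})\Big|\le M_{2m}\quad\text{for all }\mathbf{n}\in\mathbb{Z}_+^p,\text{ all }\boldsymbol{\alpha}\in\mathbb{Z}_+^p\text{ with }\|\boldsymbol{\alpha}\|=2m,\text{ and all }\mathbf{u}\in(-m\mathbf{1}/2,m\mathbf{1}/2],$$ then $$|R_{m,f}(\infty)|\le\frac{M_{2m}}{2^{2m}}\sum_{\|\boldsymbol{\alpha}\|=2m}\frac1{(\boldsymbol{\alpha}+\mathbf{1})!}\sum_{\mathbf{j}=\mathbf{1}}^{m\mathbf{1}}|\gamma_{m,\mathbf{j}}|\,\mathbf{j}^{\boldsymbol{\alpha}+\mathbf{1}}\le M_{2m}\,\frac{1.0331\,(\pi m)^{(p+1)/2}}{(2m+1)!}\,(\kappa pm)^{2m},$$ where $\kappa:=\sqrt{\Lambda_*/4}=0.27754\dots$ and $\Lambda_*:=\max_{0<t<1}(1-t)^{t-1}(1+t)^{-1-t}t^2=0.3081\dots$. Also, for all $\mathbf{n}\in\mathbb{Z}_+^p$ and $J\subseteq[p]$, $$A^{\emptyset}_{m,F}(\mathbf{0})=A^{\emptyset}_{m,F}(\mathbf{n})=A^J_{m,F}(\mathbf{0})=\sum_{\boldsymbol{\alpha}=\mathbf{0}}^{(m-1)\mathbf{1}}\tau_{m,\mathbf{1}+\boldsymbol{\alpha}}\sum_{\boldsymbol{\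beta}\colon|\boldsymbol{\beta}|=\boldsymbol{\alpha}}F(\boldsymbol{\beta}/2-\mathbf{1}/2).$$
   Context: Notation. $\mathbb{Z}_+:=\mathbb{Z}\cap[0,\infty)$, $[p]:=\{1,\dots,p\}$, $|J|$ is the cardinality of $J\subseteq[p]$, and $\mathbf{1}_J\in\{0,1\}^p$ is the vector whose $r$th coordinate is $1$ if $r\in J$ and $0$ otherwise. Boldface letters denote vectors with $p$ coordinates, the coordinates being denoted by the corresponding non-bold letters with indices. $\mathbf{1}:=(1,\dots,1)$, $\mathbf{0}:=(0,\dots,0)$, $\wedge\mathbf{n}:=\min(n_1,\dots,n_p)$. For $\boldsymbol{\alpha}\in\mathbb{Z}_+^p$: $\|\boldsymbol{\alpha}\|:=\alpha_1+\dots+\alpha_p$, $\boldsymbol{\alpha}!:=\alpha_1!\cdots\alpha_p!$, $\mathbf{x}^{\boldsymbol{\alpha}}:=x_1^{\alpha_1}\cdots x_p^{\alpha_p}$, and $h^{(\boldsymbol{\alpha})}$ is the corresponding partial derivative of a function $h$. $|\boldsymbol{\beta}|:=(|\beta_1|,\dots,|\beta_p|)$ for $\boldsymbol{\beta}\in\mathbb{Z}^p$. Products of vectors such as $\mathbf{j}\mathbf{v}$ and $\mathbf{n}\mathbf{1}_J$ are coordinatewise, and inequalities between vectors are coordinatewise. $(\mathbf{u},\mathbf{v}]:=\prod_r(u_r,v_r]$, $[\mathbf{u},\mathbf{v}]:=\prod_r[u_r,v_r]$. $\sum_{\mathbf{i}=\mathbf{a}}^{\mathbf{b}}$ is the sum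 over all $\mathbf{i}\in\mathbb{Z}^p$ with $\mathbf{a}\le\mathbf{i}\le\mathbf{b}$ (an empty sum is $0$); $\sum_{\mathbf{k}=\mathbf{0}}^{\infty\mathbf{1}}$ is the limit of $\sum_{\mathbf{k}=\mathbf{0}}^{\mathbf{n}-\mathbf{1}}$ as $\wedge\mathbf{n}\to\infty$; $\sum_{\boldsymbol{\beta}\colon|\boldsymbol{\beta}|=\boldsymbol{\alpha}}$ is over $\boldsymbol{\beta}\in\mathbb{Z}^p$; $\sum_{\|\boldsymbol{\alpha}\|=2m}$ is over $\boldsymbol{\alpha}\in\mathbb{Z}_+^p$. A function $F$ on $\mathbb{R}^p$ is an antiderivative of $f$ if $F^{(\mathbf{1})}=f$, that is, $\partial^pF/(\partial x_1\cdots\partial x_p)=f$. Coefficients: for integers $j\ge1$, $$\gamma_{m,j}:=(-1)^{j-1}\frac2j\binom{2m}{m+j}\Big/\binom{2m}{m},\qquad \tau_{m,j}:=\sum_{\beta=0}^{\infty}\gamma_{m,j+2\beta}$$ (with $\binom{2m}{m+j}=0$ for $j>m$), and for $\mathbf{j}\in\mathbb{Z}_+^p$ with $\mathbf{j}\ge\mathbf{1}$, $\gamma_{m,\mathbf{j}}:=\prod_{r=1}^p\gamma_{m,j_r}$ and $\tau_{m,\mathbf{j}}:=\prod_{r=1}^p\tau_{m,j_r}$. The quantities with $m_0$ in place of $m$ are defined in the same way. *)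

theory Defs
  imports "HOL-Analysis.Analysis"
begin

text \<open>
  The index set \<open>[p]\<close> is a type \<open>'p\<close> of cardinality \<open>p\<close>. It is linearly ordered only to give
  meaning to the order of differentiation in \<open>\<partial>\<^sup>p F / (\<partial>x\<^sub>1 \<dots> \<partial>x\<^sub>p)\<close>, in which \<open>\<partial>/\<partial>x\<^sub>1\<close> is applied last;
  the numeral types give such a \<open>'p\<close> of every cardinality \<open>p \<ge> 1\<close>.
  Multi-indices are vectors in \<open>nat ^ 'p\<close> or \<open>int ^ 'p\<close>; on these types \<open>0\<close>, \<open>1\<close>, \<open>of_nat m\<close>,
  \<open>+\<close>, \<open>-\<close>, \<open>*\<close>, \<open>\<le>\<close> (and hence \<open>{a..b}\<close>) are coordinatewise.
\<close>

subsection \<open>Multi-indices\<close>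

definition msize :: "nat ^ 'p::finite \<Rightarrow> nat"
  where "msize \<alpha> = (\<Sum>r\<in>UNIV. \<alpha> $ r)"

definition mfact :: "nat ^ 'p::finite \<Rightarrow> real"
  where "mfact \<alpha> = (\<Prod>r\<in>UNIV. fact (\<alpha> $ r))"

definition mpow :: "real ^ 'p::finite \<Rightarrow> nat ^ 'p \<Rightarrow> real"
  where "mpow x \<alpha> = (\<Prod>r\<in>UNIV. x $ r ^ (\<alpha> $ r))"

definition mabs :: "int ^ 'p::finite \<Rightarrow> nat ^ 'p"
  where "mabs \<beta> = (\<chi> r. nat \<bar>\<beta> $ r\<bar>)"

definition rvec :: "nat ^ 'p::finite \<Rightarrow> real ^ 'p"
  where "rvec k = (\<chi> r. real (k $ r))"

definition ivec :: "int ^ 'p::finite \<Rightarrow> real ^ 'p"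
  where "ivec \<beta> = (\<chi> r. real_of_int (\<beta> $ r))"

definition indvec :: "'p::finite set \<Rightarrow> real ^ 'p"
  where "indvec J = (\<chi> r. if r \<in> J then 1 else 0)"

text \<open>
  The range \<open>0 \<le> k \<le> n - 1\<close> of a sum. It is not written with subtraction because truncated
  subtraction on \<open>nat\<close> would make it nonempty when a coordinate of \<open>n\<close> is zero.
\<close>

definition below :: "nat ^ 'p::finite \<Rightarrow> (nat ^ 'p) set"
  where "below n = {k. \<forall>r. k $ r < n $ r}"

definition min_at_top :: "(nat ^ 'p::finite) filter"
  where "min_at_top = filtercomap (\<lambda>n. Min (range (\<lambda>r. n $ r))) at_top"

definition max_at_top :: "(real ^ 'p::finite) filter"
  where "max_at_top = filtercomap (\<lambda>x. Max (range (\<lambda>r. x $ r))) at_top"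

definition infsum_box :: "(nat ^ 'p::finite \<Rightarrow> real) \<Rightarrow> real"
  where "infsum_box a = Lim min_at_top (\<lambda>n. \<Sum>k\<in>below n. a k)"


subsection \<open>Partial derivatives\<close>

definition has_partial :: "'p::finite \<Rightarrow> (real ^ 'p \<Rightarrow> real) \<Rightarrow> (real ^ 'p \<Rightarrow> real) \<Rightarrow> bool"
  where "has_partial r h g \<longleftrightarrow>
    (\<forall>x. ((\<lambda>t. h (x + t *\<^sub>R axis r 1)) has_real_derivative g x) (at 0))"

fun has_iter_partial ::
  "'p::finite list \<Rightarrow> (real ^ 'p \<Rightarrow> real) \<Rightarrow> (real ^ 'p \<Rightarrow> real) \<Rightarrow> bool"
where
  "has_iter_partial [] h g \<longleftrightarrow> g = h"
| "has_iter_partial (r # rs) h g \<longleftrightarrow> (\<exists>h'. has_iter_partial rs h h' \<and> has_partial r h' g)"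

definition deriv_list :: "nat ^ 'p::{finite,linorder} \<Rightarrow> 'p list"
  where "deriv_list \<alpha> = concat (map (\<lambda>r. replicate (\<alpha> $ r) r) (sorted_list_of_set UNIV))"

definition has_mpartial ::
  "nat ^ 'p::{finite,linorder} \<Rightarrow> (real ^ 'p::{finite,linorder} \<Rightarrow> real) \<Rightarrow> (real ^ 'p::{finite,linorder} \<Rightarrow> real) \<Rightarrow> bool"
  where "has_mpartial \<alpha> h g \<longleftrightarrow> has_iter_partial (deriv_list \<alpha>) h g"

definition mpartial ::
  "nat ^ 'p::{finite,linorder} \<Rightarrow> (real ^ 'p::{finite,linorder} \<Rightarrow> real) \<Rightarrow> real ^ 'p::{finite,linorder} \<Rightarrow> real"
  where "mpartial \<alpha> h = (THE g. has_mpartial \<alpha> h g)"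

lemma has_partial_unique: "has_partial r h g \<Longrightarrow> has_partial r h g' \<Longrightarrow> g = g'"
  unfolding has_partial_def by (metis DERIV_unique ext)

lemma has_iter_partial_unique:
  "has_iter_partial rs h g \<Longrightarrow> has_iter_partial rs h g' \<Longrightarrow> g = g'"
proof (induction rs arbitrary: g g')
  case (Cons r rs)
  then show ?case by (metis has_iter_partial.simps(2) has_partial_unique)
qed simp

lemma mpartial_eqI: "has_mpartial \<alpha> h g \<Longrightarrow> mpartial \<alpha> h = g"
  unfolding mpartial_def has_mpartial_def using has_iter_partial_unique by blast

text \<open>All iterated partial derivatives of order at most \<open>k\<close> exist and are continuous.\<close>

fun cont_diff :: "nat \<Rightarrow> (real ^ 'p::finite \<Rightarrow> real) \<Rightarrow> bool"
where
  "cont_diff 0 h \<longleftrightarrow> continuous_on UNIV h"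
| "cont_diff (Suc k) h \<longleftrightarrow>
    continuous_on UNIV h \<and> (\<forall>r. \<exists>g. has_partial r h g \<and> cont_diff k g)"

definition is_antiderivative ::
  "(real ^ 'p::{finite,linorder} \<Rightarrow> real) \<Rightarrow> (real ^ 'p::{finite,linorder} \<Rightarrow> real) \<Rightarrow> bool"
  where "is_antiderivative F f \<longleftrightarrow> has_mpartial 1 F f"


subsection \<open>Coefficients\<close>

definition gam :: "nat \<Rightarrow> nat \<Rightarrow> real"
  where "gam m j = (- 1) ^ (j - 1) * (2 / real j)
    * (real ((2 * m) choose (m + j)) / real ((2 * m) choose m))"

definition tau :: "nat \<Rightarrow> nat \<Rightarrow> real"
  where "tau m j = (\<Sum>\<beta>. gam m (j + 2 * \<beta>))"

definition mgam :: "nat \<Rightarrow> nat ^ 'p::finite \<Rightarrow> real"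
  where "mgam m j = (\<Prod>r\<in>UNIV. gam m (j $ r))"

definition mtau :: "nat \<Rightarrow> nat ^ 'p::finite \<Rightarrow> real"
  where "mtau m j = (\<Prod>r\<in>UNIV. tau m (j $ r))"


subsection \<open>The main terms and the remainder\<close>

definition A_term ::
  "nat \<Rightarrow> (real ^ 'p::finite \<Rightarrow> real) \<Rightarrow> 'p set \<Rightarrow> nat ^ 'p \<Rightarrow> real"
  where "A_term m F J n =
    (\<Sum>j\<in>{1..of_nat m}. mgam m j *
      (\<Sum>i\<in>below j. F (rvec n * indvec J - 1 + (1/2) *\<^sub>R rvec j - rvec i)))"

definition A_tilde ::
  "nat \<Rightarrow> (real ^ 'p::finite \<Rightarrow> real) \<Rightarrow> nat ^ 'p \<Rightarrow> real"
  where "A_tilde m F n =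
    (\<Sum>J\<in>{J. J \<noteq> {}}. (- 1) ^ (CARD('p) - card J) * A_term m F J n)"

definition R_inf :: "nat \<Rightarrow> (real ^ 'p::{finite,linorder} \<Rightarrow> real) \<Rightarrow> real"
  where "R_inf m f =
    real m / 2 ^ (2 * m + CARD('p) - 1) *
    (\<Sum>\<alpha>\<in>{\<alpha>. msize \<alpha> = 2 * m}. 1 / mfact \<alpha> *
      integral {0..1} (\<lambda>s. (1 - s) ^ (2 * m - 1) *
        integral (cbox (- 1) 1) (\<lambda>v. mpow v \<alpha> *
          (\<Sum>j\<in>{1..of_nat m}. mgam m j * mpow (rvec j) (\<alpha> + 1) *
            infsum_box (\<lambda>k. mpartial \<alpha> f (rvec k + (s / 2) *\<^sub>R (rvec j * v)))))))"


subsection \<open>The constants of the error bound\<close>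

definition Lam_fun :: "real \<Rightarrow> real"
  where "Lam_fun t = (1 - t) powr (t - 1) * (1 + t) powr (- 1 - t) * t ^ 2"

text \<open>That the supremum is attained is part of the theorem.\<close>

definition Lam_star :: real
  where "Lam_star = (SUP t\<in>{0<..<1}. Lam_fun t)"

definition kap :: real
  where "kap = sqrt (Lam_star / 4)"

end

theory Submission
  imports Defs
begin

text \<open>
  In one variable, \<open>\<Sum>\<^sub>j \<gamma>\<^sub>j \<integral>\<^bsub>[-j/2, j/2]\<^esub> \<phi> = \<phi> 0\<close> for every polynomial \<open>\<phi>\<close> of degree less than \<open>2 m\<close>: odd
  monomials integrate to zero, and for the even ones this says \<open>\<Sum>\<^sub>j \<gamma>\<^sub>j j\<^bsup>2q+1\<^esup> = [q = 0]\<close>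
  (\<open>gam_moment\<close>), which holds because alternating binomial sums annihilate polynomials of low degree.
  The product rule with weights \<open>\<gamma>\<^sub>j\<close> therefore reproduces the value at the origin of every
  polynomial of total degree less than \<open>2 m\<close> in \<open>p\<close> variables. Applied to the Taylor expansion of
  \<open>f\<close> at a lattice point \<open>k\<close>, it expresses \<open>f k\<close> by integrals of \<open>f\<close> over boxes centred at \<open>k\<close>, up to
  an integral of the derivatives of order \<open>2 m\<close> (\<open>local_formula\<close>). The integral over a box is the
  alternating sum of \<open>F\<close> over the vertices (\<open>box_FTC\<close>), and the sum of these over \<open>k < n\<close> telescopes in
  each coordinate into \<open>\<Sum>\<^sub>J (-1)\<^bsup>p-|J|\<^esup> A\<^sup>J(n)\<close> (\<open>sum_boxes_eq_A_terms\<close>). This is a summation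
  formula for finite \<open>n\<close> (\<open>summation_formula\<close>).

  Two things happen as \<open>n\<close> grows. The remainder is a bounded linear functional of the partial sums of
  the derivatives, which converge uniformly, so it tends to \<open>R\<^sub>\<infinity>\<close> (\<open>rem_fun_limit\<close>). And in
  the main terms \<open>A\<^sup>J\<close> with \<open>J \<noteq> {}\<close> the order \<open>m\<close> may be replaced by \<open>m\<^sub>0\<close>: the one-variable
  functionals of both orders agree on polynomials of degree less than \<open>2 m\<^sub>0\<close>, so exchanging them in one
  variable at a time costs only Taylor remainders with pure derivatives of \<open>F\<close> of order \<open>2 m\<^sub>0\<close> near the
  point \<open>n\<close>, and these vanish at infinity (\<open>A_term_order_change\<close>). The term \<open>J = {}\<close> does not depend on
  \<open>n\<close> and is left over in the limit.

  The first error bound is a bound for the norm of the remainder functional (\<open>rem_fun_bound\<close>). For the explicit one,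
  \<open>\<Sum>\<^sub>\<alpha> j\<^sup>\<alpha> / (\<alpha> + 1)!\<close> is the integral of \<open>(j \<cdot> u)\<^bsup>2m\<^esup> / (2m)!\<close> over the unit cube, and
  the power mean inequality separates the variables. What remains are the one-variable sums
  \<open>\<Sum>\<^sub>j |\<gamma>\<^sub>j| j\<close>, estimated by Wallis's product (\<open>gam_mass\<close>), and \<open>\<Sum>\<^sub>j |\<gamma>\<^sub>j| j\<^bsup>2m+1\<^esup>\<close>
  (\<open>gam_top_moment\<close>). Stirling's formula bounds the terms of the latter, with \<open>t = j/m\<close>, by about
  \<open>2 m\<^bsup>2m\<^esup> \<Lambda>(t)\<^sup>m / sqrt (1 - t\<^sup>2)\<close>; since \<open>\<integral> 2 / sqrt (1 - t\<^sup>2) = \<pi>\<close> over \<open>[0, 1]\<close>, their sum is at most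
  about \<open>\<pi> m m\<^bsup>2m\<^esup> \<Lambda>\<^sub>*\<^sup>m\<close>. The factor \<open>1.0331\<close> is what the case \<open>m = 1\<close> requires, where
  the bound is almost an equality.
\<close>

section \<open>Tensor products of finitely supported measures\<close>

definition grid :: "('p::finite \<Rightarrow> 'a set) \<Rightarrow> ('a ^ 'p) set"
  where "grid S = {y. \<forall>r. y $ r \<in> S r}"

definition vupd :: "'a ^ 'p::finite \<Rightarrow> 'p \<Rightarrow> 'a \<Rightarrow> 'a ^ 'p"
  where "vupd x r t = (\<chi> i. if i = r then t else x $ i)"

definition dirac :: "'a \<Rightarrow> 'a \<Rightarrow> real"
  where "dirac c t = of_bool (t = c)"

text \<open>
  The product of the one-variable measures \<open>W r\<close>, as a functional. The main terms \<open>A\<^sup>J\<close> and the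
  vertex sums of boxes are of this form, and so identities between them follow from identities between finitely
  supported measures on the line, which are checked at each point separately.
\<close>

definition tensor :: "('p::finite \<Rightarrow> real \<Rightarrow> real) \<Rightarrow> (real ^ 'p \<Rightarrow> real) \<Rightarrow> real"
  where "tensor W h = (\<Sum>y\<in>grid (\<lambda>r. {t. W r t \<noteq> 0}). (\<Prod>r\<in>UNIV. W r (y $ r)) * h y)"

lemma vupd_nth [simp]: "vupd x r t $ i = (if i = r then t else x $ i)"
  by (simp add: vupd_def)

lemma vupd_same [simp]: "vupd x r (x $ r) = x"
  by (simp add: vec_eq_iff)

lemma grid_eq_image: "grid S = vec_lambda ` (PiE UNIV S)"
proof -
  have "y \<in> vec_lambda ` (PiE UNIV S)" if "y \<in> grid S" for y
    using that by (intro image_eqI[where x = "vec_nth y"]) (auto simp: grid_def PiE_def)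
  then show ?thesis by (auto simp: grid_def)
qed

lemma finite_grid: "(\<And>r. finite (S r)) \<Longrightarrow> finite (grid S)"
  unfolding grid_eq_image by (intro finite_imageI finite_PiE) auto

lemma sum_grid_prod:
  fixes g :: "'p::finite \<Rightarrow> 'a \<Rightarrow> 'b::comm_semiring_1"
  assumes "\<And>r. finite (S r)"
  shows "(\<Sum>y\<in>grid S. \<Prod>r\<in>UNIV. g r (y $ r)) = (\<Prod>r\<in>UNIV. \<Sum>t\<in>S r. g r t)"
proof -
  have "inj_on vec_lambda (PiE UNIV S)"
    by (auto intro!: inj_onI simp: vec_lambda_inject)
  then have "(\<Sum>y\<in>grid S. \<Prod>r\<in>UNIV. g r (y $ r)) = (\<Sum>y\<in>PiE UNIV S. \<Prod>r\<in>UNIV. g r (y r))"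
    unfolding grid_eq_image by (simp add: sum.reindex)
  also have "\<dots> = (\<Prod>r\<in>UNIV. \<Sum>t\<in>S r. g r t)"
    by (subst prod_sum_PiE) (use assms in auto)
  finally show ?thesis .
qed

lemma sum_grid_slice:
  fixes G :: "'a ^ 'p::finite \<Rightarrow> 'b::comm_monoid_add"
  assumes "\<And>r. finite (S r)"
  shows "(\<Sum>y\<in>grid S. G y) = (\<Sum>y\<in>grid (S(r := {z})). \<Sum>t\<in>S r. G (vupd y r t))"
proof -
  have "(\<Sum>y\<in>grid (S(r := {z})). \<Sum>t\<in>S r. G (vupd y r t))
      = (\<Sum>(y, t)\<in>grid (S(r := {z})) \<times> S r. G (vupd y r t))"
    by (simp add: sum.cartesian_product)
  also have "\<dots> = (\<Sum>y\<in>grid S. G y)"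
    by (rule sum.reindex_bij_witness[where i = "\<lambda>y. (vupd y r z, y $ r)" and j = "\<lambda>(y, t). vupd y r t"])
       (auto simp: grid_def vec_eq_iff split: if_splits)
  finally show ?thesis by simp
qed

text \<open>
  Any finite grid that contains the support may be used to evaluate the functional; this allows two
  products with different supports to be compared over a common grid.
\<close>

lemma tensor_on:
  assumes "\<And>r. finite (S r)" "\<And>r t. W r t \<noteq> 0 \<Longrightarrow> t \<in> S r"
  shows "tensor W h = (\<Sum>y\<in>grid S. (\<Prod>r\<in>UNIV. W r (y $ r)) * h y)"
  unfolding tensor_def
proof (rule sum.mono_neutral_left)
  show "finite (grid S)" using assms by (intro finite_grid)
  show "grid (\<lambda>r. {t. W r t \<noteq> 0}) \<subseteq> grid S" using assms by (auto simp: grid_def)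
  show "\<forall>y\<in>grid S - grid (\<lambda>r. {t. W r t \<noteq> 0}). (\<Prod>r\<in>UNIV. W r (y $ r)) * h y = 0"
    by (auto simp: grid_def)
qed

lemma finite_dirac [simp]: "finite {t. dirac c t \<noteq> 0}"
  by (simp add: dirac_def)

lemma dirac_nonzero [simp]: "dirac c t \<noteq> 0 \<longleftrightarrow> t = c" "dirac c t = 0 \<longleftrightarrow> t \<noteq> c"
  by (simp_all add: dirac_def)

lemma dirac_self [simp]: "dirac c c = 1"
  by (simp add: dirac_def)

lemma tensor_dirac: "tensor (\<lambda>r. dirac (c $ r)) h = h c"
proof -
  have "tensor (\<lambda>r. dirac (c $ r)) h = (\<Sum>y\<in>{c}. (\<Prod>r\<in>UNIV. dirac (c $ r) (y $ r)) * h y)"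
    unfolding tensor_def by (rule sum.cong) (auto simp: grid_def vec_eq_iff)
  then show ?thesis by simp
qed

text \<open>
  The functional is multilinear in the measures. Expanding a product of sums gives a sum over vectors
  of indices, which is how the multi-index sums of the theorem arise.
\<close>

lemma tensor_sum:
  fixes w :: "'p::finite \<Rightarrow> 'i \<Rightarrow> real \<Rightarrow> real"
  assumes I: "\<And>r. finite (I r)" and w: "\<And>r i. i \<in> I r \<Longrightarrow> finite {t. w r i t \<noteq> 0}"
  shows "tensor (\<lambda>r t. \<Sum>i\<in>I r. w r i t) h = (\<Sum>i\<in>grid I. tensor (\<lambda>r. w r (i $ r)) h)"
proof -
  define S where "S r = (\<Union>i\<in>I r. {t. w r i t \<noteq> 0})" for r
  have S: "finite (S r)" for r using I w by (auto simp: S_def)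
  have in_S: "t \<in> S r" if "w r i t \<noteq> 0" "i \<in> I r" for r t i
    using that by (auto simp: S_def)
  have "tensor (\<lambda>r t. \<Sum>i\<in>I r. w r i t) h
      = (\<Sum>y\<in>grid S. (\<Prod>r\<in>UNIV. \<Sum>i\<in>I r. w r i (y $ r)) * h y)"
    by (rule tensor_on[OF S]) (auto dest: sum.not_neutral_contains_not_neutral intro: in_S)
  also have "\<dots> = (\<Sum>y\<in>grid S. \<Sum>i\<in>grid I. (\<Prod>r\<in>UNIV. w r (i $ r) (y $ r)) * h y)"
  proof (rule sum.cong[OF refl])
    fix y
    show "(\<Prod>r\<in>UNIV. \<Sum>i\<in>I r. w r i (y $ r)) * h y
        = (\<Sum>i\<in>grid I. (\<Prod>r\<in>UNIV. w r (i $ r) (y $ r)) * h y)"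
      using sum_grid_prod[where S = I and g = "\<lambda>r i. w r i (y $ r)", symmetric] I
      by (simp add: sum_distrib_right)
  qed
  also have "\<dots> = (\<Sum>i\<in>grid I. \<Sum>y\<in>grid S. (\<Prod>r\<in>UNIV. w r (i $ r) (y $ r)) * h y)"
    by (rule sum.swap)
  also have "\<dots> = (\<Sum>i\<in>grid I. tensor (\<lambda>r. w r (i $ r)) h)"
    by (rule sum.cong[OF refl], rule tensor_on[OF S, symmetric]) (auto simp: grid_def intro: in_S)
  finally show ?thesis .
qed

lemma tensor_scale:
  assumes "\<And>r. finite {t. w r t \<noteq> 0}"
  shows "tensor (\<lambda>r t. c r * w r t) h = (\<Prod>r\<in>UNIV. c r) * tensor w h"
proof -
  have "tensor (\<lambda>r t. c r * w r t) h
      = (\<Sum>y\<in>grid (\<lambda>r. {t. w r t \<noteq> 0}). (\<Prod>r\<in>UNIV. c r * w r (y $ r)) * h y)"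
    by (rule tensor_on) (use assms in auto)
  also have "\<dots> = (\<Prod>r\<in>UNIV. c r) * tensor w h"
    by (simp add: tensor_def prod.distrib sum_distrib_left mult.assoc)
  finally show ?thesis .
qed

lemma tensor_diff:
  fixes u v :: "'p::finite \<Rightarrow> real \<Rightarrow> real"
  assumes "\<And>r. finite {t. u r t \<noteq> 0}" "\<And>r. finite {t. v r t \<noteq> 0}"
  shows "tensor (\<lambda>r t. u r t - v r t) h
    = (\<Sum>J\<in>UNIV. (- 1) ^ (CARD('p) - card J) * tensor (\<lambda>r. if r \<in> J then u r else v r) h)"
proof -
  define S where "S r = {t. u r t \<noteq> 0} \<union> {t. v r t \<noteq> 0}" for r
  have S: "finite (S r)" for r using assms by (auto simp: S_def)
  have "tensor (\<lambda>r t. u r t - v r t) h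
      = (\<Sum>y\<in>grid S. (\<Prod>r\<in>UNIV. u r (y $ r) - v r (y $ r)) * h y)"
    by (rule tensor_on[OF S]) (auto simp: S_def)
  also have "\<dots> = (\<Sum>y\<in>grid S. \<Sum>J\<in>UNIV. (- 1) ^ (CARD('p) - card J)
      * ((\<Prod>r\<in>UNIV. if r \<in> J then u r (y $ r) else v r (y $ r)) * h y))"
    by (simp add: prod_diff_conv_sum' sum_distrib_right mult.assoc prod.If_cases Compl_eq_Diff_UNIV)
  also have "\<dots> = (\<Sum>J\<in>UNIV. \<Sum>y\<in>grid S. (- 1) ^ (CARD('p) - card J)
      * ((\<Prod>r\<in>UNIV. if r \<in> J then u r (y $ r) else v r (y $ r)) * h y))"
    by (rule sum.swap)
  also have "\<dots> = (\<Sum>J\<in>UNIV. (- 1) ^ (CARD('p) - card J) * tensor (\<lambda>r. if r \<in> J then u r else v r) h)"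
  proof (rule sum.cong[OF refl])
    fix J :: "'p set"
    have "tensor (\<lambda>r. if r \<in> J then u r else v r) h
      = (\<Sum>y\<in>grid S. (\<Prod>r\<in>UNIV. (if r \<in> J then u r else v r) (y $ r)) * h y)"
      by (rule tensor_on[OF S]) (auto simp: S_def split: if_splits)
    moreover have "(if r \<in> J then u r else v r) t = (if r \<in> J then u r t else v r t)" for r t
      by simp
    ultimately show "(\<Sum>y\<in>grid S. (- 1) ^ (CARD('p) - card J)
      * ((\<Prod>r\<in>UNIV. if r \<in> J then u r (y $ r) else v r (y $ r)) * h y))
      = (- 1) ^ (CARD('p) - card J) * tensor (\<lambda>r. if r \<in> J then u r else v r) h"
      by (simp add: sum_distrib_left)
  qed
  finally show ?thesis .
qed

text \<open>
  The functional is a sum over coordinate \<open>r\<close> of functionals of the remaining coordinates. The unit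
  mass at an arbitrary point \<open>z\<close> only marks coordinate \<open>r\<close> as used up.
\<close>

lemma tensor_slice:
  fixes W :: "'p::finite \<Rightarrow> real \<Rightarrow> real"
  assumes W: "\<And>q. q \<noteq> r \<Longrightarrow> finite {t. W q t \<noteq> 0}" and T: "finite T" "\<And>t. u t \<noteq> 0 \<Longrightarrow> t \<in> T"
  shows "tensor (W(r := u)) h = (\<Sum>t\<in>T. u t * tensor (W(r := dirac z)) (\<lambda>y. h (vupd y r t)))"
proof -
  define S where "S = (\<lambda>q. {t. W q t \<noteq> 0})(r := T)"
  have S: "finite (S q)" for q using W T by (auto simp: S_def)
  have split: "(\<Prod>q\<in>UNIV. G q) = G r * (\<Prod>q\<in>UNIV - {r}. G q)" for G :: "'p \<Rightarrow> real"
    by (simp add: prod.remove)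
  have "tensor (W(r := u)) h = (\<Sum>y\<in>grid S. (\<Prod>q\<in>UNIV. (W(r := u)) q (y $ q)) * h y)"
    by (rule tensor_on[OF S]) (use T in \<open>auto simp: S_def\<close>)
  also have "\<dots> = (\<Sum>y\<in>grid (S(r := {z})). \<Sum>t\<in>T.
      (u t * (\<Prod>q\<in>UNIV - {r}. W q (y $ q))) * h (vupd y r t))"
    by (subst sum_grid_slice[OF S, where r = r and z = z], simp add: S_def split)
  also have "\<dots> = (\<Sum>t\<in>T. \<Sum>y\<in>grid (S(r := {z})).
      (u t * (\<Prod>q\<in>UNIV - {r}. W q (y $ q))) * h (vupd y r t))"
    by (rule sum.swap)
  also have "\<dots> = (\<Sum>t\<in>T. u t * tensor (W(r := dirac z)) (\<lambda>y. h (vupd y r t)))"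
  proof (rule sum.cong[OF refl])
    fix t
    have "tensor (W(r := dirac z)) (\<lambda>y. h (vupd y r t))
      = (\<Sum>y\<in>grid (S(r := {z})). (\<Prod>q\<in>UNIV. (W(r := dirac z)) q (y $ q)) * h (vupd y r t))"
      by (rule tensor_on) (use W in \<open>auto simp: S_def\<close>)
    also have "\<dots> = (\<Sum>y\<in>grid (S(r := {z})). (\<Prod>q\<in>UNIV - {r}. W q (y $ q)) * h (vupd y r t))"
      unfolding split by (intro sum.cong refl) (auto simp: grid_def dest: spec[of _ r] intro!: prod.cong)
    finally show "(\<Sum>y\<in>grid (S(r := {z})). (u t * (\<Prod>q\<in>UNIV - {r}. W q (y $ q))) * h (vupd y r t))
       = u t * tensor (W(r := dirac z)) (\<lambda>y. h (vupd y r t))"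
      by (simp add: sum_distrib_left mult.assoc)
  qed
  finally show ?thesis .
qed


section \<open>The fundamental theorem of calculus on boxes\<close>

lemma has_partial_vupd:
  assumes "has_partial r h g"
  shows "((\<lambda>t. h (vupd x r t)) has_real_derivative g (vupd x r t)) (at t)"
proof -
  have eq: "vupd x r (s + t) = vupd x r t + s *\<^sub>R axis r 1" for s
    by (simp add: vec_eq_iff axis_def)
  have "((\<lambda>s. h (vupd x r (s + t))) has_real_derivative g (vupd x r t)) (at 0)"
    unfolding eq using assms by (simp add: has_partial_def)
  then show ?thesis
    using DERIV_shift[of "\<lambda>t. h (vupd x r t)" "g (vupd x r t)" 0 t] by simp
qed

lemma has_partialI_vupd:
  assumes "\<And>x. ((\<lambda>t. h (vupd x r t)) has_real_derivative g x) (at (x $ r))"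
  shows "has_partial r h g"
  unfolding has_partial_def
proof
  fix x :: "real ^ 'a"
  have eq: "vupd x r (s + x $ r) = x + s *\<^sub>R axis r 1" for s
    by (simp add: vec_eq_iff axis_def)
  show "((\<lambda>t. h (x + t *\<^sub>R axis r 1)) has_real_derivative g x) (at 0)"
    using DERIV_shift[of "\<lambda>t. h (vupd x r t)" "g x" 0 "x $ r"] assms[of x]
    unfolding eq by simp
qed

lemma has_iter_partial_face_diff:
  assumes "has_iter_partial rs h g" "r \<notin> set rs"
  shows "has_iter_partial rs (\<lambda>y. h (vupd y r b) - h (vupd y r a)) (\<lambda>y. g (vupd y r b) - g (vupd y r a))"
  using assms
proof (induction rs arbitrary: g)
  case (Cons s rs)
  then obtain h' where h': "has_iter_partial rs h h'" "has_partial s h' g" by auto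
  have "vupd (x + t *\<^sub>R axis s 1) r c = vupd x r c + t *\<^sub>R axis s 1" for x :: "real ^ 'a" and t c
    using Cons.prems by (simp add: vec_eq_iff axis_def)
  then have "has_partial s (\<lambda>y. h' (vupd y r b) - h' (vupd y r a)) (\<lambda>y. g (vupd y r b) - g (vupd y r a))"
    using h'(2) by (auto simp: has_partial_def intro!: DERIV_diff)
  then show ?case using Cons h' by auto
qed simp

lemma tensor_minus: "tensor W (\<lambda>y. h y - g y) = tensor W h - tensor W g"
  by (simp add: tensor_def right_diff_distrib sum_subtractf)

text \<open>
  Taking differences in coordinate \<open>r\<close> can be moved from the measure to the function. This is what makes
  induction over the coordinates possible.
\<close>

lemma tensor_face_diff:
  assumes W: "\<And>q. q \<noteq> r \<Longrightarrow> finite {t. W q t \<noteq> 0}"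
  shows "tensor (W(r := \<lambda>t. dirac b t - dirac a t)) h
    = tensor (W(r := dirac z)) (\<lambda>y. h (vupd y r b) - h (vupd y r a))"
proof -
  have "tensor (W(r := \<lambda>t. dirac b t - dirac a t)) h
      = (\<Sum>t\<in>{a, b}. (dirac b t - dirac a t) * tensor (W(r := dirac z)) (\<lambda>y. h (vupd y r t)))"
    by (rule tensor_slice) (use W in \<open>auto simp: dirac_def split: if_splits\<close>)
  then show ?thesis
    by (cases "a = b") (auto simp: tensor_minus dirac_def, simp add: tensor_def)
qed

lemma finite_dirac_diff [simp]: "finite {t. dirac b t \<noteq> dirac a t}"
  by (rule finite_subset[of _ "{a, b}"]) (auto simp: dirac_def)

text \<open>
  The alternating sum of \<open>h\<close> over the vertices of the box with corners \<open>a\<close> and \<open>b\<close>.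
\<close>

definition box_diff :: "real ^ 'p::finite \<Rightarrow> real ^ 'p \<Rightarrow> (real ^ 'p \<Rightarrow> real) \<Rightarrow> real"
  where "box_diff a b h = tensor (\<lambda>r t. dirac (b $ r) t - dirac (a $ r) t) h"

text \<open>
  A mean value theorem for alternating vertex sums. The head of the list is the direction in which \<open>h\<close>
  is differentiated last. The difference in this direction is therefore carried along as a face
  difference until the other derivatives have been found, and only then is the ordinary mean value
  theorem applied. So derivatives are taken in the order of the list only, as the definition of an
  antiderivative prescribes.
\<close>

lemma tensor_diff_mvt:
  fixes h g :: "real ^ 'p::finite \<Rightarrow> real"
  assumes "has_iter_partial rs h g" "distinct rs" "\<And>r. r \<in> set rs \<Longrightarrow> a $ r < b $ r"
  shows "\<exists>\<xi>. (\<forall>r. if r \<in> set rs then a $ r \<le> \<xi> $ r \<and> \<xi> $ r \<le> b $ r else \<xi> $ r = x $ r)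
    \<and> tensor (\<lambda>r. if r \<in> set rs then (\<lambda>t. dirac (b $ r) t - dirac (a $ r) t) else dirac (x $ r)) h
      = (\<Prod>r\<in>set rs. b $ r - a $ r) * g \<xi>"
  using assms
proof (induction rs arbitrary: h g)
  case Nil
  then show ?case by (intro exI[of _ x]) (simp add: tensor_dirac)
next
  case (Cons r rs)
  from Cons.prems obtain h' where h': "has_iter_partial rs h h'" "has_partial r h' g" by auto
  define W where "W = (\<lambda>q. if q \<in> set rs then (\<lambda>t. dirac (b $ q) t - dirac (a $ q) t) else dirac (x $ q))"
  have r: "r \<notin> set rs" using Cons.prems by simp
  have "has_iter_partial rs (\<lambda>y. h (vupd y r (b $ r)) - h (vupd y r (a $ r)))
    (\<lambda>y. h' (vupd y r (b $ r)) - h' (vupd y r (a $ r)))"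
    by (rule has_iter_partial_face_diff[OF h'(1) r])
  from Cons.IH[OF this] Cons.prems obtain \<xi> where
    \<xi>: "\<And>q. if q \<in> set rs then a $ q \<le> \<xi> $ q \<and> \<xi> $ q \<le> b $ q else \<xi> $ q = x $ q"
    and eq: "tensor W (\<lambda>y. h (vupd y r (b $ r)) - h (vupd y r (a $ r)))
      = (\<Prod>q\<in>set rs. b $ q - a $ q) * (h' (vupd \<xi> r (b $ r)) - h' (vupd \<xi> r (a $ r)))"
    unfolding W_def by auto
  have "\<exists>z>a $ r. z < b $ r \<and> h' (vupd \<xi> r (b $ r)) - h' (vupd \<xi> r (a $ r)) = (b $ r - a $ r) * g (vupd \<xi> r z)"
    using Cons.prems by (intro MVT2 has_partial_vupd[OF h'(2)]) auto
  then obtain z where z: "a $ r < z" "z < b $ r"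
    "h' (vupd \<xi> r (b $ r)) - h' (vupd \<xi> r (a $ r)) = (b $ r - a $ r) * g (vupd \<xi> r z)" by blast
  have "(\<lambda>q. if q \<in> set (r # rs) then (\<lambda>t. dirac (b $ q) t - dirac (a $ q) t) else dirac (x $ q))
      = W(r := \<lambda>t. dirac (b $ r) t - dirac (a $ r) t)"
    by (auto simp: W_def)
  moreover have "tensor (W(r := \<lambda>t. dirac (b $ r) t - dirac (a $ r) t)) h
      = tensor (W(r := dirac (x $ r))) (\<lambda>y. h (vupd y r (b $ r)) - h (vupd y r (a $ r)))"
    by (rule tensor_face_diff) (simp add: W_def)
  moreover have "W(r := dirac (x $ r)) = W" using r by (auto simp: W_def)
  ultimately have "tensor (\<lambda>q. if q \<in> set (r # rs) then (\<lambda>t. dirac (b $ q) t - dirac (a $ q) t) else dirac (x $ q)) h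
      = (\<Prod>q\<in>set (r # rs). b $ q - a $ q) * g (vupd \<xi> r z)"
    using eq z(3) r by (simp add: mult_ac)
  then show ?case
    using \<xi> z r by (intro exI[of _ "vupd \<xi> r z"]) (auto split: if_splits)
qed

lemma box_diff_mvt:
  fixes h g :: "real ^ 'p::finite \<Rightarrow> real"
  assumes "has_iter_partial rs h g" "distinct rs" "set rs = UNIV" "\<And>r. a $ r < b $ r"
  shows "\<exists>\<xi>\<in>cbox a b. box_diff a b h = (\<Prod>r\<in>UNIV. b $ r - a $ r) * g \<xi>"
  using tensor_diff_mvt[OF assms(1,2), of a b] assms(3,4) by (auto simp: box_diff_def mem_box_cart)

lemma box_diff_split: "box_diff a b h = box_diff a (vupd b r c) h + box_diff (vupd a r c) b h"
proof -
  define W where "W = (\<lambda>q t. dirac (b $ q) t - dirac (a $ q) t)"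
  define X where "X = tensor (W(r := dirac 0))"
  have X: "X (\<lambda>y. f y - g y) = X f - X g" for f g
    by (simp add: X_def tensor_minus)
  have *: "tensor (W(r := \<lambda>t. dirac v t - dirac u t)) h = X (\<lambda>y. h (vupd y r v)) - X (\<lambda>y. h (vupd y r u))" for u v
    unfolding X[symmetric] unfolding X_def by (rule tensor_face_diff) (simp add: W_def)
  have "W = W(r := \<lambda>t. dirac (b $ r) t - dirac (a $ r) t)"
    "(\<lambda>q t. dirac (vupd b r c $ q) t - dirac (a $ q) t) = W(r := \<lambda>t. dirac c t - dirac (a $ r) t)"
    "(\<lambda>q t. dirac (b $ q) t - dirac (vupd a r c $ q) t) = W(r := \<lambda>t. dirac (b $ r) t - dirac c t)"
    by (auto simp: W_def fun_eq_iff)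
  then have "box_diff a b h = X (\<lambda>y. h (vupd y r (b $ r))) - X (\<lambda>y. h (vupd y r (a $ r)))"
    "box_diff a (vupd b r c) h = X (\<lambda>y. h (vupd y r c)) - X (\<lambda>y. h (vupd y r (a $ r)))"
    "box_diff (vupd a r c) b h = X (\<lambda>y. h (vupd y r (b $ r))) - X (\<lambda>y. h (vupd y r c))"
    unfolding box_diff_def *[symmetric] by (simp_all add: W_def)
  then show ?thesis by simp
qed

lemma box_diff_degenerate:
  assumes "a $ r = b $ r"
  shows "box_diff a b h = 0"
proof -
  have "(\<Prod>r\<in>UNIV. dirac (b $ r) (y $ r) - dirac (a $ r) (y $ r)) = 0" for y :: "real ^ 'a"
    using assms by (intro prod_zero) (auto intro!: exI[of _ r])
  then show ?thesis by (simp only: box_diff_def tensor_def mult_zero_left sum.neutral_const)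
qed

text \<open>
  Alternating vertex sums are additive when a box is cut by a coordinate hyperplane, hence add up over
  the pieces of every division.
\<close>

lemma operative_box_diff:
  fixes h :: "real ^ 'p::finite \<Rightarrow> real"
  defines "G \<equiv> \<lambda>K. if K = {} then 0 else box_diff (interval_lowerbound K) (interval_upperbound K) h"
  shows "operative (+) 0 G"
proof
  have G0: "G {} = 0" by (simp add: G_def)
  have G: "G (cbox a b) = (if cbox a b = {} then 0 else box_diff a b h)" for a b
    by (simp add: G_def)
  show "G (cbox a b) = 0" if "box a b = {}" for a b
  proof (cases "cbox a b = {}")
    case False
    moreover obtain r where "b $ r \<le> a $ r"
      using \<open>box a b = {}\<close> by (auto simp: interval_eq_empty_cart)
    ultimately have "a $ r = b $ r"
      by (auto simp: interval_ne_empty_cart intro: order.antisym)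
    then show ?thesis by (simp add: G box_diff_degenerate)
  qed (simp add: G_def)
  show "G (cbox a b) = G (cbox a b \<inter> {x. x \<bullet> k \<le> c}) + G (cbox a b \<inter> {x. c \<le> x \<bullet> k})"
    if k: "k \<in> Basis" for a b c and k :: "real ^ 'p"
  proof (cases "cbox a b = {}")
    case True
    then show ?thesis by (simp add: G_def)
  next
    case ne: False
    obtain r where r: "k = axis r 1" using k by (auto simp: Basis_vec_def)
    have le: "a $ q \<le> b $ q" for q using ne by (auto simp: interval_ne_empty_cart)
    have L: "cbox a b \<inter> {x. x \<bullet> k \<le> c} = cbox a (vupd b r (min (b $ r) c))"
      unfolding r using interval_split_cart(1)[of a b r c] by (simp add: vupd_def inner_axis interval_cbox_cart)
    have R: "cbox a b \<inter> {x. c \<le> x \<bullet> k} = cbox (vupd a r (max (a $ r) c)) b"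
      unfolding r using interval_split_cart(2)[of a b c r] by (simp add: vupd_def inner_axis interval_cbox_cart)
    consider "c < a $ r" | "b $ r < c" | "a $ r \<le> c" "c \<le> b $ r" by linarith
    then show ?thesis
    proof cases
      case 1
      then have "cbox a (vupd b r (min (b $ r) c)) = {}"
        by (auto simp: interval_eq_empty_cart intro!: exI[of _ r])
      with 1 show ?thesis unfolding L R by (simp add: G[of a b] G0 max_def)
    next
      case 2
      then have "cbox (vupd a r (max (a $ r) c)) b = {}"
        by (auto simp: interval_eq_empty_cart intro!: exI[of _ r])
      with 2 show ?thesis unfolding L R by (simp add: G[of a b] G0 min_def)
    next
      case 3
      then have "cbox a (vupd b r c) \<noteq> {}" "cbox (vupd a r c) b \<noteq> {}"
        using le by (auto simp: interval_ne_empty_cart)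
      with 3 ne show ?thesis
        unfolding L R G using box_diff_split[of a b h r c] by (auto simp: min_def max_def split: if_splits)
    qed
  qed
qed

text \<open>
  On a small box the vertex sum is the volume times a value of \<open>f\<close> at some point of the box, by the mean
  value theorem, and the Riemann sum has the value at the tag instead. As \<open>f\<close> is uniformly continuous,
  the two differ little, while the vertex sums add up exactly. No iterated integrals are involved.
\<close>

theorem box_FTC:
  fixes F f :: "real ^ 'p::finite \<Rightarrow> real"
  assumes F: "has_iter_partial rs F f" "distinct rs" "set rs = UNIV"
    and cont: "continuous_on UNIV f" and le: "\<And>r. a $ r \<le> b $ r"
  shows "(f has_integral box_diff a b F) (cbox a b)"
  unfolding has_integral
proof (intro allI impI)
  fix e :: real assume "e > 0"
  define e' where "e' = e / (measure lborel (cbox a b) + 1)"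
  have "measure lborel (cbox a b) + 1 > 0" by (simp add: add_nonneg_pos)
  with \<open>e > 0\<close> have e': "e' > 0" "e' * measure lborel (cbox a b) < e"
    by (simp_all add: e'_def field_simps)
  have "uniformly_continuous_on (cbox a b) f"
    by (rule compact_uniformly_continuous) (use cont continuous_on_subset in auto)
  then obtain d where d: "d > 0"
    "\<And>x y. x \<in> cbox a b \<Longrightarrow> y \<in> cbox a b \<Longrightarrow> dist y x < d \<Longrightarrow> dist (f y) (f x) < e'"
    using e'(1) unfolding uniformly_continuous_on_def by metis
  define G where "G = (\<lambda>K. if K = {} then 0 else box_diff (interval_lowerbound K) (interval_upperbound K) F)"
  interpret operative "(+)" 0 G
    rewrites "comm_monoid_set.F (+) 0 = sum"
    using operative_box_diff[of F] by (auto simp: G_def sum_def)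
  show "\<exists>\<gamma>. gauge \<gamma> \<and> (\<forall>\<D>. \<D> tagged_division_of cbox a b \<and> \<gamma> fine \<D> \<longrightarrow>
      norm ((\<Sum>(x, k)\<in>\<D>. measure lborel k *\<^sub>R f x) - box_diff a b F) < e)"
  proof (intro exI conjI allI impI)
    show "gauge (\<lambda>x. ball x d)" using d(1) by (simp add: gauge_def)
    fix D assume "D tagged_division_of cbox a b \<and> (\<lambda>x. ball x d) fine D"
    then have D: "D tagged_division_of cbox a b" and fine: "(\<lambda>x. ball x d) fine D" by auto
    have ne: "cbox a b \<noteq> {}" using le by (auto simp: interval_ne_empty_cart)
    then have GD: "(\<Sum>(x, K)\<in>D. G K) = box_diff a b F"
      using tagged_division[OF D] by (simp add: G_def)
    have "norm ((\<Sum>(x, K)\<in>D. measure lborel K *\<^sub>R f x) - box_diff a b F)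
        = norm (\<Sum>(x, K)\<in>D. measure lborel K * f x - G K)"
      unfolding GD[symmetric] by (simp add: sum_subtractf[symmetric] split_def)
    also have "\<dots> \<le> (\<Sum>(x, K)\<in>D. e' * measure lborel K)"
    proof (rule sum_norm_le, clarify)
      fix x K assume xK: "(x, K) \<in> D"
      note x = tagged_division_ofD(2)[OF D xK] and sub = tagged_division_ofD(3)[OF D xK]
      obtain u v where K: "K = cbox u v" using tagged_division_ofD(4)[OF D xK] by auto
      have ball: "K \<subseteq> ball x d" using fine xK by (auto simp: fine_def)
      from x K have uv: "u $ r \<le> v $ r" for r by (auto simp: mem_box_cart intro: order_trans)
      have content: "measure lborel K = (\<Prod>r\<in>UNIV. v $ r - u $ r)"
        using x unfolding K by (intro content_cbox_cart) auto
      have GK: "G K = box_diff u v F" using x by (auto simp: G_def K)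
      show "norm (measure lborel K * f x - G K) \<le> e' * measure lborel K"
      proof (cases "\<exists>r. u $ r = v $ r")
        case True
        then obtain r where "u $ r = v $ r" by blast
        then have "measure lborel K = 0" unfolding content by (intro prod_zero bexI[of _ r]) auto
        moreover have "G K = 0" using True GK box_diff_degenerate by auto
        ultimately show ?thesis by simp
      next
        case False
        with uv have "u $ r < v $ r" for r by (metis order.not_eq_order_implies_strict)
        with box_diff_mvt[OF F] obtain \<xi> where \<xi>: "\<xi> \<in> K" "G K = measure lborel K * f \<xi>"
          unfolding GK content unfolding K by blast
        have "dist \<xi> x < d" using ball \<xi>(1) by (auto simp: dist_commute)
        then have "\<bar>f x - f \<xi>\<bar> < e'" using d(2)[of x \<xi>] \<xi>(1) x sub by (auto simp: dist_real_def abs_minus_commute)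
        moreover have "norm (measure lborel K * f x - G K) = measure lborel K * \<bar>f x - f \<xi>\<bar>"
          unfolding \<xi>(2) by (simp add: right_diff_distrib[symmetric] abs_mult)
        ultimately show ?thesis
          using mult_left_mono[of "\<bar>f x - f \<xi>\<bar>" e' "measure lborel K"] by (simp add: mult.commute)
      qed
    qed
    also have "\<dots> = e' * measure lborel (cbox a b)"
      using additive_content_tagged_division[OF D] by (simp add: sum_distrib_left[symmetric] split_def)
    also have "\<dots> < e" by (rule e')
    finally show "norm ((\<Sum>(x, K)\<in>D. measure lborel K *\<^sub>R f x) - box_diff a b F) < e" .
  qed
qed

lemma box_diff_vertices:
  fixes h :: "real ^ 'p::finite \<Rightarrow> real"
  shows "box_diff a b h = (\<Sum>J\<in>UNIV. (- 1) ^ (CARD('p) - card J) * h (\<chi> r. if r \<in> J then b $ r else a $ r))"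
proof -
  have "tensor (\<lambda>r. if r \<in> J then dirac (b $ r) else dirac (a $ r)) h
      = h (\<chi> r. if r \<in> J then b $ r else a $ r)" for J :: "'p set"
    using tensor_dirac[of "\<chi> r. if r \<in> J then b $ r else a $ r" h] by (simp add: if_distrib)
  then show ?thesis unfolding box_diff_def by (subst tensor_diff) auto
qed

lemma has_iter_partial_affine:
  assumes "has_iter_partial rs F f"
  shows "has_iter_partial rs (\<lambda>v. F (c + d * v)) (\<lambda>v. prod_list (map (($) d) rs) * f (c + d * v))"
  using assms
proof (induction rs arbitrary: f)
  case (Cons r rs)
  then obtain F' where F': "has_iter_partial rs F F'" "has_partial r F' f" by auto
  have eq: "c + d * (x + t *\<^sub>R axis r 1) = (c + d * x) + (d $ r * t) *\<^sub>R axis r 1" for x t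
    by (simp add: vec_eq_iff axis_def algebra_simps)
  have "((\<lambda>t. F' ((c + d * x) + (d $ r * t) *\<^sub>R axis r 1)) has_real_derivative f (c + d * x) * d $ r) (at 0)" for x
    by (rule DERIV_chain2[where f = "\<lambda>s. F' ((c + d * x) + s *\<^sub>R axis r 1)" and g = "\<lambda>t. d $ r * t"])
       (use F'(2) in \<open>auto simp: has_partial_def intro!: derivative_eq_intros\<close>)
  then have "has_partial r (\<lambda>v. prod_list (map (($) d) rs) * F' (c + d * v))
     (\<lambda>v. prod_list (map (($) d) (r # rs)) * f (c + d * v))"
    unfolding has_partial_def eq by (auto intro!: derivative_eq_intros)
  then show ?case using Cons.IH[OF F'(1)] by auto
qed simp

lemma continuous_on_vec_mult [continuous_intros]:
  fixes f g :: "'a::topological_space \<Rightarrow> real ^ 'p::finite"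
  assumes "continuous_on A f" "continuous_on A g"
  shows "continuous_on A (\<lambda>x. f x * g x)"
proof -
  have "continuous_on A (\<lambda>x. \<chi> r. f x $ r * g x $ r)"
    by (intro continuous_intros assms)
  then show ?thesis by (simp add: times_vec_def)
qed

lemma box_FTC_affine:
  fixes F f :: "real ^ 'p::finite \<Rightarrow> real"
  assumes F: "has_iter_partial rs F f" "distinct rs" "set rs = UNIV"
    and cont: "continuous_on UNIV f"
  shows "((\<lambda>v. (\<Prod>r\<in>UNIV. d $ r) * f (c + d * v)) has_integral box_diff (c - d) (c + d) F) (cbox (- 1) 1)"
proof -
  have "prod_list (map (($) d) rs) = (\<Prod>r\<in>UNIV. d $ r)"
    using F(2,3) by (metis prod.distinct_set_conv_list)
  then have "has_iter_partial rs (\<lambda>v. F (c + d * v)) (\<lambda>v. (\<Prod>r\<in>UNIV. d $ r) * f (c + d * v))"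
    using has_iter_partial_affine[OF F(1), of c d] by simp
  moreover have "continuous_on UNIV (\<lambda>v. (\<Prod>r\<in>UNIV. d $ r) * f (c + d * v))"
    by (intro continuous_intros continuous_on_compose2[OF cont]) auto
  ultimately have "((\<lambda>v. (\<Prod>r\<in>UNIV. d $ r) * f (c + d * v)) has_integral box_diff (- 1) 1 (\<lambda>v. F (c + d * v))) (cbox (- 1) 1)"
    using F(2,3) by (intro box_FTC) auto
  moreover have "box_diff (- 1) 1 (\<lambda>v. F (c + d * v)) = box_diff (c - d) (c + d) F"
    unfolding box_diff_vertices
    by (intro sum.cong refl arg_cong2[where f = "(*)"] arg_cong[where f = F]) (simp add: vec_eq_iff)
  ultimately show ?thesis by simp
qed

lemma box_diff_prod: "box_diff a b (\<lambda>x. \<Prod>r\<in>UNIV. \<Phi> r (x $ r)) = (\<Prod>r\<in>UNIV. \<Phi> r (b $ r) - \<Phi> r (a $ r))"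
proof -
  have "box_diff a b (\<lambda>x. \<Prod>r\<in>UNIV. \<Phi> r (x $ r))
      = (\<Sum>y\<in>grid (\<lambda>r. {a $ r, b $ r}). \<Prod>r\<in>UNIV. (dirac (b $ r) (y $ r) - dirac (a $ r) (y $ r)) * \<Phi> r (y $ r))"
    unfolding box_diff_def prod.distrib by (rule tensor_on) (auto simp: dirac_def split: if_splits)
  also have "\<dots> = (\<Prod>r\<in>UNIV. \<Sum>t\<in>{a $ r, b $ r}. (dirac (b $ r) t - dirac (a $ r) t) * \<Phi> r t)"
    by (rule sum_grid_prod) auto
  also have "\<dots> = (\<Prod>r\<in>UNIV. \<Phi> r (b $ r) - \<Phi> r (a $ r))"
  proof (rule prod.cong[OF refl])
    fix r
    show "(\<Sum>t\<in>{a $ r, b $ r}. (dirac (b $ r) t - dirac (a $ r) t) * \<Phi> r t) = \<Phi> r (b $ r) - \<Phi> r (a $ r)"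
      by (cases "a $ r = b $ r") (auto simp: dirac_def)
  qed
  finally show ?thesis .
qed

text \<open>
  Integrals of products of functions of one variable, from the same theorem: a product of antiderivatives
  is an antiderivative of the product.
\<close>

lemma has_integral_prod_box:
  fixes a b :: "real ^ 'p::finite"
  assumes D: "\<And>r t. (\<Phi> r has_real_derivative \<phi> r t) (at t)"
    and cont: "\<And>r. continuous_on UNIV (\<phi> r)" and le: "\<And>r. a $ r \<le> b $ r"
  shows "((\<lambda>v. \<Prod>r\<in>UNIV. \<phi> r (v $ r)) has_integral (\<Prod>r\<in>UNIV. \<Phi> r (b $ r) - \<Phi> r (a $ r))) (cbox a b)"
proof -
  obtain rs :: "'p list" where rs: "distinct rs" "set rs = UNIV"
    using finite_distinct_list[of "UNIV :: 'p set"] by auto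
  have step: "has_iter_partial rs (\<lambda>x. \<Prod>r\<in>UNIV. \<Phi> r (x $ r))
      (\<lambda>x. \<Prod>r\<in>UNIV. if r \<in> set rs then \<phi> r (x $ r) else \<Phi> r (x $ r))" if "distinct rs" for rs :: "'p list"
    using that
  proof (induction rs)
    case (Cons s rs)
    let ?G = "\<lambda>x. \<Prod>r\<in>UNIV. if r \<in> set rs then \<phi> r (x $ r) else \<Phi> r (x $ r)"
    have "has_partial s ?G (\<lambda>x. \<Prod>r\<in>UNIV. if r \<in> set (s # rs) then \<phi> r (x $ r) else \<Phi> r (x $ r))"
    proof (rule has_partialI_vupd)
      fix x :: "real ^ 'p"
      define c where "c = (\<Prod>r\<in>UNIV - {s}. if r \<in> set rs then \<phi> r (x $ r) else \<Phi> r (x $ r))"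
      have "?G (vupd x s t) = \<Phi> s t * c" for t
        using Cons.prems by (subst prod.remove[of _ s]) (auto simp: c_def intro!: prod.cong cong: if_cong)
      moreover have "(\<Prod>r\<in>UNIV. if r \<in> set (s # rs) then \<phi> r (x $ r) else \<Phi> r (x $ r)) = \<phi> s (x $ s) * c"
        by (subst prod.remove[of _ s]) (auto simp: c_def intro!: prod.cong)
      ultimately show "((\<lambda>t. ?G (vupd x s t)) has_real_derivative
         (\<Prod>r\<in>UNIV. if r \<in> set (s # rs) then \<phi> r (x $ r) else \<Phi> r (x $ r))) (at (x $ s))"
        by (simp only:) (intro DERIV_cmult_right D)
    qed
    then show ?case using Cons by auto
  qed simp
  have "continuous_on UNIV (\<lambda>x::real ^ 'p. \<Prod>r\<in>UNIV. \<phi> r (x $ r))"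
    by (intro continuous_intros continuous_on_compose2[OF cont]) auto
  from box_FTC[OF _ rs this le, of "\<lambda>x. \<Prod>r\<in>UNIV. \<Phi> r (x $ r)"] step[OF rs(1)] rs(2)
  show ?thesis by (simp add: box_diff_prod)
qed


section \<open>Mixed partial derivatives and the multivariate Taylor formula\<close>

lemma cont_diff_continuous: "cont_diff n h \<Longrightarrow> continuous_on UNIV h"
  by (cases n) auto

lemma cont_diff_antimono: "cont_diff n h \<Longrightarrow> k \<le> n \<Longrightarrow> cont_diff k h"
proof (induction n arbitrary: h k)
  case (Suc n)
  then show ?case by (cases k) (auto, blast)
qed simp

lemma cont_diff_iter_partial:
  assumes "cont_diff n h" "length rs \<le> n"
  shows "\<exists>g. has_iter_partial rs h g \<and> cont_diff (n - length rs) g"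
  using assms
proof (induction rs)
  case (Cons r rs)
  then obtain g where g: "has_iter_partial rs h g" "cont_diff (n - length rs) g" by auto
  moreover have "n - length rs = Suc (n - length (r # rs))" using Cons.prems by auto
  ultimately obtain g' where "has_partial r g g'" "cont_diff (n - length (r # rs)) g'" by auto
  with g show ?case by auto
qed simp

text \<open>
  Schwarz's theorem: over the same small rectangle at \<open>x\<close>, the second difference of \<open>h\<close> equals the area
  times a value of either mixed derivative, and both points tend to \<open>x\<close>.
\<close>

lemma mixed_partials_commute:
  fixes h :: "real ^ 'p::finite \<Rightarrow> real"
  assumes "has_iter_partial [s, r] h hrs" "has_iter_partial [r, s] h hsr"
    and cont: "continuous_on UNIV hrs" "continuous_on UNIV hsr" and ne: "r \<noteq> s"
  shows "hrs = hsr"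
proof
  fix x :: "real ^ 'p"
  \<comment> \<open>The rectangles with corners \<open>x\<close> and \<open>b n\<close> shrink to \<open>x\<close>.\<close>
  define b where "b n = (\<chi> i. x $ i + 1 / real (Suc n))" for n
  define T where "T n = tensor (\<lambda>q. if q \<in> {r, s} then (\<lambda>t. dirac (b n $ q) t - dirac (x $ q) t) else dirac (x $ q)) h" for n
  define V where "V n = (\<Prod>q\<in>{r, s}. b n $ q - x $ q)" for n
  have near: "\<exists>\<xi>. (\<forall>i. x $ i \<le> \<xi> $ i \<and> \<xi> $ i \<le> b n $ i) \<and> T n = V n * g \<xi>"
    if g: "has_iter_partial rs h g" "distinct rs" "set rs = {r, s}" for rs g n
  proof -
    obtain \<xi> where \<xi>: "\<And>i. if i \<in> {r, s} then x $ i \<le> \<xi> $ i \<and> \<xi> $ i \<le> b n $ i else \<xi> $ i = x $ i"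
      "T n = V n * g \<xi>"
      using tensor_diff_mvt[OF g(1,2), of x "b n" x] unfolding g(3) T_def V_def by (auto simp: b_def)
    have "x $ i \<le> \<xi> $ i \<and> \<xi> $ i \<le> b n $ i" for i
      using \<xi>(1)[of i] by (auto simp: b_def split: if_splits)
    with \<xi>(2) show ?thesis by blast
  qed
  have "\<forall>n. \<exists>\<xi>. (\<forall>i. x $ i \<le> \<xi> $ i \<and> \<xi> $ i \<le> b n $ i) \<and> T n = V n * hrs \<xi>"
    using near[OF assms(1)] ne by auto
  from choice[OF this] obtain \<xi> where \<xi>: "\<And>n i. x $ i \<le> \<xi> n $ i \<and> \<xi> n $ i \<le> b n $ i"
    and eq1: "\<And>n. T n = V n * hrs (\<xi> n)" by auto
  have "\<forall>n. \<exists>\<xi>. (\<forall>i. x $ i \<le> \<xi> $ i \<and> \<xi> $ i \<le> b n $ i) \<and> T n = V n * hsr \<xi>"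
    using near[OF assms(2)] ne by auto
  from choice[OF this] obtain \<zeta> where \<zeta>: "\<And>n i. x $ i \<le> \<zeta> n $ i \<and> \<zeta> n $ i \<le> b n $ i"
    and eq2: "\<And>n. T n = V n * hsr (\<zeta> n)" by auto
  have eq: "hrs (\<xi> n) = hsr (\<zeta> n)" for n
  proof -
    have "V n > 0" unfolding V_def by (intro prod_pos) (auto simp: b_def)
    then show ?thesis using eq1[of n] eq2[of n] by simp
  qed
  have lim: "X \<longlonglongrightarrow> x" if "\<And>n i. x $ i \<le> X n $ i \<and> X n $ i \<le> b n $ i" for X :: "nat \<Rightarrow> real ^ 'p"
  proof (rule vec_tendstoI)
    fix i
    have "(\<lambda>n. b n $ i) \<longlonglongrightarrow> x $ i + 0"
      unfolding b_def vec_lambda_beta by (intro tendsto_intros LIMSEQ_Suc[OF lim_1_over_n])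
    then have "(\<lambda>n. b n $ i) \<longlonglongrightarrow> x $ i" by simp
    then show "(\<lambda>n. X n $ i) \<longlonglongrightarrow> x $ i"
      by (rule tendsto_sandwich[OF _ _ tendsto_const, rotated 2]) (use that in auto)
  qed
  have "(\<lambda>n. hrs (\<xi> n)) \<longlonglongrightarrow> hrs x"
    using cont(1) lim[OF \<xi>] by (auto simp: continuous_on_eq_continuous_at intro: isCont_tendsto_compose)
  moreover have "(\<lambda>n. hrs (\<xi> n)) \<longlonglongrightarrow> hsr x"
    unfolding eq using cont(2) lim[OF \<zeta>] by (auto simp: continuous_on_eq_continuous_at intro: isCont_tendsto_compose)
  ultimately show "hrs x = hsr x" by (rule LIMSEQ_unique)
qed

lemma has_iter_partial_swap:
  assumes h: "has_iter_partial (r # s # rs) h g" "cont_diff n h" "Suc (Suc (length rs)) \<le> n"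
  shows "has_iter_partial (s # r # rs) h g"
proof (cases "r = s")
  case False
  obtain k where k: "has_iter_partial rs h k" "cont_diff (n - length rs) k"
    using cont_diff_iter_partial[OF h(2), of rs] h(3) by auto
  have k2: "cont_diff 2 k" using cont_diff_antimono[OF k(2), of 2] h(3) by auto
  from h(1) obtain h1 where h1: "has_partial s k h1" "has_partial r h1 g"
    using has_iter_partial_unique[OF k(1)] by auto
  obtain g1 where g1: "has_iter_partial [r, s] k g1" "continuous_on UNIV g1"
    using cont_diff_iter_partial[OF k2, of "[r, s]"] by auto
  obtain g2 where g2: "has_iter_partial [s, r] k g2" "continuous_on UNIV g2"
    using cont_diff_iter_partial[OF k2, of "[s, r]"] by auto
  have "g1 = g" using has_iter_partial_unique[OF g1(1), of g] h1 by auto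
  moreover have "g2 = g1" using mixed_partials_commute[OF g2(1) g1(1) g2(2) g1(2) False] .
  ultimately show ?thesis using g2(1) k(1) by auto
qed (use h in simp)

text \<open>
  A derivative taken last can be moved to its place in the sorted list of directions. This is the only
  reordering needed, because \<open>mpartial\<close> differentiates in sorted order.
\<close>

lemma has_iter_partial_insort:
  assumes "has_iter_partial (r # rs) h g" "cont_diff n h" "Suc (length rs) \<le> n"
  shows "has_iter_partial (insort r rs) h g"
  using assms
proof (induction rs arbitrary: g)
  case (Cons s rs)
  show ?case
  proof (cases "r \<le> s")
    case False
    have "has_iter_partial (s # r # rs) h g"
      by (rule has_iter_partial_swap[OF Cons.prems(1,2)]) (use Cons.prems(3) in simp)
    then obtain h' where "has_iter_partial (r # rs) h h'" "has_partial s h' g" by auto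
    with Cons False show ?thesis by auto
  qed (use Cons in auto)
qed auto

lemma count_concat_replicate:
  "distinct xs \<Longrightarrow> count (mset (concat (map (\<lambda>r. replicate (a r) r) xs))) q = (if q \<in> set xs then a q else 0)"
  by (induction xs) auto

lemma sorted_concat_replicate:
  "sorted xs \<Longrightarrow> sorted (concat (map (\<lambda>r. replicate (a r) r) xs))"
  by (induction xs) (auto simp: sorted_append)

lemma mset_deriv_list: "count (mset (deriv_list \<alpha>)) q = \<alpha> $ q"
  unfolding deriv_list_def by (subst count_concat_replicate) auto

lemma sorted_deriv_list: "sorted (deriv_list \<alpha>)"
  unfolding deriv_list_def by (intro sorted_concat_replicate) auto

lemma length_deriv_list: "length (deriv_list \<alpha>) = msize \<alpha>"
proof -
  have "length (deriv_list \<alpha>) = size (mset (deriv_list \<alpha>))" by simp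
  also have "\<dots> = (\<Sum>r\<in>UNIV. count (mset (deriv_list \<alpha>)) r)"
    unfolding size_multiset_overloaded_eq by (rule sum.mono_neutral_left) (auto simp flip: not_in_iff)
  finally show ?thesis by (simp add: mset_deriv_list msize_def)
qed

lemma deriv_list_unit: "deriv_list (axis r n) = replicate n r"
proof -
  have "deriv_list (axis r n) = sort (deriv_list (axis r n))"
    using sorted_deriv_list[of "axis r n"] by (simp add: sorted_sort_id)
  also have "\<dots> = replicate n r"
    by (rule properties_for_sort) (auto intro!: multiset_eqI simp: mset_deriv_list axis_def)
  finally show ?thesis .
qed

lemma deriv_list_Suc: "deriv_list (\<alpha> + axis r 1) = insort r (deriv_list \<alpha>)"
proof -
  have "sort (r # deriv_list \<alpha>) = deriv_list (\<alpha> + axis r 1)"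
    by (rule properties_for_sort)
       (auto intro!: multiset_eqI simp: mset_deriv_list axis_def sorted_deriv_list)
  then show ?thesis by (simp add: sorted_sort_id sorted_deriv_list)
qed

lemma continuous_mpartial:
  assumes "cont_diff n f" "msize \<alpha> \<le> n"
  shows "continuous_on UNIV (mpartial \<alpha> f)"
proof -
  obtain g where g: "has_iter_partial (deriv_list \<alpha>) f g" "cont_diff (n - msize \<alpha>) g"
    using cont_diff_iter_partial[OF assms(1), of "deriv_list \<alpha>"] assms(2) by (auto simp: length_deriv_list)
  moreover have "mpartial \<alpha> f = g" using g(1) by (intro mpartial_eqI) (simp add: has_mpartial_def)
  ultimately show ?thesis by (simp add: cont_diff_continuous)
qed

lemma msize_add_axis: "msize (\<alpha> + axis r 1) = Suc (msize \<alpha>)"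
  by (simp add: msize_def sum.distrib axis_def)

lemma has_partial_mpartial:
  assumes "cont_diff n f" "msize \<alpha> < n"
  shows "has_partial r (mpartial \<alpha> f) (mpartial (\<alpha> + axis r 1) f)"
proof -
  obtain g where g: "has_iter_partial (r # deriv_list \<alpha>) f g"
    using cont_diff_iter_partial[OF assms(1), of "r # deriv_list \<alpha>"] assms(2) by (auto simp: length_deriv_list)
  have "has_iter_partial (insort r (deriv_list \<alpha>)) f g"
    by (rule has_iter_partial_insort[OF g assms(1)]) (use assms(2) in \<open>simp add: length_deriv_list\<close>)
  then have "mpartial (\<alpha> + axis r 1) f = g"
    by (intro mpartial_eqI) (simp only: has_mpartial_def deriv_list_Suc)
  moreover obtain h' where h': "has_iter_partial (deriv_list \<alpha>) f h'" "has_partial r h' g"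
    using g by auto
  moreover have "mpartial \<alpha> f = h'" using h'(1) by (intro mpartial_eqI) (simp add: has_mpartial_def)
  ultimately show ?thesis by simp
qed

lemma mpartial_0:
  fixes f :: "real ^ 'a::{finite,linorder} \<Rightarrow> real"
  shows "mpartial 0 f = f"
proof (rule mpartial_eqI)
  have "deriv_list (0 :: (nat, 'a) vec) = []" using length_deriv_list[of "0 :: (nat, 'a) vec"] by (simp add: msize_def)
  then show "has_mpartial 0 f f" by (simp add: has_mpartial_def)
qed

text \<open>
  Differentiability along a line follows by adding one coordinate direction \<open>r\<close> at a time: on the plane
  spanned by the directions treated so far and \<open>r\<close>, one partial derivative exists and the other is
  continuous, which suffices for total differentiability.
\<close>

lemma chain_rule_line:
  fixes h :: "real ^ 'p::finite \<Rightarrow> real"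
  assumes g: "\<And>r. has_partial r h (g r)" and cont: "\<And>r. continuous_on UNIV (g r)"
  shows "((\<lambda>t. h (x + t *\<^sub>R u)) has_real_derivative (\<Sum>r\<in>UNIV. u $ r * g r (x + t *\<^sub>R u))) (at t)"
proof -
  define e where "e S = (\<chi> i. if i \<in> S then u $ i else 0)" for S
  have "((\<lambda>t. h (x + t *\<^sub>R e S)) has_real_derivative (\<Sum>r\<in>S. u $ r * g r x)) (at 0)"
    if "finite S" for S x using that
  proof (induction S)
    case empty
    have "e {} = 0" by (simp add: e_def vec_eq_iff)
    then show ?case by simp
  next
    case (insert r S)
    define P where "P a b = (x + a *\<^sub>R e S) + (b * u $ r) *\<^sub>R axis r 1" for a b
    have P: "P a a = x + a *\<^sub>R e (insert r S)" for a
      using insert.hyps by (auto simp: P_def e_def vec_eq_iff axis_def)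
    have P0: "P a 0 = x + a *\<^sub>R e S" for a by (simp add: P_def)
    have contP: "continuous_on UNIV (\<lambda>(a, b). P a b)"
      unfolding P_def split_def by (intro continuous_intros)
    have "((\<lambda>(a, b). h (P a b)) has_derivative
        (\<lambda>(ta, tb). (\<Sum>q\<in>S. u $ q * g q x) * ta + blinfun_mult_right (u $ r * g r (P 0 0)) tb))
        (at (0, 0) within UNIV \<times> UNIV)"
    proof (rule has_derivative_partialsI[where fy = "\<lambda>a b. blinfun_mult_right (u $ r * g r (P a b))"])
      show "((\<lambda>a. h (P a 0)) has_derivative (\<lambda>ta. (\<Sum>q\<in>S. u $ q * g q x) * ta)) (at 0 within UNIV)"
        using insert.IH by (simp add: P0 has_field_derivative_def)
    next
      fix a b :: real
      have "((\<lambda>t. h (P a b + t *\<^sub>R axis r 1)) has_real_derivative g r (P a b)) (at (u $ r * (b - b)))"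
        using g[of r] by (simp add: has_partial_def)
      then have "((\<lambda>b'. h (P a b + (u $ r * (b' - b)) *\<^sub>R axis r 1)) has_real_derivative
          g r (P a b) * u $ r) (at b)"
        by (rule DERIV_chain2[where f = "\<lambda>t. h (P a b + t *\<^sub>R axis r 1)" and g = "\<lambda>b'. u $ r * (b' - b)"])
           (auto intro!: derivative_eq_intros)
      moreover have "P a b + (u $ r * (b' - b)) *\<^sub>R axis r 1 = P a b'" for b'
        by (simp add: P_def vec_eq_iff algebra_simps)
      ultimately show "((\<lambda>b. h (P a b)) has_derivative
          blinfun_apply (blinfun_mult_right (u $ r * g r (P a b)))) (at b within UNIV)"
        by (simp add: has_field_derivative_def mult.commute)
    next
      have "continuous_on UNIV (\<lambda>(a, b). blinfun_mult_right (u $ r * g r (P a b)))"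
        using contP unfolding split_def
        by (intro continuous_intros bounded_linear.continuous_on[OF bounded_linear_blinfun_mult_right]
            continuous_on_compose2[OF cont]) auto
      then show "continuous (at (0, 0) within UNIV \<times> UNIV) (\<lambda>(a, b). blinfun_mult_right (u $ r * g r (P a b)))"
        by (simp add: continuous_on_eq_continuous_at)
    qed auto
    then have D: "((\<lambda>(a, b). h (P a b)) has_derivative
        (\<lambda>(ta, tb). (\<Sum>q\<in>S. u $ q * g q x) * ta + (u $ r * g r x) * tb)) (at (0, 0))"
      by (simp add: P0)
    have "((\<lambda>t. (\<lambda>(a, b). h (P a b)) (t, t)) has_derivative
        (\<lambda>t. (\<lambda>(ta, tb). (\<Sum>q\<in>S. u $ q * g q x) * ta + (u $ r * g r x) * tb) (t, t))) (at 0)"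
      by (rule has_derivative_compose[of "\<lambda>t. (t, t)" "\<lambda>t. (t, t)"]) (auto intro!: derivative_eq_intros D)
    moreover have "(\<lambda>t. (\<lambda>(ta, tb). (\<Sum>q\<in>S. u $ q * g q x) * ta + (u $ r * g r x) * tb) (t, t))
        = (*) (\<Sum>q\<in>insert r S. u $ q * g q x)"
      using insert.hyps by (simp add: fun_eq_iff distrib_right)
    ultimately show ?case by (simp add: P has_field_derivative_def)
  qed
  from this[of UNIV "x + t *\<^sub>R u"]
  have "((\<lambda>s. h ((x + t *\<^sub>R u) + s *\<^sub>R u)) has_real_derivative (\<Sum>r\<in>UNIV. u $ r * g r (x + t *\<^sub>R u))) (at 0)"
    by (simp add: e_def)
  moreover have "(x + t *\<^sub>R u) + s *\<^sub>R u = x + (s + t) *\<^sub>R u" for s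
    by (simp add: algebra_simps)
  ultimately show ?thesis
    using DERIV_shift[of "\<lambda>t. h (x + t *\<^sub>R u)" _ 0 t] by simp
qed

lemma finite_msize [simp]: "finite {\<alpha> :: nat ^ 'p::finite. msize \<alpha> = n}"
proof (rule finite_subset)
  show "{\<alpha> :: nat ^ 'p. msize \<alpha> = n} \<subseteq> grid (\<lambda>_. {..n})"
    by (auto simp: grid_def msize_def intro!: member_le_sum)
qed (auto intro: finite_grid)

lemma mpow_add_axis: "mpow u (\<alpha> + axis r 1) = u $ r * mpow u \<alpha>"
proof -
  have "mpow u (\<alpha> + axis r 1) = (\<Prod>q\<in>UNIV. u $ q ^ (\<alpha> $ q) * (if q = r then u $ r else 1))"
    unfolding mpow_def by (intro prod.cong) (auto simp: axis_def)
  then show ?thesis by (simp add: prod.distrib mpow_def)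
qed

lemma mfact_add_axis: "mfact (\<alpha> + axis r 1) = real (Suc (\<alpha> $ r)) * mfact \<alpha>"
proof -
  have "mfact (\<alpha> + axis r 1) = (\<Prod>q\<in>UNIV. fact (\<alpha> $ q) * (if q = r then real (Suc (\<alpha> $ r)) else 1))"
    unfolding mfact_def by (intro prod.cong) (auto simp: axis_def)
  then show ?thesis by (simp add: prod.distrib mfact_def)
qed

lemma mfact_pos [simp]: "mfact \<alpha> > 0"
  by (simp add: mfact_def prod_pos)

text \<open>
  Each \<open>\<alpha>\<close> of size \<open>n + 1\<close> arises from \<open>\<alpha> - e\<^sub>r\<close> for all \<open>r\<close> with \<open>\<alpha>\<^sub>r > 0\<close>, with weights
  \<open>1 / (\<alpha> - e\<^sub>r)! = \<alpha>\<^sub>r / \<alpha>!\<close> that add up to \<open>(n + 1) / \<alpha>!\<close>. This is the step both of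
  the multinomial theorem and of differentiating Taylor coefficients along a line.
\<close>

lemma sum_multi_index_Suc:
  fixes Q :: "nat ^ 'p::finite \<Rightarrow> real"
  shows "(\<Sum>\<alpha> | msize \<alpha> = n. mpow u \<alpha> / mfact \<alpha> * (\<Sum>r\<in>UNIV. u $ r * Q (\<alpha> + axis r 1)))
    = real (Suc n) * (\<Sum>\<alpha> | msize \<alpha> = Suc n. mpow u \<alpha> / mfact \<alpha> * Q \<alpha>)"
proof -
  have "real (Suc n) * (\<Sum>\<alpha> | msize \<alpha> = Suc n. mpow u \<alpha> / mfact \<alpha> * Q \<alpha>)
      = (\<Sum>\<alpha> | msize \<alpha> = Suc n. \<Sum>r\<in>UNIV. real (\<alpha> $ r) * (mpow u \<alpha> / mfact \<alpha> * Q \<alpha>))"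
    unfolding sum_distrib_left
  proof (rule sum.cong[OF refl])
    fix \<alpha> :: "nat ^ 'p" assume "\<alpha> \<in> {\<alpha>. msize \<alpha> = Suc n}"
    then have "Suc n = (\<Sum>r\<in>UNIV. \<alpha> $ r)" by (simp add: msize_def)
    then have "real (Suc n) = (\<Sum>r\<in>UNIV. real (\<alpha> $ r))" by (simp only: of_nat_sum)
    then show "real (Suc n) * (mpow u \<alpha> / mfact \<alpha> * Q \<alpha>)
        = (\<Sum>r\<in>UNIV. real (\<alpha> $ r) * (mpow u \<alpha> / mfact \<alpha> * Q \<alpha>))"
      by (simp only: sum_distrib_right)
  qed
  also have "\<dots> = (\<Sum>r\<in>UNIV. \<Sum>\<alpha> | msize \<alpha> = Suc n. real (\<alpha> $ r) * (mpow u \<alpha> / mfact \<alpha> * Q \<alpha>))"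
    by (rule sum.swap)
  also have "\<dots> = (\<Sum>r\<in>UNIV. \<Sum>\<alpha> | msize \<alpha> = n. mpow u \<alpha> / mfact \<alpha> * (u $ r * Q (\<alpha> + axis r 1)))"
  proof (rule sum.cong[OF refl])
    fix r :: 'p
    have "(\<Sum>\<alpha> | msize \<alpha> = Suc n. real (\<alpha> $ r) * (mpow u \<alpha> / mfact \<alpha> * Q \<alpha>))
        = (\<Sum>\<alpha> | msize \<alpha> = Suc n \<and> 0 < \<alpha> $ r. real (\<alpha> $ r) * (mpow u \<alpha> / mfact \<alpha> * Q \<alpha>))"
      by (rule sum.mono_neutral_right) auto
    also have "\<dots> = (\<Sum>\<alpha> | msize \<alpha> = n. mpow u \<alpha> / mfact \<alpha> * (u $ r * Q (\<alpha> + axis r 1)))"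
    proof (rule sum.reindex_bij_witness[where j = "\<lambda>\<alpha>. \<alpha> - axis r 1" and i = "\<lambda>\<alpha>. \<alpha> + axis r 1"])
      fix \<alpha> :: "nat ^ 'p" assume \<alpha>: "\<alpha> \<in> {\<alpha>. msize \<alpha> = Suc n \<and> 0 < \<alpha> $ r}"
      then show eq: "\<alpha> - axis r 1 + axis r 1 = \<alpha>" by (auto simp: vec_eq_iff axis_def)
      show "\<alpha> - axis r 1 \<in> {\<alpha>. msize \<alpha> = n}"
        using \<alpha> msize_add_axis[of "\<alpha> - axis r 1" r] unfolding eq by simp
      define \<beta> where "\<beta> = \<alpha> - axis r 1"
      have \<beta>: "\<alpha> = \<beta> + axis r 1" unfolding \<beta>_def eq ..
      have \<beta>r: "(\<beta> + axis r 1) $ r = Suc (\<beta> $ r)" by (simp add: axis_def)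
      have cancel: "S \<noteq> 0 \<Longrightarrow> a / M * (v * q) = S * (v * a / (S * M) * q)" for S a M v q :: real
        by simp
      show "mpow u (\<alpha> - axis r 1) / mfact (\<alpha> - axis r 1) * (u $ r * Q (\<alpha> - axis r 1 + axis r 1))
         = real (\<alpha> $ r) * (mpow u \<alpha> / mfact \<alpha> * Q \<alpha>)"
        unfolding \<beta>_def[symmetric] unfolding \<beta> mpow_add_axis mfact_add_axis \<beta>r
        by (rule cancel) simp
    qed (auto simp: axis_def msize_def sum.distrib)
    finally show "(\<Sum>\<alpha> | msize \<alpha> = Suc n. real (\<alpha> $ r) * (mpow u \<alpha> / mfact \<alpha> * Q \<alpha>))
      = (\<Sum>\<alpha> | msize \<alpha> = n. mpow u \<alpha> / mfact \<alpha> * (u $ r * Q (\<alpha> + axis r 1)))" .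
  qed
  also have "\<dots> = (\<Sum>\<alpha> | msize \<alpha> = n. mpow u \<alpha> / mfact \<alpha> * (\<Sum>r\<in>UNIV. u $ r * Q (\<alpha> + axis r 1)))"
    by (subst sum.swap) (simp add: sum_distrib_left)
  finally show ?thesis by simp
qed

lemma msize_0_iff [simp]: "msize \<alpha> = 0 \<longleftrightarrow> \<alpha> = 0"
  by (auto simp: msize_def vec_eq_iff)

lemma mpow_0 [simp]: "mpow u 0 = 1" and mfact_0 [simp]: "mfact 0 = 1"
  by (simp_all add: mpow_def mfact_def)

lemma multinomial:
  fixes u :: "real ^ 'p::finite"
  shows "(\<Sum>\<alpha> | msize \<alpha> = n. mpow u \<alpha> / mfact \<alpha>) = (\<Sum>r\<in>UNIV. u $ r) ^ n / fact n"
proof (induction n)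
  case (Suc n)
  have "real (Suc n) * (\<Sum>\<alpha> | msize \<alpha> = Suc n. mpow u \<alpha> / mfact \<alpha>)
      = (\<Sum>\<alpha> | msize \<alpha> = n. mpow u \<alpha> / mfact \<alpha>) * (\<Sum>r\<in>UNIV. u $ r)"
    using sum_multi_index_Suc[where n = n and u = u and Q = "\<lambda>_. 1"] by (simp add: sum_distrib_right)
  then have "(\<Sum>\<alpha> | msize \<alpha> = Suc n. mpow u \<alpha> / mfact \<alpha>)
      = (\<Sum>r\<in>UNIV. u $ r) ^ n / fact n * (\<Sum>r\<in>UNIV. u $ r) / real (Suc n)"
    unfolding Suc.IH by (metis nonzero_mult_div_cancel_left of_nat_neq_0)
  then show ?case by (simp add: mult_ac)
qed simp

text \<open>
  The one-variable Taylor formula for \<open>s \<mapsto> f (x + s u)\<close> on \<open>[0, 1]\<close>, whose \<open>n\<close>th derivative is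
  \<open>n! \<Sum> u\<^sup>\<alpha> / \<alpha>! f\<^bsup>(\<alpha>)\<^esup> (x + s u)\<close> over \<open>\<alpha>\<close> of size \<open>n\<close>.
\<close>

theorem taylor_mpartial:
  fixes f :: "real ^ 'p::{finite,linorder} \<Rightarrow> real"
  assumes f: "cont_diff N f" and N: "N > 0"
  shows "f (x + u) = (\<Sum>n<N. \<Sum>\<alpha> | msize \<alpha> = n. mpow u \<alpha> / mfact \<alpha> * mpartial \<alpha> f x)
    + real N * (\<Sum>\<alpha> | msize \<alpha> = N. mpow u \<alpha> / mfact \<alpha> *
        integral {0..1} (\<lambda>s. (1 - s) ^ (N - 1) * mpartial \<alpha> f (x + s *\<^sub>R u)))"
proof -
  define Df where "Df n s = fact n * (\<Sum>\<alpha> | msize \<alpha> = n. mpow u \<alpha> / mfact \<alpha> * mpartial \<alpha> f (x + s *\<^sub>R u))"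
    for n and s :: real
  have Df0: "Df 0 = (\<lambda>s. f (x + s *\<^sub>R u))"
    by (auto simp: Df_def mpartial_0 fun_eq_iff)
  have "(Df n has_vector_derivative Df (Suc n) t) (at t within {0..1})" if "n < N" for n t
  proof -
    have "(Df n has_real_derivative fact n * (\<Sum>\<alpha> | msize \<alpha> = n. mpow u \<alpha> / mfact \<alpha> *
        (\<Sum>r\<in>UNIV. u $ r * mpartial (\<alpha> + axis r 1) f (x + t *\<^sub>R u)))) (at t)"
      unfolding Df_def
    proof (intro DERIV_cmult DERIV_sum)
      fix \<alpha> :: "(nat, 'p) vec" assume "\<alpha> \<in> {\<alpha>. msize \<alpha> = n}"
      with that show "((\<lambda>s. mpartial \<alpha> f (x + s *\<^sub>R u)) has_real_derivative
         (\<Sum>r\<in>UNIV. u $ r * mpartial (\<alpha> + axis r 1) f (x + t *\<^sub>R u))) (at t)"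
        by (intro chain_rule_line has_partial_mpartial[OF f] continuous_mpartial[OF f])
          (auto simp: msize_add_axis simp del: One_nat_def)
    qed
    also have "fact n * (\<Sum>\<alpha> | msize \<alpha> = n. mpow u \<alpha> / mfact \<alpha> *
        (\<Sum>r\<in>UNIV. u $ r * mpartial (\<alpha> + axis r 1) f (x + t *\<^sub>R u))) = Df (Suc n) t"
      unfolding Df_def sum_multi_index_Suc[where Q = "\<lambda>\<alpha>. mpartial \<alpha> f (x + t *\<^sub>R u)"] by simp
    finally show ?thesis
      by (simp add: has_real_derivative_iff_has_vector_derivative has_vector_derivative_at_within)
  qed
  from Taylor_has_integral[where a = 0 and b = 1 and Df = Df and p = N and f = "\<lambda>s. f (x + s *\<^sub>R u)",
      OF N Df0 this]
  have "((\<lambda>s. (1 - s) ^ (N - 1) / fact (N - 1) * Df N s) has_integral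
      f (x + u) - (\<Sum>i<N. 1 / fact i * Df i 0)) {0..1}"
    by simp
  moreover have "((\<lambda>s. (1 - s) ^ (N - 1) / fact (N - 1) * Df N s) has_integral
     real N * (\<Sum>\<alpha> | msize \<alpha> = N. mpow u \<alpha> / mfact \<alpha> *
        integral {0..1} (\<lambda>s. (1 - s) ^ (N - 1) * mpartial \<alpha> f (x + s *\<^sub>R u)))) {0..1}"
  proof -
    have "((\<lambda>s. real N * (\<Sum>\<alpha> | msize \<alpha> = N. mpow u \<alpha> / mfact \<alpha> * ((1 - s) ^ (N - 1) * mpartial \<alpha> f (x + s *\<^sub>R u))))
      has_integral real N * (\<Sum>\<alpha> | msize \<alpha> = N. mpow u \<alpha> / mfact \<alpha> *
        integral {0..1} (\<lambda>s. (1 - s) ^ (N - 1) * mpartial \<alpha> f (x + s *\<^sub>R u)))) {0..1}"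
      by (intro has_integral_mult_right has_integral_sum integrable_integral integrable_continuous_real
          continuous_intros continuous_on_compose2[OF continuous_mpartial[OF f]]) auto
    moreover have "real N * (\<Sum>\<alpha> | msize \<alpha> = N. mpow u \<alpha> / mfact \<alpha> * ((1 - s) ^ (N - 1) * mpartial \<alpha> f (x + s *\<^sub>R u)))
      = (1 - s) ^ (N - 1) / fact (N - 1) * Df N s" for s
      using N by (simp add: Df_def sum_distrib_left fact_reduce[of N] field_simps)
    ultimately show ?thesis by simp
  qed
  ultimately have "f (x + u) - (\<Sum>i<N. 1 / fact i * Df i 0) =
     real N * (\<Sum>\<alpha> | msize \<alpha> = N. mpow u \<alpha> / mfact \<alpha> *
        integral {0..1} (\<lambda>s. (1 - s) ^ (N - 1) * mpartial \<alpha> f (x + s *\<^sub>R u)))"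
    by (rule has_integral_unique)
  then show ?thesis by (simp add: Df_def)
qed


section \<open>Moments of the coefficients\<close>

lemma alternating_sum_Suc:
  fixes g :: "nat \<Rightarrow> real"
  shows "(\<Sum>i\<le>Suc n. (- 1) ^ i * real (Suc n choose i) * g i)
    = (\<Sum>i\<le>n. (- 1) ^ i * real (n choose i) * (g i - g (Suc i)))"
proof -
  have "(\<Sum>i\<le>n. (- 1) ^ i * real (n choose i) * g i) = (\<Sum>i\<le>Suc n. (- 1) ^ i * real (n choose i) * g i)"
    by simp
  also have "\<dots> = g 0 + (\<Sum>i\<le>n. (- 1) ^ Suc i * real (n choose Suc i) * g (Suc i))"
    by (subst sum.atMost_Suc_shift) simp
  finally have *: "(\<Sum>i\<le>n. (- 1) ^ i * real (n choose i) * g i)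
      = g 0 + (\<Sum>i\<le>n. (- 1) ^ Suc i * real (n choose Suc i) * g (Suc i))" .
  have "(\<Sum>i\<le>Suc n. (- 1) ^ i * real (Suc n choose i) * g i)
      = g 0 + (\<Sum>i\<le>n. (- 1) ^ Suc i * real (n choose Suc i) * g (Suc i)) +
        (\<Sum>i\<le>n. (- 1) ^ Suc i * real (n choose i) * g (Suc i))"
    by (subst sum.atMost_Suc_shift) (simp add: sum.distrib[symmetric] algebra_simps)
  then show ?thesis
    unfolding *[symmetric] by (simp add: sum_subtractf right_diff_distrib sum_negf)
qed

text \<open>
  An \<open>n\<close>th finite difference annihilates polynomials of degree less than \<open>n\<close>: one difference step lowers
  the degree by one.
\<close>

lemma alternating_binomial_power:
  fixes x :: real
  assumes "k < n"
  shows "(\<Sum>i\<le>n. (- 1) ^ i * real (n choose i) * (x + real i) ^ k) = 0"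
  using assms
proof (induction n arbitrary: k)
  case (Suc n)
  have "(x + real i) ^ k - (x + real (Suc i)) ^ k = - (\<Sum>l<k. real (k choose l) * (x + real i) ^ l)" for i
  proof -
    have "(x + real (Suc i)) ^ k = ((x + real i) + 1) ^ k" by (simp add: add_ac)
    also have "\<dots> = (\<Sum>l\<le>k. real (k choose l) * (x + real i) ^ l)" by (simp add: binomial_ring)
    finally show ?thesis by (simp add: lessThan_Suc_atMost[symmetric])
  qed
  then have "(\<Sum>i\<le>Suc n. (- 1) ^ i * real (Suc n choose i) * (x + real i) ^ k)
      = - (\<Sum>i\<le>n. \<Sum>l<k. real (k choose l) * ((- 1) ^ i * real (n choose i) * (x + real i) ^ l))"
    unfolding alternating_sum_Suc by (simp add: sum_negf sum_distrib_left mult_ac)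
  also have "\<dots> = - (\<Sum>l<k. real (k choose l) * (\<Sum>i\<le>n. (- 1) ^ i * real (n choose i) * (x + real i) ^ l))"
    by (subst sum.swap) (simp add: sum_distrib_left)
  also have "\<dots> = 0" using Suc by simp
  finally show ?case .
qed simp

text \<open>
  Up to the factor \<open>- 2 / (2m choose m)\<close>, this is the half \<open>j > 0\<close> of the vanishing sum
  \<open>\<Sum> (-1)\<^sup>j (2m choose (m + j)) j\<^bsup>2q\<^esup>\<close> over \<open>-m \<le> j \<le> m\<close>, which is symmetric in \<open>j\<close>. The term
  \<open>j = 0\<close> contributes only if \<open>q = 0\<close>.
\<close>

lemma gam_moment:
  assumes "q < m"
  shows "(\<Sum>j\<in>{1..m}. gam m j * real j ^ (2 * q + 1)) = (if q = 0 then 1 else 0)"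
proof -
  define h where "h i = (- 1) ^ i * real (2 * m choose i) * (- real m + real i) ^ (2 * q)" for i
  define s where "s = (\<Sum>j\<in>{1..m}. (- 1) ^ j * real (2 * m choose (m + j)) * real j ^ (2 * q))"
  have sgn: "(- 1) ^ (m - j) = (- 1) ^ m * (- 1 :: real) ^ j" if "j \<le> m" for j
    using that by (simp add: minus_one_power_iff)
  have "0 = (\<Sum>i\<le>2 * m. h i)"
    unfolding h_def using assms by (subst alternating_binomial_power) auto
  also have "{..2 * m} = (\<lambda>j. m - j) ` {1..m} \<union> ({m} \<union> (\<lambda>j. m + j) ` {1..m})"
  proof -
    have "i \<in> (\<lambda>j. m - j) ` {1..m}" if "i < m" for i
      using that by (intro image_eqI[of _ _ "m - i"]) auto
    moreover have "i \<in> (\<lambda>j. m + j) ` {1..m}" if "i > m" "i \<le> 2 * m" for i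
      using that by (intro image_eqI[of _ _ "i - m"]) auto
    ultimately show ?thesis by (auto simp: not_le)
  qed
  also have "(\<Sum>i\<in>\<dots>. h i) = (\<Sum>i\<in>(\<lambda>j. m - j) ` {1..m}. h i) + (h m + (\<Sum>i\<in>(\<lambda>j. m + j) ` {1..m}. h i))"
    by (subst sum.union_disjoint, (auto)[3], subst sum.union_disjoint, auto)
  also have "(\<Sum>i\<in>(\<lambda>j. m - j) ` {1..m}. h i) = (- 1) ^ m * s"
    unfolding s_def sum_distrib_left
  proof (subst sum.reindex)
    show "inj_on ((-) m) {1..m}" by (auto simp: inj_on_def)
    show "sum (h \<circ> (-) m) {1..m} = (\<Sum>j\<in>{1..m}. (- 1) ^ m * ((- 1) ^ j * real (2 * m choose (m + j)) * real j ^ (2 * q)))"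
    proof (rule sum.cong[OF refl])
      fix j assume "j \<in> {1..m}"
      then have j: "j \<le> m" by simp
      have "2 * m choose (m - j) = 2 * m choose (m + j)"
        using binomial_symmetric[of "m + j" "2 * m"] j by simp
      then show "(h \<circ> (-) m) j = (- 1) ^ m * ((- 1) ^ j * real (2 * m choose (m + j)) * real j ^ (2 * q))"
        using j by (simp add: h_def sgn)
    qed
  qed
  also have "(\<Sum>i\<in>(\<lambda>j. m + j) ` {1..m}. h i) = (- 1) ^ m * s"
    unfolding s_def sum_distrib_left by (subst sum.reindex) (auto simp: h_def power_add mult_ac)
  also have "h m = (- 1) ^ m * (real (2 * m choose m) * (if q = 0 then 1 else 0))"
    by (simp add: h_def)
  finally have "(- 1) ^ m * (2 * s + real (2 * m choose m) * (if q = 0 then 1 else 0)) = 0"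
    by (simp add: algebra_simps)
  then have s: "- 2 * s = real (2 * m choose m) * (if q = 0 then 1 else 0)" by simp
  have "gam m j * real j ^ (2 * q + 1)
      = (- 2 / real (2 * m choose m)) * ((- 1) ^ j * real (2 * m choose (m + j)) * real j ^ (2 * q))"
    if "j \<in> {1..m}" for j
  proof -
    have "real j > 0" using that by simp
    moreover have "(- 1) ^ (j - 1) = - ((- 1 :: real) ^ j)" using that by (cases j) auto
    ultimately show ?thesis by (simp add: gam_def field_simps)
  qed
  then have "(\<Sum>j\<in>{1..m}. gam m j * real j ^ (2 * q + 1)) = (- 2 / real (2 * m choose m)) * s"
    unfolding s_def sum_distrib_left by (intro sum.cong refl) auto
  also have "\<dots> = (- 2 * s) / real (2 * m choose m)" by simp
  also have "\<dots> = (if q = 0 then 1 else 0)" unfolding s by simp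
  finally show ?thesis .
qed

lemma tau_eq: "tau m a = (\<Sum>j | a \<le> j \<and> j \<le> m \<and> even (j - a). gam m j)"
proof -
  have fin: "finite {b. a + 2 * b \<le> m}" by (rule finite_subset[of _ "{..m}"]) auto
  have "tau m a = (\<Sum>b | a + 2 * b \<le> m. gam m (a + 2 * b))"
    unfolding tau_def by (rule suminf_finite[OF fin]) (simp add: gam_def)
  also have "\<dots> = (\<Sum>j | a \<le> j \<and> j \<le> m \<and> even (j - a). gam m j)"
    by (rule sum.reindex_bij_witness[where j = "\<lambda>b. a + 2 * b" and i = "\<lambda>j. (j - a) div 2"]) auto
  finally show ?thesis .
qed

lemma tau_eq_0: "m < a \<Longrightarrow> tau m a = 0"
  unfolding tau_eq by (rule sum.neutral) auto

text \<open>
  The point \<open>(j - 1) / 2 - i\<close> is \<open>- \<beta> / 2\<close> with \<open>\<beta> = 2 i - j + 1\<close>. For given \<open>\<beta>\<close>, the contributing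
  \<open>j\<close> are \<open>1 + |\<beta>|, 3 + |\<beta>|, ...\<close>, and their weights add up to \<open>\<tau>\<close>.
\<close>

lemma gam_sum_eq_tau_sum:
  fixes \<phi> :: "real \<Rightarrow> real"
  shows "(\<Sum>j\<in>{1..m}. gam m j * (\<Sum>i<j. \<phi> ((real j - 1) / 2 - real i)))
    = (\<Sum>\<beta>\<in>{1 - int m..int m - 1}. tau m (1 + nat \<bar>\<beta>\<bar>) * \<phi> (- real_of_int \<beta> / 2))"
proof -
  \<comment> \<open>The indices \<open>j\<close> for which the point \<open>- \<beta> / 2\<close> occurs.\<close>
  define K where "K \<beta> = {j. 1 + nat \<bar>\<beta>\<bar> \<le> j \<and> j \<le> m \<and> even (j - (1 + nat \<bar>\<beta>\<bar>))}" for \<beta>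
  have fin: "finite (K \<beta>)" for \<beta> by (rule finite_subset[of _ "{..m}"]) (auto simp: K_def)
  have "(\<Sum>j\<in>{1..m}. gam m j * (\<Sum>i<j. \<phi> ((real j - 1) / 2 - real i)))
      = (\<Sum>(j, i)\<in>Sigma {1..m} (\<lambda>j. {..<j}). gam m j * \<phi> ((real j - 1) / 2 - real i))"
    by (simp add: sum.Sigma sum_distrib_left)
  also have "\<dots> = (\<Sum>(\<beta>, j)\<in>Sigma {1 - int m..int m - 1} K. gam m j * \<phi> (- real_of_int \<beta> / 2))"
  proof (rule sum.reindex_bij_witness)
    let ?to = "\<lambda>(j, i). (2 * int i - int j + 1, j)"
    let ?from = "\<lambda>(\<beta>, j). (j, nat ((\<beta> + int j - 1) div 2))"
    fix z assume "z \<in> Sigma {1..m} (\<lambda>j. {..<j})"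
    then obtain j i where z: "z = (j, i)" and ji: "1 \<le> j" "j \<le> m" "i < j" by auto
    show "?from (?to z) = z" by (simp add: z)
    have "even (j - (1 + nat \<bar>2 * int i - int j + 1\<bar>))"
    proof (cases "2 * int i - int j + 1 \<ge> 0")
      case True
      then have "j - (1 + nat \<bar>2 * int i - int j + 1\<bar>) = 2 * (j - i - 1)" using ji by auto
      then show ?thesis by (rule ssubst) simp
    next
      case False
      then have "j - (1 + nat \<bar>2 * int i - int j + 1\<bar>) = 2 * i" using ji by auto
      then show ?thesis by (rule ssubst) simp
    qed
    then show "?to z \<in> Sigma {1 - int m..int m - 1} K"
      using ji by (auto simp: K_def z)
    show "(case ?to z of (\<beta>, j) \<Rightarrow> gam m j * \<phi> (- real_of_int \<beta> / 2))
        = (case z of (j, i) \<Rightarrow> gam m j * \<phi> ((real j - 1) / 2 - real i))"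
    proof -
      have "- real_of_int (2 * int i - int j + 1) / 2 = (real j - 1) / 2 - real i"
        by (simp add: field_simps)
      then show ?thesis by (simp only: z prod.case)
    qed
  next
    let ?to = "\<lambda>(j, i). (2 * int i - int j + 1, j)"
    let ?from = "\<lambda>(\<beta>, j). (j, nat ((\<beta> + int j - 1) div 2))"
    fix z assume "z \<in> Sigma {1 - int m..int m - 1} K"
    then obtain \<beta> j where z: "z = (\<beta>, j)" and j: "j \<in> K \<beta>" by auto
    from j have "even (j - (1 + nat \<bar>\<beta>\<bar>))" unfolding K_def by blast
    then obtain c where c: "j - (1 + nat \<bar>\<beta>\<bar>) = 2 * c" by (elim evenE)
    then have "\<beta> + int j - 1 = (if \<beta> \<ge> 0 then 2 * (\<beta> + int c) else 2 * int c)"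
      using j by (auto simp: K_def)
    then have e: "2 * ((\<beta> + int j - 1) div 2) = \<beta> + int j - 1" by (auto split: if_splits)
    have nn: "\<beta> + int j - 1 \<ge> 0" using j by (auto simp: K_def)
    with e show "?to (?from z) = z" by (auto simp: z)
    show "?from z \<in> Sigma {1..m} (\<lambda>j. {..<j})"
      using e nn j by (auto simp: K_def z)
  qed
  also have "\<dots> = (\<Sum>\<beta>\<in>{1 - int m..int m - 1}. tau m (1 + nat \<bar>\<beta>\<bar>) * \<phi> (- real_of_int \<beta> / 2))"
    by (subst sum.Sigma[symmetric]) (auto simp: fin tau_eq K_def sum_distrib_right)
  finally show ?thesis .
qed

definition tau_moment :: "nat \<Rightarrow> nat \<Rightarrow> real"
  where "tau_moment m l = (\<Sum>\<beta>\<in>{1 - int m..int m - 1}. tau m (1 + nat \<bar>\<beta>\<bar>) * real_of_int \<beta> ^ l)"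

text \<open>
  Applying the one-variable functional to \<open>\<phi> (x + 1) - \<phi> (x - 1)\<close> makes the inner sum telescope to
  \<open>\<phi> j - \<phi> (- j)\<close>. For \<open>\<phi> x = x\<^bsup>l+1\<^esup>\<close> the result is then known from \<open>gam_moment\<close> and does not depend on
  \<open>m\<close>; the binomial expansion of the left side turns this into a recurrence for the moments.
\<close>

lemma tau_moment_recurrence:
  assumes "l < 2 * m"
  shows "(\<Sum>k\<le>l. real (Suc l choose k) * (1 - (- 1) ^ (Suc l - k)) * tau_moment m k) = (if l = 0 then 2 else 0)"
proof -
  have mom: "tau_moment m k = (\<Sum>j\<in>{1..m}. gam m j * (\<Sum>i<j. (2 * real i - real j + 1) ^ k))" for k
  proof -
    have "(\<Sum>j\<in>{1..m}. gam m j * (\<Sum>i<j. (- 2 * ((real j - 1) / 2 - real i)) ^ k)) = tau_moment m k"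
      unfolding gam_sum_eq_tau_sum[where \<phi> = "\<lambda>x. (- 2 * x) ^ k"] tau_moment_def by simp
    moreover have "- 2 * ((real j - 1) / 2 - real i) = 2 * real i - real j + 1" for i j
      by (simp add: field_simps)
    ultimately show ?thesis by (simp only:)
  qed
  have pow: "(\<Sum>k\<le>l. real (Suc l choose k) * (1 - (- 1) ^ (Suc l - k)) * x ^ k) = (x + 1) ^ Suc l - (x - 1) ^ Suc l" for x :: real
  proof -
    have "(x + 1) ^ Suc l - (x + (- 1)) ^ Suc l
        = (\<Sum>k\<le>Suc l. real (Suc l choose k) * (1 - (- 1) ^ (Suc l - k)) * x ^ k)"
      unfolding binomial_ring by (simp add: sum_subtractf[symmetric] algebra_simps)
    then show ?thesis by simp
  qed
  have tele: "(\<Sum>i<j. ((2 * real i - real j + 1) + 1) ^ Suc l - ((2 * real i - real j + 1) - 1) ^ Suc l)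
      = real j ^ Suc l - (- real j) ^ Suc l" for j
  proof -
    have "(\<Sum>i<n. ((2 * real i - real j + 1) + 1) ^ Suc l - ((2 * real i - real j + 1) - 1) ^ Suc l)
      = (2 * real n - real j) ^ Suc l - (- real j) ^ Suc l" for n
    proof (induction n)
      case (Suc n)
      have "2 * real n - real j + 1 + 1 = 2 * real (Suc n) - real j"
        "2 * real n - real j + 1 - 1 = 2 * real n - real j" by simp_all
      then show ?case using Suc by (simp only: sum.lessThan_Suc)
    qed simp
    from this[of j] show ?thesis by simp
  qed
  have "(\<Sum>k\<le>l. real (Suc l choose k) * (1 - (- 1) ^ (Suc l - k)) * tau_moment m k)
      = (\<Sum>k\<le>l. \<Sum>j\<in>{1..m}. gam m j * (\<Sum>i<j. real (Suc l choose k) * (1 - (- 1) ^ (Suc l - k)) * (2 * real i - real j + 1) ^ k))"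
    unfolding mom by (simp add: sum_distrib_left mult_ac)
  also have "\<dots> = (\<Sum>j\<in>{1..m}. gam m j * (\<Sum>i<j. \<Sum>k\<le>l. real (Suc l choose k) * (1 - (- 1) ^ (Suc l - k)) * (2 * real i - real j + 1) ^ k))"
    by (subst sum.swap, subst (2) sum.swap) (simp add: sum_distrib_left)
  also have "\<dots> = (\<Sum>j\<in>{1..m}. gam m j * (real j ^ Suc l - (- real j) ^ Suc l))"
    unfolding pow tele ..
  also have "\<dots> = (if l = 0 then 2 else 0)"
  proof (cases "even l")
    case True
    then obtain q where q: "l = 2 * q" by auto
    have "(\<Sum>j\<in>{1..m}. gam m j * (real j ^ Suc l - (- real j) ^ Suc l)) = 2 * (\<Sum>j\<in>{1..m}. gam m j * real j ^ (2 * q + 1))"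
      by (simp add: q sum_distrib_left mult_ac)
    then show ?thesis using gam_moment[of q m] assms q by auto
  next
    case False
    then show ?thesis by (auto simp: odd_pos elim!: oddE)
  qed
  finally show ?thesis .
qed

text \<open>
  The recurrence determines the moments, and it is the same for both orders.
\<close>

lemma tau_moment_eq:
  assumes "l < 2 * m" "l < 2 * m0"
  shows "tau_moment m l = tau_moment m0 l"
  using assms
proof (induction l rule: less_induct)
  case (less l)
  define c where "c k = real (Suc l choose k) * (1 - (- 1) ^ (Suc l - k))" for k
  have "(\<Sum>k\<le>l. c k * tau_moment m k) = (\<Sum>k\<le>l. c k * tau_moment m0 k)"
    unfolding c_def using tau_moment_recurrence[of l] less.prems by simp
  moreover have "(\<Sum>k<l. c k * tau_moment m k) = (\<Sum>k<l. c k * tau_moment m0 k)"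
    using less by (intro sum.cong) auto
  ultimately have "c l * tau_moment m l = c l * tau_moment m0 l"
    by (simp add: lessThan_Suc_atMost[symmetric])
  moreover have "c l \<noteq> 0" by (simp add: c_def)
  ultimately show ?case by simp
qed

lemma tau_moment_extend:
  assumes "m0 \<le> m"
  shows "tau_moment m0 l = (\<Sum>\<beta>\<in>{1 - int m..int m - 1}. tau m0 (1 + nat \<bar>\<beta>\<bar>) * real_of_int \<beta> ^ l)"
  unfolding tau_moment_def
  by (rule sum.mono_neutral_left) (use assms in \<open>auto intro!: tau_eq_0\<close>)


section \<open>The main terms as tensor products\<close>

text \<open>
  The one-variable measure whose tensor product is the main term: coordinate \<open>r\<close> of \<open>A\<^sup>J(n)\<close> has the
  measure for \<open>c = n\<^sub>r\<close> if \<open>r \<in> J\<close> and for \<open>c = 0\<close> otherwise.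
\<close>

definition A_weight :: "nat \<Rightarrow> real \<Rightarrow> real \<Rightarrow> real"
  where "A_weight m c t = (\<Sum>j\<in>{1..m}. gam m j * (\<Sum>i<j. dirac (c - 1 + real j / 2 - real i) t))"

lemma finite_sum_nonzero:
  assumes "finite I" "\<And>i. i \<in> I \<Longrightarrow> finite {t. w i t \<noteq> (0 :: real)}"
  shows "finite {t. (\<Sum>i\<in>I. w i t) \<noteq> 0}"
  by (rule finite_subset[of _ "\<Union>i\<in>I. {t. w i t \<noteq> 0}"])
     (use assms in \<open>auto dest: sum.not_neutral_contains_not_neutral\<close>)

lemma finite_mult_nonzero: "finite {t. w t \<noteq> (0 :: real)} \<Longrightarrow> finite {t. c * w t \<noteq> 0}"
  by (rule finite_subset[of _ "{t. w t \<noteq> 0}"]) auto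

lemma finite_A_weight [simp]: "finite {t. A_weight m c t \<noteq> 0}"
  unfolding A_weight_def by (intro finite_sum_nonzero finite_mult_nonzero) auto

lemma atLeastAtMost_vec_eq_grid: "{a..b} = grid (\<lambda>r. {a $ r..b $ r})" for a b :: "'a::order ^ 'p::finite"
  by (auto simp: grid_def less_eq_vec_def)

lemma below_eq_grid: "below n = grid (\<lambda>r. {..<n $ r})"
  by (auto simp: grid_def below_def)

lemma one_to_of_nat: "{1..of_nat m :: nat ^ 'p::finite} = grid (\<lambda>_. {1..m})"
  by (simp add: atLeastAtMost_vec_eq_grid of_nat_index)

lemma A_term_eq_tensor:
  "A_term m F J n = tensor (\<lambda>r. A_weight m ((rvec n * indvec J) $ r)) F"
proof -
  define c where "c = rvec n * indvec J"
  define w where "w r j t = (\<Sum>i<j. dirac (c $ r - 1 + real j / 2 - real i) t)" for r j t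
  have fin: "finite {t. w r j t \<noteq> 0}" for r j
    unfolding w_def by (intro finite_sum_nonzero) auto
  have inner: "(\<Sum>i\<in>below j. F (c - 1 + (1/2) *\<^sub>R rvec j - rvec i)) = tensor (\<lambda>r. w r (j $ r)) F" for j
  proof -
    have "tensor (\<lambda>r. w r (j $ r)) F = (\<Sum>i\<in>below j. tensor (\<lambda>r. dirac (c $ r - 1 + real (j $ r) / 2 - real (i $ r))) F)"
      unfolding w_def below_eq_grid
      by (rule tensor_sum[where w = "\<lambda>r i. dirac (c $ r - 1 + real (j $ r) / 2 - real i)"]) auto
    also have "\<dots> = (\<Sum>i\<in>below j. F (c - 1 + (1/2) *\<^sub>R rvec j - rvec i))"
    proof (rule sum.cong[OF refl])
      fix i
      show "tensor (\<lambda>r. dirac (c $ r - 1 + real (j $ r) / 2 - real (i $ r))) F = F (c - 1 + (1/2) *\<^sub>R rvec j - rvec i)"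
        using tensor_dirac[of "c - 1 + (1/2) *\<^sub>R rvec j - rvec i" F] by (simp add: rvec_def)
    qed
    finally show ?thesis by simp
  qed
  have "tensor (\<lambda>r. A_weight m (c $ r)) F = tensor (\<lambda>r t. \<Sum>j\<in>{1..m}. gam m j * w r j t) F"
    by (simp add: A_weight_def[abs_def] w_def)
  also have "\<dots> = (\<Sum>j\<in>{1..of_nat m}. tensor (\<lambda>r t. gam m (j $ r) * w r (j $ r) t) F)"
    unfolding one_to_of_nat by (rule tensor_sum) (auto intro: finite_mult_nonzero fin)
  also have "\<dots> = (\<Sum>j\<in>{1..of_nat m}. mgam m j * tensor (\<lambda>r. w r (j $ r)) F)"
    unfolding mgam_def by (intro sum.cong refl tensor_scale fin)
  finally show ?thesis unfolding A_term_def inner[symmetric] c_def by simp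
qed

lemma A_weight_eq_tau: "A_weight m c t = (\<Sum>\<beta>\<in>{1 - int m..int m - 1}. tau m (1 + nat \<bar>\<beta>\<bar>) * dirac (c - 1 / 2 - real_of_int \<beta> / 2) t)"
proof -
  have e: "c - 1 + real j / 2 - real i = c - 1 / 2 + ((real j - 1) / 2 - real i)" for i j
    by (simp add: field_simps)
  show ?thesis
    unfolding A_weight_def e gam_sum_eq_tau_sum[where \<phi> = "\<lambda>x. dirac (c - 1 / 2 + x) t"] by simp
qed

lemma A_term_eq_tau:
  "A_term m F J n = (\<Sum>\<beta>\<in>grid (\<lambda>_. {1 - int m..int m - 1}).
    (\<Prod>r\<in>UNIV. tau m (1 + nat \<bar>\<beta> $ r\<bar>)) * F (rvec n * indvec J - (1/2) *\<^sub>R 1 - (1/2) *\<^sub>R ivec \<beta>))"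
proof -
  define c where "c = rvec n * indvec J"
  have "A_term m F J n = tensor (\<lambda>r t. \<Sum>\<beta>\<in>{1 - int m..int m - 1}.
      tau m (1 + nat \<bar>\<beta>\<bar>) * dirac (c $ r - 1 / 2 - real_of_int \<beta> / 2) t) F"
    unfolding A_term_eq_tensor c_def A_weight_eq_tau[abs_def] ..
  also have "\<dots> = (\<Sum>\<beta>\<in>grid (\<lambda>_. {1 - int m..int m - 1}).
      tensor (\<lambda>r t. tau m (1 + nat \<bar>\<beta> $ r\<bar>) * dirac (c $ r - 1 / 2 - real_of_int (\<beta> $ r) / 2) t) F)"
    by (rule tensor_sum) (auto intro: finite_mult_nonzero)
  also have "\<dots> = (\<Sum>\<beta>\<in>grid (\<lambda>_. {1 - int m..int m - 1}).
    (\<Prod>r\<in>UNIV. tau m (1 + nat \<bar>\<beta> $ r\<bar>)) * F (c - (1/2) *\<^sub>R 1 - (1/2) *\<^sub>R ivec \<beta>))"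
  proof (rule sum.cong[OF refl])
    fix \<beta> :: "int ^ 'a"
    have "tensor (\<lambda>r. dirac (c $ r - 1 / 2 - real_of_int (\<beta> $ r) / 2)) F = F (c - (1/2) *\<^sub>R 1 - (1/2) *\<^sub>R ivec \<beta>)"
      using tensor_dirac[of "c - (1/2) *\<^sub>R 1 - (1/2) *\<^sub>R ivec \<beta>" F] by (simp add: ivec_def)
    then show "tensor (\<lambda>r t. tau m (1 + nat \<bar>\<beta> $ r\<bar>) * dirac (c $ r - 1 / 2 - real_of_int (\<beta> $ r) / 2) t) F
      = (\<Prod>r\<in>UNIV. tau m (1 + nat \<bar>\<beta> $ r\<bar>)) * F (c - (1/2) *\<^sub>R 1 - (1/2) *\<^sub>R ivec \<beta>)"
      by (subst tensor_scale) auto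
  qed
  finally show ?thesis by (simp add: c_def)
qed

lemma A_term_tau_int:
  "A_term m F J n = (\<Sum>\<beta>\<in>{1 - of_nat m..of_nat m - 1}.
     mtau m (1 + mabs \<beta>) * F (rvec n * indvec J - (1/2) *\<^sub>R 1 - (1/2) *\<^sub>R ivec \<beta>))"
  unfolding A_term_eq_tau mtau_def mabs_def
  by (rule sum.cong) (auto simp: atLeastAtMost_vec_eq_grid of_nat_index)

lemma A_term_tau_nat:
  fixes n :: "nat ^ 'p::finite"
  assumes "m \<ge> 1"
  shows "A_term m F J n = (\<Sum>\<alpha>\<in>{0..of_nat (m - 1)}. mtau m (1 + \<alpha>) *
     (\<Sum>\<beta>\<in>{\<beta>. mabs \<beta> = \<alpha>}. F (rvec n * indvec J - (1/2) *\<^sub>R 1 - (1/2) *\<^sub>R ivec \<beta>)))"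
proof -
  let ?G = "\<lambda>\<beta> :: int ^ 'p. F (rvec n * indvec J - (1/2) *\<^sub>R 1 - (1/2) *\<^sub>R ivec \<beta>)"
  let ?B = "{1 - of_nat m..of_nat m - 1 :: int ^ 'p}"
  let ?A = "{0..of_nat (m - 1) :: nat ^ 'p}"
  have fin: "finite ?B" "finite ?A"
    by (auto simp: atLeastAtMost_vec_eq_grid intro!: finite_grid)
  have mem: "\<beta> \<in> ?B \<longleftrightarrow> mabs \<beta> \<in> ?A" for \<beta> :: "int ^ 'p"
  proof -
    have "1 - int m \<le> b \<and> b \<le> int m - 1 \<longleftrightarrow> nat \<bar>b\<bar> \<le> m - 1" for b
      using assms by auto
    then show ?thesis
      by (auto simp: atLeastAtMost_vec_eq_grid grid_def mabs_def of_nat_index)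
  qed
  have "A_term m F J n = (\<Sum>\<alpha>\<in>?A. \<Sum>\<beta>\<in>{\<beta>\<in>?B. mabs \<beta> = \<alpha>}. mtau m (1 + mabs \<beta>) * ?G \<beta>)"
    unfolding A_term_tau_int using mem by (intro sum.group[symmetric] fin) auto
  also have "\<dots> = (\<Sum>\<alpha>\<in>?A. mtau m (1 + \<alpha>) * (\<Sum>\<beta>\<in>{\<beta>. mabs \<beta> = \<alpha>}. ?G \<beta>))"
  proof (rule sum.cong[OF refl])
    fix \<alpha> assume "\<alpha> \<in> ?A"
    then have "{\<beta>\<in>?B. mabs \<beta> = \<alpha>} = {\<beta>. mabs \<beta> = \<alpha>}" using mem by blast
    then show "(\<Sum>\<beta>\<in>{\<beta>\<in>?B. mabs \<beta> = \<alpha>}. mtau m (1 + mabs \<beta>) * ?G \<beta>)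
        = mtau m (1 + \<alpha>) * (\<Sum>\<beta>\<in>{\<beta>. mabs \<beta> = \<alpha>}. ?G \<beta>)"
      by (simp add: sum_distrib_left)
  qed
  finally show ?thesis .
qed

lemma A_term_at_origin:
  fixes F :: "real ^ 'p::finite \<Rightarrow> real"
  assumes "m \<ge> 1"
  shows "A_term m F J 0 = (\<Sum>\<alpha>\<in>{0..of_nat (m - 1)}. mtau m (1 + \<alpha>) *
     (\<Sum>\<beta>\<in>{\<beta>. mabs \<beta> = \<alpha>}. F ((1/2) *\<^sub>R ivec \<beta> - (1/2) *\<^sub>R 1)))"
proof -
  have "(\<Sum>\<beta>\<in>{\<beta>. mabs \<beta> = \<alpha>}. F (rvec 0 * indvec J - (1/2) *\<^sub>R 1 - (1/2) *\<^sub>R ivec \<beta>))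
      = (\<Sum>\<beta>\<in>{\<beta>. mabs \<beta> = \<alpha>}. F ((1/2) *\<^sub>R ivec \<beta> - (1/2) *\<^sub>R 1))" for \<alpha> :: "nat ^ 'p"
    by (rule sum.reindex_bij_witness[of _ uminus uminus])
       (auto simp: mabs_def vec_eq_iff rvec_def ivec_def intro!: arg_cong[where f = F])
  then show ?thesis unfolding A_term_tau_nat[OF assms] by simp
qed

lemma A_term_empty: "A_term m F {} n = A_term m F J 0"
proof -
  have "rvec n * indvec {} = rvec 0 * indvec J" by (simp add: vec_eq_iff rvec_def indvec_def)
  then show ?thesis by (simp add: A_term_def)
qed

text \<open>
  Both sides are \<open>\<Sum>\<^bsub>i < n + j\<^esub> \<psi> i - \<Sum>\<^bsub>i < j\<^esub> \<psi> i - \<Sum>\<^bsub>i < n\<^esub> \<psi> i\<close>: overlapping intervals of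
  length \<open>j\<close> starting at \<open>0, ..., n - 1\<close> have the same boundary terms as intervals of length \<open>n\<close> starting
  at \<open>0, ..., j - 1\<close>.
\<close>

lemma telescope_shift:
  fixes \<psi> :: "real \<Rightarrow> real"
  shows "(\<Sum>k<n. \<psi> (real k + real j) - \<psi> (real k)) = (\<Sum>i<j. \<psi> (real n + real i) - \<psi> (real i))"
proof (induction n)
  case (Suc n)
  have "(\<Sum>i<j. \<psi> (real (Suc n) + real i) - \<psi> (real n + real i)) = (\<Sum>i<j. \<psi> (real n + real (Suc i)) - \<psi> (real n + real i))"
    by (simp add: algebra_simps)
  also have "\<dots> = \<psi> (real n + real j) - \<psi> (real n)"
    using sum_lessThan_telescope[of "\<lambda>i. \<psi> (real n + real i)" j] by simp
  finally show ?case using Suc by (simp add: sum_subtractf)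
qed simp

text \<open>
  Both sides are tensor products of the same one-variable measure, by \<open>telescope_shift\<close>; on the right the
  product of the differences of the measures at \<open>n\<^sub>r\<close> and \<open>0\<close> is expanded over \<open>J\<close>.
\<close>

lemma sum_boxes_eq_A_terms:
  fixes n :: "nat ^ 'p::finite"
  shows "(\<Sum>j\<in>{1..of_nat m}. mgam m j * (\<Sum>k\<in>below n. box_diff (rvec k - (1/2) *\<^sub>R rvec j) (rvec k + (1/2) *\<^sub>R rvec j) F))
    = (\<Sum>J\<in>UNIV. (- 1) ^ (CARD('p) - card J) * A_term m F J n)"
proof -
  define d where "d k j t = dirac (real k + real j / 2) t - dirac (real k - real j / 2) t" for k j :: nat and t
  have find: "finite {t. d k j t \<noteq> 0}" for k j by (simp add: d_def)
  have inner: "(\<Sum>k\<in>below n. box_diff (rvec k - (1/2) *\<^sub>R rvec j) (rvec k + (1/2) *\<^sub>R rvec j) F)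
      = tensor (\<lambda>r t. \<Sum>k<n $ r. d k (j $ r) t) F" for j :: "nat ^ 'p"
  proof -
    have "tensor (\<lambda>r t. \<Sum>k<n $ r. d k (j $ r) t) F = (\<Sum>k\<in>below n. tensor (\<lambda>r. d (k $ r) (j $ r)) F)"
      unfolding below_eq_grid by (rule tensor_sum) (auto simp: find)
    then show ?thesis by (simp add: box_diff_def d_def[abs_def] rvec_def)
  qed
  have tele: "(\<Sum>k<N. d k j t) = (\<Sum>i<j. dirac (real N - 1 + real j / 2 - real i) t) - (\<Sum>i<j. dirac (0 - 1 + real j / 2 - real i) t)"
    for N j t
  proof -
    have "(\<Sum>k<N. d k j t) = (\<Sum>i<j. dirac (real N + real i - real j / 2) t - dirac (real i - real j / 2) t)"
      using telescope_shift[of "\<lambda>x. dirac (x - real j / 2) t" j N] by (simp add: d_def algebra_simps)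
    also have "\<dots> = (\<Sum>i<j. dirac (real N - 1 + real j / 2 - real i) t - dirac (0 - 1 + real j / 2 - real i) t)"
    proof (subst sum.nat_diff_reindex[symmetric, where n = j and g = "\<lambda>i. dirac (real N + real i - real j / 2) t - dirac (real i - real j / 2) t"],
        rule sum.cong[OF refl])
      fix i assume "i \<in> {..<j}"
      then have "real N + real (j - Suc i) - real j / 2 = real N - 1 + real j / 2 - real i"
        "real (j - Suc i) - real j / 2 = 0 - 1 + real j / 2 - real i"
        by (auto simp: field_simps)
      then show "dirac (real N + real (j - Suc i) - real j / 2) t - dirac (real (j - Suc i) - real j / 2) t
          = dirac (real N - 1 + real j / 2 - real i) t - dirac (0 - 1 + real j / 2 - real i) t"
        by (simp only:)
    qed
    finally show ?thesis by (simp add: sum_subtractf)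
  qed
  have w: "(\<Sum>j\<in>{1..m}. gam m j * (\<Sum>k<N. d k j t)) = A_weight m (real N) t - A_weight m 0 t" for N t
    unfolding tele A_weight_def by (simp add: right_diff_distrib sum_subtractf)
  have "(\<Sum>j\<in>{1..of_nat m}. mgam m j * (\<Sum>k\<in>below n. box_diff (rvec k - (1/2) *\<^sub>R rvec j) (rvec k + (1/2) *\<^sub>R rvec j) F))
      = (\<Sum>j\<in>{1..of_nat m}. tensor (\<lambda>r t. gam m (j $ r) * (\<Sum>k<n $ r. d k (j $ r) t)) F)"
    unfolding inner mgam_def
    by (intro sum.cong refl tensor_scale[symmetric] finite_sum_nonzero find) auto
  also have "\<dots> = tensor (\<lambda>r t. \<Sum>j\<in>{1..m}. gam m j * (\<Sum>k<n $ r. d k j t)) F"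
    unfolding one_to_of_nat
    by (rule tensor_sum[symmetric]) (auto intro!: finite_mult_nonzero finite_sum_nonzero find)
  also have "\<dots> = tensor (\<lambda>r t. A_weight m (real (n $ r)) t - A_weight m 0 t) F"
    unfolding w ..
  also have "\<dots> = (\<Sum>J\<in>UNIV. (- 1) ^ (CARD('p) - card J) * tensor (\<lambda>r. if r \<in> J then A_weight m (real (n $ r)) else A_weight m 0) F)"
    by (rule tensor_diff) auto
  also have "\<dots> = (\<Sum>J\<in>UNIV. (- 1) ^ (CARD('p) - card J) * A_term m F J n)"
  proof -
    have "(if r \<in> J then A_weight m (real (n $ r)) else A_weight m 0) = A_weight m ((rvec n * indvec J) $ r)" for r and J :: "'p set"
      by (simp add: rvec_def indvec_def)
    then show ?thesis by (simp add: A_term_eq_tensor)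
  qed
  finally show ?thesis .
qed

section \<open>Replacing one order by another in the main terms\<close>

lemma has_iter_partial_replicate:
  assumes "has_iter_partial (replicate N r) F G"
  shows "\<exists>D. D 0 = F \<and> D N = G \<and> (\<forall>i<N. has_partial r (D i) (D (Suc i)))"
  using assms
proof (induction N arbitrary: G)
  case (Suc N)
  then obtain H where H: "has_iter_partial (replicate N r) F H" "has_partial r H G" by auto
  from Suc.IH[OF H(1)] obtain D where D: "D 0 = F" "D N = H" "\<forall>i<N. has_partial r (D i) (D (Suc i))" by auto
  then show ?case using H(2) by (intro exI[of _ "D(Suc N := G)"]) (auto simp: less_Suc_eq)
qed auto

lemma filterlim_max_at_top_iff:
  "filterlim x max_at_top Fl \<longleftrightarrow> filterlim (\<lambda>n. Max (range (\<lambda>r. x n $ r))) at_top Fl"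
  unfolding max_at_top_def by (simp add: filterlim_filtercomap_iff o_def)

text \<open>
  A combination of values of \<open>F\<close> along direction \<open>r\<close> that annihilates polynomials of degree less than \<open>N\<close>
  sees only the Lagrange remainders of the Taylor expansion, which are values of \<open>\<partial>\<^sub>r\<^sup>N F\<close> at points that
  go to infinity together with \<open>x\<close>.
\<close>

lemma annihilating_combination_tendsto_0:
  fixes F G :: "real ^ 'p::finite \<Rightarrow> real" and d :: "int \<Rightarrow> real"
  assumes FG: "has_iter_partial (replicate N r) F G" and N: "N > 0"
    and G: "(G \<longlongrightarrow> 0) max_at_top" and B: "finite B"
    and d: "\<And>l. l < N \<Longrightarrow> (\<Sum>b\<in>B. d b * real_of_int b ^ l) = 0"
    and x: "filterlim x max_at_top Fl"
  shows "((\<lambda>n. \<Sum>b\<in>B. d b * F (vupd (x n) r (x n $ r - real_of_int b / 2))) \<longlongrightarrow> 0) Fl"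
proof -
  obtain D where D: "D 0 = F" "D N = G" "\<And>i. i < N \<Longrightarrow> has_partial r (D i) (D (Suc i))"
    using has_iter_partial_replicate[OF FG] by auto
  define P where "P y s t \<longleftrightarrow> \<bar>t\<bar> \<le> \<bar>s\<bar> \<and> F (vupd y r (y $ r + s)) = (\<Sum>i<N. D i y / fact i * s ^ i) + G (vupd y r (y $ r + t)) / fact N * s ^ N"
    for y and s t :: real
  \<comment> \<open>Taylor expansion in direction \<open>r\<close> about \<open>y\<close>, with remainder in Lagrange form.\<close>
  have P: "\<exists>t. P y s t" for y s
  proof -
    have "((\<lambda>t. D i (vupd y r (y $ r + t))) has_real_derivative D (Suc i) (vupd y r (y $ r + t))) (at t)" if "i < N" for i t
      using has_partial_vupd[OF D(3)[OF that], of y "t + y $ r"]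
        DERIV_shift[of "\<lambda>t. D i (vupd y r t)" _ t "y $ r"] by (simp add: add.commute)
    then have "\<exists>t. \<bar>t\<bar> \<le> \<bar>s\<bar> \<and> F (vupd y r (y $ r + s)) =
        (\<Sum>i<N. D i (vupd y r (y $ r + 0)) / fact i * s ^ i) + D N (vupd y r (y $ r + t)) / fact N * s ^ N"
      by (intro Maclaurin_bi_le[where diff = "\<lambda>i t. D i (vupd y r (y $ r + t))"]) (auto simp: D(1))
    then show ?thesis by (simp add: D(2) P_def)
  qed
  \<comment> \<open>The displacement at which the Lagrange remainder is evaluated.\<close>
  define \<theta> where "\<theta> y s = (SOME t. P y s t)" for y s
  have "P y s (\<theta> y s)" for y s unfolding \<theta>_def by (rule someI_ex[OF P])
  then have \<theta>: "\<bar>\<theta> y s\<bar> \<le> \<bar>s\<bar>"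
    and taylor: "F (vupd y r (y $ r + s)) = (\<Sum>i<N. D i y / fact i * s ^ i) + G (vupd y r (y $ r + \<theta> y s)) / fact N * s ^ N"
    for y s by (simp_all add: P_def)
  define s where "s b = - real_of_int b / 2" for b
  have eq: "(\<Sum>b\<in>B. d b * F (vupd y r (y $ r - real_of_int b / 2)))
      = (\<Sum>b\<in>B. d b * s b ^ N / fact N * G (vupd y r (y $ r + \<theta> y (s b))))" for y
  proof -
    have "(\<Sum>b\<in>B. d b * F (vupd y r (y $ r - real_of_int b / 2))) = (\<Sum>b\<in>B. d b * F (vupd y r (y $ r + s b)))"
      by (simp add: s_def)
    also have "\<dots> = (\<Sum>b\<in>B. \<Sum>i<N. D i y / fact i * (- 1 / 2) ^ i * (d b * real_of_int b ^ i))
        + (\<Sum>b\<in>B. d b * s b ^ N / fact N * G (vupd y r (y $ r + \<theta> y (s b))))"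
    proof -
      have "s b ^ i = (- 1 / 2) ^ i * real_of_int b ^ i" for b i
        unfolding s_def power_mult_distrib[symmetric] by simp
      then show ?thesis
        unfolding taylor by (simp add: distrib_left sum.distrib sum_distrib_left mult_ac)
    qed
    also have "(\<Sum>b\<in>B. \<Sum>i<N. D i y / fact i * (- 1 / 2) ^ i * (d b * real_of_int b ^ i)) = 0"
    proof (subst sum.swap, rule sum.neutral, rule ballI)
      fix i assume "i \<in> {..<N}"
      then show "(\<Sum>b\<in>B. D i y / fact i * (- 1 / 2) ^ i * (d b * real_of_int b ^ i)) = 0"
        using d[of i] by (simp only: sum_distrib_left[symmetric] mult_zero_right lessThan_iff)
    qed
    finally show ?thesis by simp
  qed
  have "((\<lambda>n. G (vupd (x n) r (x n $ r + \<theta> (x n) (s b)))) \<longlongrightarrow> 0) Fl" for b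
  proof (rule filterlim_compose[OF G])
    have le: "Max (range (\<lambda>q. x n $ q)) - \<bar>s b\<bar> \<le> Max (range (\<lambda>q. vupd (x n) r (x n $ r + \<theta> (x n) (s b)) $ q))" for n
    proof -
      have "Max (range (\<lambda>q. x n $ q)) \<in> range (\<lambda>q. x n $ q)" by (intro Max_in) auto
      then obtain q where q: "Max (range (\<lambda>q. x n $ q)) = x n $ q" by (rule rangeE)
      have "x n $ q - \<bar>s b\<bar> \<le> vupd (x n) r (x n $ r + \<theta> (x n) (s b)) $ q"
        using \<theta>[of "x n" "s b"] by auto
      also have "\<dots> \<le> Max (range (\<lambda>q. vupd (x n) r (x n $ r + \<theta> (x n) (s b)) $ q))"
        by (rule Max_ge) auto
      finally show ?thesis unfolding q .
    qed
    have lim: "filterlim (\<lambda>n. Max (range (\<lambda>q. x n $ q)) - \<bar>s b\<bar>) at_top Fl"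
      using filterlim_tendsto_add_at_top[OF tendsto_const[of "- \<bar>s b\<bar>"] x[unfolded filterlim_max_at_top_iff]]
      by simp
    show "filterlim (\<lambda>n. vupd (x n) r (x n $ r + \<theta> (x n) (s b))) max_at_top Fl"
      unfolding filterlim_max_at_top_iff
      by (rule filterlim_at_top_mono[OF lim always_eventually[OF allI[OF le]]])
  qed
  then show ?thesis
    unfolding eq by (intro tendsto_null_sum tendsto_mult_right_zero)
qed

text \<open>
  The two tensor products are connected by hybrids that use order \<open>m\<close> in the coordinates of a set \<open>S\<close> and
  order \<open>m\<^sub>0\<close> elsewhere. Adding one coordinate to \<open>S\<close> changes the value by a combination as in
  \<open>annihilating_combination_tendsto_0\<close>. The evaluation points go to infinity because some coordinate in
  \<open>J\<close> does.
\<close>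

lemma A_term_order_change:
  fixes F :: "real ^ 'p::finite \<Rightarrow> real"
  assumes m: "m0 \<ge> 1" "m0 \<le> m" and J: "J \<noteq> {}"
    and F: "\<And>r. \<exists>G. has_iter_partial (replicate (2 * m0) r) F G \<and> (G \<longlongrightarrow> 0) max_at_top"
  shows "((\<lambda>n. A_term m F J n - A_term m0 F J n) \<longlongrightarrow> 0) min_at_top"
proof -
  define B where "B = {1 - int m..int m - 1}"
  define y where "y n \<beta> = rvec n * indvec J - (1/2) *\<^sub>R 1 - (1/2) *\<^sub>R ivec \<beta>" for n and \<beta> :: "int ^ 'p"
  define T where "T M b = tau M (1 + nat \<bar>b\<bar>)" for M and b :: int
  define h where "h S n = (\<Sum>\<beta>\<in>grid (\<lambda>_. B). (\<Prod>r\<in>UNIV. T (if r \<in> S then m else m0) (\<beta> $ r)) * F (y n \<beta>))" for S n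
  have B: "finite B" by (simp add: B_def)
  have full: "A_term m F J n = h UNIV n" for n
    unfolding A_term_eq_tau h_def B_def y_def T_def by simp
  have none: "A_term m0 F J n = h {} n" for n
    unfolding A_term_eq_tau h_def y_def T_def if_distrib
  proof (simp, rule sum.mono_neutral_left)
    show "finite (grid (\<lambda>_::'p. B))" by (intro finite_grid B)
    show "grid (\<lambda>_. {1 - int m0..int m0 - 1}) \<subseteq> grid (\<lambda>_::'p. B)"
    proof -
      have "{1 - int m0..int m0 - 1} \<subseteq> B" using m by (auto simp: B_def)
      then show ?thesis by (auto simp: grid_def)
    qed
    show "\<forall>\<beta>\<in>grid (\<lambda>_. B) - grid (\<lambda>_. {1 - int m0..int m0 - 1}).
        (\<Prod>r\<in>UNIV. tau m0 (Suc (nat \<bar>\<beta> $ r\<bar>))) * F (rvec n * indvec J - (1/2) *\<^sub>R 1 - (1/2) *\<^sub>R ivec \<beta>) = 0"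
    proof
      fix \<beta> :: "int ^ 'p" assume "\<beta> \<in> grid (\<lambda>_. B) - grid (\<lambda>_. {1 - int m0..int m0 - 1})"
      then obtain r where "\<beta> $ r \<notin> {1 - int m0..int m0 - 1}" by (auto simp: grid_def)
      then have "tau m0 (Suc (nat \<bar>\<beta> $ r\<bar>)) = 0" by (intro tau_eq_0) auto
      then have "(\<Prod>r\<in>UNIV. tau m0 (Suc (nat \<bar>\<beta> $ r\<bar>))) = 0" by (intro prod_zero) auto
      then show "(\<Prod>r\<in>UNIV. tau m0 (Suc (nat \<bar>\<beta> $ r\<bar>))) * F (rvec n * indvec J - (1/2) *\<^sub>R 1 - (1/2) *\<^sub>R ivec \<beta>) = 0"
        by simp
    qed
  qed
  have moments: "(\<Sum>b\<in>B. (T m b - T m0 b) * real_of_int b ^ l) = 0" if "l < 2 * m0" for l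
  proof -
    have "tau_moment m l = tau_moment m0 l" using that m by (intro tau_moment_eq) auto
    moreover have "tau_moment m l = (\<Sum>b\<in>B. T m b * real_of_int b ^ l)"
      by (simp add: tau_moment_def T_def B_def)
    moreover have "tau_moment m0 l = (\<Sum>b\<in>B. T m0 b * real_of_int b ^ l)"
      unfolding tau_moment_extend[OF m(2)] by (simp add: T_def B_def)
    ultimately show ?thesis by (simp add: left_diff_distrib sum_subtractf)
  qed
  have top: "filterlim (\<lambda>n. y n \<beta>) max_at_top min_at_top" for \<beta>
  proof -
    obtain r where r: "r \<in> J" using J by auto
    define c where "c = 1 / 2 + real_of_int (\<beta> $ r) / 2"
    have le: "real (Min (range (\<lambda>q. n $ q))) - c \<le> Max (range (\<lambda>q. y n \<beta> $ q))" for n :: "nat ^ 'p"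
    proof -
      have "Min (range (\<lambda>q. n $ q)) \<le> n $ r" by (intro Min_le) auto
      then have "real (Min (range (\<lambda>q. n $ q))) - c \<le> real (n $ r) - c" by simp
      also have "\<dots> = y n \<beta> $ r"
        using r by (simp add: y_def c_def rvec_def indvec_def ivec_def)
      also have "\<dots> \<le> Max (range (\<lambda>q. y n \<beta> $ q))" by (rule Max_ge) auto
      finally show ?thesis .
    qed
    have lim: "filterlim (\<lambda>n :: nat ^ 'p. real (Min (range (\<lambda>q. n $ q))) - c) at_top min_at_top"
    proof -
      have "filterlim (\<lambda>n :: nat ^ 'p. Min (range (\<lambda>q. n $ q))) at_top min_at_top"
        unfolding min_at_top_def by (rule filterlim_filtercomap)
      from filterlim_compose[OF filterlim_real_sequentially this]
      have "filterlim (\<lambda>n :: nat ^ 'p. - c + real (Min (range (\<lambda>q. n $ q)))) at_top min_at_top"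
        by (intro filterlim_tendsto_add_at_top[OF tendsto_const])
      then show ?thesis by simp
    qed
    show ?thesis
      unfolding filterlim_max_at_top_iff
      by (rule filterlim_at_top_mono[OF lim always_eventually[OF allI[OF le]]])
  qed
  have "((\<lambda>n. h S n - h {} n) \<longlongrightarrow> 0) min_at_top" if "finite S" for S
    using that
  proof (induction S)
    case (insert r S)
    obtain G where G: "has_iter_partial (replicate (2 * m0) r) F G" "(G \<longlongrightarrow> 0) max_at_top"
      using F by blast
    define P where "P \<beta> = (\<Prod>q\<in>UNIV - {r}. T (if q \<in> S then m else m0) (\<beta> $ q))" for \<beta>
    have split: "(\<Prod>q\<in>UNIV. Q q) = Q r * (\<Prod>q\<in>UNIV - {r}. Q q)" for Q :: "'p \<Rightarrow> real"
      by (simp add: prod.remove)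
    have P1: "(\<Prod>q\<in>UNIV. T (if q \<in> insert r S then m else m0) (\<beta> $ q)) = T m (\<beta> $ r) * P \<beta>" for \<beta>
      unfolding split P_def by (auto intro!: prod.cong)
    have P2: "(\<Prod>q\<in>UNIV. T (if q \<in> S then m else m0) (\<beta> $ q)) = T m0 (\<beta> $ r) * P \<beta>" for \<beta>
      unfolding split P_def using insert.hyps by auto
    have Pu: "P (vupd \<beta> r b) = P \<beta>" for \<beta> b
      unfolding P_def by (intro prod.cong) auto
    have yu: "y n (vupd \<beta> r b) = vupd (y n \<beta>) r (y n \<beta> $ r - real_of_int b / 2)" if "\<beta> $ r = 0" for n \<beta> b
      using that by (auto simp: y_def vec_eq_iff ivec_def)
    have "h (insert r S) n - h S n = (\<Sum>\<beta>\<in>grid (\<lambda>_. B). (T m (\<beta> $ r) - T m0 (\<beta> $ r)) * P \<beta> * F (y n \<beta>))" for n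
      unfolding h_def P1 P2 by (simp add: sum_subtractf[symmetric] left_diff_distrib)
    also have "(\<Sum>\<beta>\<in>grid (\<lambda>_. B). (T m (\<beta> $ r) - T m0 (\<beta> $ r)) * P \<beta> * F (y n \<beta>))
        = (\<Sum>\<beta>\<in>grid ((\<lambda>_. B)(r := {0})). \<Sum>b\<in>B. (T m b - T m0 b) * P \<beta> * F (y n (vupd \<beta> r b)))" for n
      by (subst sum_grid_slice[where r = r and z = 0]) (auto simp: B Pu)
    also have "\<dots> n = (\<Sum>\<beta>\<in>grid ((\<lambda>_. B)(r := {0})). P \<beta> *
        (\<Sum>b\<in>B. (T m b - T m0 b) * F (vupd (y n \<beta>) r (y n \<beta> $ r - real_of_int b / 2))))" for n
    proof (rule sum.cong[OF refl])
      fix \<beta> assume "\<beta> \<in> grid ((\<lambda>_. B)(r := {0}))"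
      then have "\<beta> $ r = 0" by (auto simp: grid_def dest: spec[of _ r])
      then show "(\<Sum>b\<in>B. (T m b - T m0 b) * P \<beta> * F (y n (vupd \<beta> r b))) = P \<beta> *
        (\<Sum>b\<in>B. (T m b - T m0 b) * F (vupd (y n \<beta>) r (y n \<beta> $ r - real_of_int b / 2)))"
        by (simp add: yu sum_distrib_left mult_ac)
    qed
    finally have eq: "h (insert r S) n - h S n = (\<Sum>\<beta>\<in>grid ((\<lambda>_. B)(r := {0})). P \<beta> *
        (\<Sum>b\<in>B. (T m b - T m0 b) * F (vupd (y n \<beta>) r (y n \<beta> $ r - real_of_int b / 2))))" for n .
    have "((\<lambda>n. h (insert r S) n - h S n) \<longlongrightarrow> 0) min_at_top"
      unfolding eq
      by (intro tendsto_null_sum tendsto_mult_right_zero annihilating_combination_tendsto_0[OF G(1) _ G(2) B moments top])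
         (use m in auto)
    from tendsto_add[OF this insert.IH] show ?case by simp
  qed auto
  from this[of UNIV] show ?thesis by (simp add: full none)
qed


section \<open>The remainder functional\<close>

definition cube :: "nat \<Rightarrow> (real ^ 'p::finite) set"
  where "cube m = {u. \<forall>r. - (real m / 2) \<le> u $ r \<and> u $ r \<le> real m / 2}"

definition ray_integral :: "nat \<Rightarrow> nat ^ 'p::finite \<Rightarrow> nat ^ 'p \<Rightarrow> (real ^ 'p \<Rightarrow> real) \<Rightarrow> real"
  where "ray_integral m \<alpha> j g = integral {0..1} (\<lambda>s. (1 - s) ^ (2 * m - 1) *
    integral (cbox (- 1) 1) (\<lambda>v. mpow v \<alpha> * g ((s / 2) *\<^sub>R (rvec j * v))))"

text \<open>
  The remainder as a linear functional of the family \<open>S\<close> of functions that replaces the sums of shifted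
  derivatives. The sum over \<open>j\<close> stands outside the integrals here, unlike in \<open>R_inf\<close>.
\<close>

definition rem_fun :: "nat \<Rightarrow> (nat ^ 'p::finite \<Rightarrow> real ^ 'p \<Rightarrow> real) \<Rightarrow> real"
  where "rem_fun m S = real m / 2 ^ (2 * m + CARD('p) - 1) *
    (\<Sum>\<alpha> | msize \<alpha> = 2 * m. 1 / mfact \<alpha> *
      (\<Sum>j\<in>{1..of_nat m}. mgam m j * mpow (rvec j) (\<alpha> + 1) * ray_integral m \<alpha> j (S \<alpha>)))"

text \<open>
  All points at which the integrands evaluate \<open>S\<close> lie in the cube on which the derivative series is known
  to converge uniformly.
\<close>

lemma in_cube:
  assumes "j \<in> {1..of_nat m}" "s \<in> {0..1}" "v \<in> cbox (- 1) 1"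
  shows "(s / 2) *\<^sub>R (rvec j * v) \<in> cube m"
proof -
  have "\<bar>s / 2 * (real (j $ r) * v $ r)\<bar> \<le> real m / 2" for r
  proof -
    have "\<bar>s\<bar> \<le> 1" "\<bar>v $ r\<bar> \<le> 1" "real (j $ r) \<le> real m"
      using assms by (auto simp: mem_box_cart abs_le_iff less_eq_vec_def of_nat_index)
    then have "\<bar>s\<bar> * (real (j $ r) * \<bar>v $ r\<bar>) \<le> 1 * (real m * 1)"
      by (intro mult_mono) auto
    then show ?thesis by (simp add: abs_mult)
  qed
  then show ?thesis by (auto simp: cube_def rvec_def abs_le_iff) (metis minus_le_iff)
qed

lemma continuous_on_mpow [continuous_intros]:
  "continuous_on A f \<Longrightarrow> continuous_on A (\<lambda>x. mpow (f x) \<alpha>)"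
  unfolding mpow_def by (intro continuous_intros)

lemma continuous_ray_integrand:
  fixes g :: "real ^ 'p::finite \<Rightarrow> real"
  assumes g: "continuous_on (cube m) g" and j: "j \<in> {1..of_nat m}"
  shows "continuous_on ({0..1} \<times> cbox (- 1) 1) (\<lambda>(s, v). mpow v \<alpha> * g ((s / 2) *\<^sub>R (rvec j * v)))"
  unfolding split_def
  by (intro continuous_intros continuous_on_compose2[OF g]) (use in_cube[OF j] in auto)

lemma ray_integrand_integrable:
  fixes g :: "real ^ 'p::finite \<Rightarrow> real"
  assumes g: "continuous_on (cube m) g" and j: "j \<in> {1..of_nat m}"
  shows "s \<in> {0..1} \<Longrightarrow> (\<lambda>v. mpow v \<alpha> * g ((s / 2) *\<^sub>R (rvec j * v))) integrable_on cbox (- 1) 1"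
    and "continuous_on {0..1} (\<lambda>s. (1 - s) ^ N * integral (cbox (- 1) 1) (\<lambda>v. mpow v \<alpha> * g ((s / 2) *\<^sub>R (rvec j * v))))"
proof -
  show "(\<lambda>v. mpow v \<alpha> * g ((s / 2) *\<^sub>R (rvec j * v))) integrable_on cbox (- 1) 1" if "s \<in> {0..1}" for s
    by (intro integrable_continuous continuous_intros continuous_on_compose2[OF g]) (use in_cube[OF j that] in auto)
  show "continuous_on {0..1} (\<lambda>s. (1 - s) ^ N * integral (cbox (- 1) 1) (\<lambda>v. mpow v \<alpha> * g ((s / 2) *\<^sub>R (rvec j * v))))"
    by (intro continuous_intros integral_continuous_on_param continuous_ray_integrand[OF g j])
qed

lemma ray_integral_sum_general:
  fixes g :: "'k \<Rightarrow> real ^ 'p::finite \<Rightarrow> real"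
  assumes X: "finite X" and j: "\<And>k. k \<in> X \<Longrightarrow> j k \<in> {1..of_nat m}"
    and g: "\<And>k. k \<in> X \<Longrightarrow> continuous_on (cube m) (g k)"
  shows "integral {0..1} (\<lambda>s. (1 - s) ^ (2 * m - 1) * integral (cbox (- 1) 1)
      (\<lambda>v. mpow v \<alpha> * (\<Sum>k\<in>X. c k * g k ((s / 2) *\<^sub>R (rvec (j k) * v)))))
    = (\<Sum>k\<in>X. c k * ray_integral m \<alpha> (j k) (g k))"
    (is "?L = _")
proof -
  have "?L = integral {0..1} (\<lambda>s. \<Sum>k\<in>X. c k * ((1 - s) ^ (2 * m - 1) *
    integral (cbox (- 1) 1) (\<lambda>v. mpow v \<alpha> * g k ((s / 2) *\<^sub>R (rvec (j k) * v)))))"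
  proof (rule integral_cong)
    fix s :: real assume s: "s \<in> {0..1}"
    have "integral (cbox (- 1) 1) (\<lambda>v. mpow v \<alpha> * (\<Sum>k\<in>X. c k * g k ((s / 2) *\<^sub>R (rvec (j k) * v))))
        = integral (cbox (- 1) 1) (\<lambda>v. \<Sum>k\<in>X. c k * (mpow v \<alpha> * g k ((s / 2) *\<^sub>R (rvec (j k) * v))))"
      by (simp add: sum_distrib_left mult_ac)
    also have "\<dots> = (\<Sum>k\<in>X. c k * integral (cbox (- 1) 1) (\<lambda>v. mpow v \<alpha> * g k ((s / 2) *\<^sub>R (rvec (j k) * v))))"
      using X by (subst integral_sum) (auto intro!: integrable_on_mult_right ray_integrand_integrable(1)[OF g j s])
    finally show "(1 - s) ^ (2 * m - 1) * integral (cbox (- 1) 1) (\<lambda>v. mpow v \<alpha> * (\<Sum>k\<in>X. c k * g k ((s / 2) *\<^sub>R (rvec (j k) * v))))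
        = (\<Sum>k\<in>X. c k * ((1 - s) ^ (2 * m - 1) * integral (cbox (- 1) 1) (\<lambda>v. mpow v \<alpha> * g k ((s / 2) *\<^sub>R (rvec (j k) * v)))))"
      by (simp add: sum_distrib_left mult_ac)
  qed
  also have "\<dots> = (\<Sum>k\<in>X. c k * ray_integral m \<alpha> (j k) (g k))"
  proof -
    have "(\<lambda>s. c k * ((1 - s) ^ (2 * m - 1) *
      integral (cbox (- 1) 1) (\<lambda>v. mpow v \<alpha> * g k ((s / 2) *\<^sub>R (rvec (j k) * v))))) integrable_on {0..1}" if "k \<in> X" for k
      using that by (intro integrable_continuous_real continuous_on_mult_left ray_integrand_integrable(2)[OF g j])
    then show ?thesis unfolding ray_integral_def using X by (subst integral_sum) auto
  qed
  finally show ?thesis .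
qed

lemma ray_integral_sum:
  fixes g :: "'k \<Rightarrow> real ^ 'p::finite \<Rightarrow> real"
  assumes "j \<in> {1..of_nat m}" "finite X" "\<And>k. k \<in> X \<Longrightarrow> continuous_on (cube m) (g k)"
  shows "ray_integral m \<alpha> j (\<lambda>u. \<Sum>k\<in>X. c k * g k u) = (\<Sum>k\<in>X. c k * ray_integral m \<alpha> j (g k))"
  using ray_integral_sum_general[of X "\<lambda>_. j" m g \<alpha> c] assms unfolding ray_integral_def by simp

lemma ray_integral_diff:
  fixes g h :: "real ^ 'p::finite \<Rightarrow> real"
  assumes j: "j \<in> {1..of_nat m}" and g: "continuous_on (cube m) g" and h: "continuous_on (cube m) h"
  shows "ray_integral m \<alpha> j (\<lambda>u. g u - h u) = ray_integral m \<alpha> j g - ray_integral m \<alpha> j h"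
proof -
  have "(\<lambda>u. g u - h u) = (\<lambda>u. \<Sum>b\<in>{True, False}. (if b then 1 else - 1) * (if b then g else h) u)"
    by auto
  then have "ray_integral m \<alpha> j (\<lambda>u. g u - h u)
      = (\<Sum>b\<in>{True, False}. (if b then 1 else - 1) * ray_integral m \<alpha> j (if b then g else h))"
    using ray_integral_sum[OF j, of "{True, False}" "\<lambda>b. if b then g else h" \<alpha> "\<lambda>b. if b then 1 else - 1"] g h
    by simp
  then show ?thesis by simp
qed

text \<open>
  The antiderivative of \<open>|t|\<^sup>n\<close> in a form that covers both signs of \<open>t\<close>.
\<close>

lemma has_real_derivative_abs_power:
  "((\<lambda>t::real. \<bar>t\<bar> ^ n * t / real (Suc n)) has_real_derivative \<bar>t\<bar> ^ n) (at t)"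
proof (cases "t = 0")
  case True
  show ?thesis
  proof (cases n)
    case (Suc k)
    have "((\<lambda>h::real. \<bar>h\<bar> ^ n / real (Suc n)) \<longlongrightarrow> 0) (at 0)"
      by (rule tendsto_eq_intros refl | simp add: Suc)+
    moreover have "\<forall>\<^sub>F h :: real in at 0. \<bar>h\<bar> ^ n / real (Suc n) = (\<bar>0 + h\<bar> ^ n * (0 + h) / real (Suc n) - \<bar>0\<bar> ^ n * 0 / real (Suc n)) / h"
      by (auto simp: eventually_at_filter)
    ultimately have "((\<lambda>h::real. (\<bar>0 + h\<bar> ^ n * (0 + h) / real (Suc n) - \<bar>0\<bar> ^ n * 0 / real (Suc n)) / h) \<longlongrightarrow> 0) (at 0)"
      by (rule Lim_transform_eventually)
    then show ?thesis using True Suc by (simp add: DERIV_def)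
  qed simp
next
  case False
  then consider "t > 0" | "t < 0" by linarith
  then show ?thesis
  proof cases
    case 1
    have "((\<lambda>t. t ^ Suc n / real (Suc n)) has_real_derivative t ^ n) (at t)"
      using DERIV_cdivide[OF DERIV_pow[of "Suc n" t UNIV], of "real (Suc n)"] by (simp del: power_Suc of_nat_Suc)
    then have "((\<lambda>t. \<bar>t\<bar> ^ n * t / real (Suc n)) has_real_derivative t ^ n) (at t)"
      by (rule has_field_derivative_transform_within_open[where S = "{0<..}"]) (use 1 in auto)
    then show ?thesis using 1 by simp
  next
    case 2
    have "((\<lambda>t. - ((- t) ^ Suc n / real (Suc n))) has_real_derivative (- t) ^ n) (at t)"
      by (rule derivative_eq_intros refl | simp del: power_Suc of_nat_Suc)+
    then have "((\<lambda>t. \<bar>t\<bar> ^ n * t / real (Suc n)) has_real_derivative (- t) ^ n) (at t)"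
      by (rule has_field_derivative_transform_within_open[where S = "{..<0}"]) (use 2 in auto)
    then show ?thesis using 2 by simp
  qed
qed

lemma integral_abs_mpow:
  "((\<lambda>v. \<bar>mpow v \<alpha>\<bar>) has_integral (\<Prod>r\<in>UNIV. 2 / real (Suc (\<alpha> $ r)))) (cbox (- 1) (1 :: real ^ 'p::finite))"
proof -
  have "((\<lambda>v. \<Prod>r\<in>UNIV. \<bar>v $ r\<bar> ^ (\<alpha> $ r)) has_integral
      (\<Prod>r\<in>UNIV. \<bar>(1 :: real ^ 'p) $ r\<bar> ^ (\<alpha> $ r) * 1 $ r / real (Suc (\<alpha> $ r))
        - \<bar>(- 1 :: real ^ 'p) $ r\<bar> ^ (\<alpha> $ r) * (- 1) $ r / real (Suc (\<alpha> $ r)))) (cbox (- 1) 1)"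
    by (rule has_integral_prod_box[OF has_real_derivative_abs_power]) (auto intro!: continuous_intros)
  then show ?thesis by (simp add: mpow_def abs_prod power_abs)
qed

lemma integral_mpow:
  "((\<lambda>v. mpow v \<alpha>) has_integral (\<Prod>r\<in>UNIV. (1 - (- 1) ^ Suc (\<alpha> $ r)) / real (Suc (\<alpha> $ r)))) (cbox (- 1) (1 :: real ^ 'p::finite))"
proof -
  have D: "((\<lambda>t::real. t ^ Suc n / real (Suc n)) has_real_derivative t ^ n) (at t)" for n t
    using DERIV_cdivide[OF DERIV_pow[of "Suc n" t UNIV], of "real (Suc n)"] by (simp del: power_Suc of_nat_Suc)
  have "((\<lambda>v. \<Prod>r\<in>UNIV. (v $ r) ^ (\<alpha> $ r)) has_integral
      (\<Prod>r\<in>UNIV. (1 :: real ^ 'p) $ r ^ Suc (\<alpha> $ r) / real (Suc (\<alpha> $ r))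
        - (- 1 :: real ^ 'p) $ r ^ Suc (\<alpha> $ r) / real (Suc (\<alpha> $ r)))) (cbox (- 1) 1)"
    by (rule has_integral_prod_box[OF D]) (auto intro!: continuous_intros)
  then show ?thesis by (simp add: mpow_def diff_divide_distrib add_divide_distrib)
qed

lemma ray_integral_bound:
  fixes g :: "real ^ 'p::finite \<Rightarrow> real"
  assumes m: "m \<ge> 1" and j: "j \<in> {1..of_nat m}" and g: "continuous_on (cube m) g"
    and M: "\<And>u. u \<in> cube m \<Longrightarrow> \<bar>g u\<bar> \<le> M"
  shows "\<bar>ray_integral m \<alpha> j g\<bar> \<le> M / (2 * real m) * (\<Prod>r\<in>UNIV. 2 / real (Suc (\<alpha> $ r)))"
proof -
  define I where "I = (\<Prod>r\<in>UNIV. 2 / real (Suc (\<alpha> $ r)))"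
  have inner: "\<bar>integral (cbox (- 1) 1) (\<lambda>v. mpow v \<alpha> * g ((s / 2) *\<^sub>R (rvec j * v)))\<bar> \<le> I * M" if s: "s \<in> {0..1}" for s
  proof -
    have I: "((\<lambda>v. \<bar>mpow v \<alpha>\<bar> * M) has_integral I * M) (cbox (- 1) 1)"
      unfolding I_def by (intro has_integral_mult_left integral_abs_mpow)
    have "norm (integral (cbox (- 1) 1) (\<lambda>v. mpow v \<alpha> * g ((s / 2) *\<^sub>R (rvec j * v)))) \<le> integral (cbox (- 1) 1) (\<lambda>v. \<bar>mpow v \<alpha>\<bar> * M)"
      using I by (intro integral_norm_bound_integral ray_integrand_integrable(1)[OF g j s])
        (auto simp: abs_mult intro!: mult_left_mono M in_cube[OF j s])
    also have "\<dots> = I * M" using I by (rule integral_unique)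
    finally show ?thesis by simp
  qed
  have pow: "((\<lambda>s::real. (1 - s) ^ (2 * m - 1) * (I * M)) has_integral (1 / (2 * real m)) * (I * M)) {0..1}"
  proof (rule has_integral_mult_left)
    have "((\<lambda>s::real. (1 - s) ^ (2 * m - 1)) has_integral (- ((1 - 1) ^ (2 * m) / (2 * real m)) - - ((1 - 0) ^ (2 * m) / (2 * real m)))) {0..1}"
      using m by (intro fundamental_theorem_of_calculus)
        (auto intro!: derivative_eq_intros simp flip: has_real_derivative_iff_has_vector_derivative)
    then show "((\<lambda>s::real. (1 - s) ^ (2 * m - 1)) has_integral 1 / (2 * real m)) {0..1}"
      using m by (simp add: power_0_left)
  qed
  have "norm (ray_integral m \<alpha> j g) \<le> integral {0..1} (\<lambda>s::real. (1 - s) ^ (2 * m - 1) * (I * M))"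
    unfolding ray_integral_def
    using pow by (intro integral_norm_bound_integral integrable_continuous_real ray_integrand_integrable(2)[OF g j])
      (auto simp: abs_mult intro!: continuous_intros mult_left_mono inner)
  also have "\<dots> = (1 / (2 * real m)) * (I * M)" using pow by (rule integral_unique)
  finally show ?thesis by (simp add: I_def mult_ac)
qed

lemma mfact_Suc: "mfact (\<alpha> + 1) = mfact \<alpha> * (\<Prod>r\<in>UNIV. real (Suc (\<alpha> $ r)))"
  by (simp add: mfact_def prod.distrib[symmetric] mult.commute)

text \<open>
  The norm bound for the remainder functional, which is the constant of the first error estimate divided
  by \<open>M\<close>.
\<close>

definition rem_const :: "nat \<Rightarrow> 'p::finite itself \<Rightarrow> real"
  where "rem_const m _ = 1 / 2 ^ (2 * m) * (\<Sum>\<alpha>\<in>{\<alpha> :: (nat, 'p) vec. msize \<alpha> = 2 * m}. 1 / mfact (\<alpha> + 1) *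
            (\<Sum>j\<in>{1..of_nat m}. \<bar>mgam m j\<bar> * mpow (rvec j) (\<alpha> + 1)))"

text \<open>
  The three integrations contribute \<open>\<integral> (1 - s)\<^bsup>2m-1\<^esup> = 1 / (2m)\<close>, \<open>\<integral> |v\<^sup>\<alpha>| = \<Prod> 2 / (\<alpha>\<^sub>r + 1)\<close> and the bound
  \<open>M\<close> itself; the products of the \<open>\<alpha>\<^sub>r + 1\<close> turn \<open>\<alpha>!\<close> into \<open>(\<alpha> + 1)!\<close>.
\<close>

lemma rem_fun_bound:
  fixes S :: "nat ^ 'p::finite \<Rightarrow> real ^ 'p \<Rightarrow> real"
  assumes m: "m \<ge> 1" and S: "\<And>\<alpha>. msize \<alpha> = 2 * m \<Longrightarrow> continuous_on (cube m) (S \<alpha>)"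
    and M: "\<And>\<alpha> u. msize \<alpha> = 2 * m \<Longrightarrow> u \<in> cube m \<Longrightarrow> \<bar>S \<alpha> u\<bar> \<le> M"
  shows "\<bar>rem_fun m S\<bar> \<le> M * rem_const m TYPE('p)"
proof -
  define c where "c = real m / 2 ^ (2 * m + CARD('p) - 1)"
  have pow: "(2::real) ^ (2 * m + CARD('p)) = 2 * 2 ^ (2 * m + CARD('p) - 1)"
    using m by (metis power_Suc Suc_diff_1 add_gr_0 zero_less_card_finite)
  have "\<bar>rem_fun m S\<bar> \<le> c * (\<Sum>\<alpha>\<in>{\<alpha> :: (nat, 'p) vec. msize \<alpha> = 2 * m}. 1 / mfact \<alpha> *
      (\<Sum>j\<in>{1..of_nat m}. \<bar>mgam m j\<bar> * mpow (rvec j) (\<alpha> + 1) * (M / (2 * real m) * (\<Prod>r\<in>UNIV. 2 / real (Suc (\<alpha> $ r))))))"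
    unfolding rem_fun_def c_def[symmetric] abs_mult
  proof (intro mult_mono order.trans[OF sum_abs] sum_mono)
    fix \<alpha> :: "nat ^ 'p" assume \<alpha>: "\<alpha> \<in> {\<alpha>. msize \<alpha> = 2 * m}"
    show "\<bar>1 / mfact \<alpha> * (\<Sum>j\<in>{1..of_nat m}. mgam m j * mpow (rvec j) (\<alpha> + 1) * ray_integral m \<alpha> j (S \<alpha>))\<bar>
      \<le> 1 / mfact \<alpha> * (\<Sum>j\<in>{1..of_nat m}. \<bar>mgam m j\<bar> * mpow (rvec j) (\<alpha> + 1) * (M / (2 * real m) * (\<Prod>r\<in>UNIV. 2 / real (Suc (\<alpha> $ r)))))"
      unfolding abs_mult
    proof (intro mult_mono order.trans[OF sum_abs] sum_mono)
      fix j :: "nat ^ 'p" assume j: "j \<in> {1..of_nat m}"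
      have "mpow (rvec j) (\<alpha> + 1) \<ge> 0" by (simp add: mpow_def rvec_def prod_nonneg)
      then have "\<bar>mgam m j * mpow (rvec j) (\<alpha> + 1) * ray_integral m \<alpha> j (S \<alpha>)\<bar>
          = (\<bar>mgam m j\<bar> * mpow (rvec j) (\<alpha> + 1)) * \<bar>ray_integral m \<alpha> j (S \<alpha>)\<bar>"
        by (simp add: abs_mult)
      also have "\<dots> \<le> (\<bar>mgam m j\<bar> * mpow (rvec j) (\<alpha> + 1)) * (M / (2 * real m) * (\<Prod>r\<in>UNIV. 2 / real (Suc (\<alpha> $ r))))"
        using \<alpha> \<open>mpow (rvec j) (\<alpha> + 1) \<ge> 0\<close> by (intro mult_left_mono ray_integral_bound[OF m j S M]) auto
      finally show "\<bar>mgam m j * mpow (rvec j) (\<alpha> + 1) * ray_integral m \<alpha> j (S \<alpha>)\<bar>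
        \<le> \<bar>mgam m j\<bar> * mpow (rvec j) (\<alpha> + 1) * (M / (2 * real m) * (\<Prod>r\<in>UNIV. 2 / real (Suc (\<alpha> $ r))))" .
    qed (auto simp: less_imp_le)
  qed (auto simp: c_def)
  also have "\<dots> = M * rem_const m TYPE('p)"
  proof -
    have eq: "c * (1 / mfact \<alpha> * (\<Sum>j\<in>{1..of_nat m}. \<bar>mgam m j\<bar> * mpow (rvec j) (\<alpha> + 1) * (M / (2 * real m) * (\<Prod>r\<in>UNIV. 2 / real (Suc (\<alpha> $ r))))))
       = M * (1 / 2 ^ (2 * m) * (1 / mfact (\<alpha> + 1) * (\<Sum>j\<in>{1..of_nat m}. \<bar>mgam m j\<bar> * mpow (rvec j) (\<alpha> + 1))))"
      for \<alpha> :: "nat ^ 'p"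
    proof -
      define T where "T = (\<Sum>j\<in>{1..of_nat m}. \<bar>mgam m j\<bar> * mpow (rvec j) (\<alpha> + 1))"
      define Q where "Q = (\<Prod>r\<in>UNIV. real (Suc (\<alpha> $ r)))"
      have Q: "(\<Prod>r\<in>UNIV. 2 / real (Suc (\<alpha> $ r))) = 2 ^ CARD('p) / Q" "Q > 0"
        by (simp_all add: Q_def prod_dividef prod_pos)
      have c: "c = 2 * real m / (2 ^ (2 * m) * 2 ^ CARD('p))"
        unfolding c_def power_add[symmetric] pow by simp
      show ?thesis
        unfolding mfact_Suc sum_distrib_right[symmetric] T_def[symmetric] Q(1) Q_def[symmetric] c
        using m Q(2) by (simp add: field_simps)
    qed
    show ?thesis unfolding sum_distrib_left[of c] eq unfolding rem_const_def sum_distrib_left[symmetric] ..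
  qed
  finally show ?thesis .
qed


section \<open>The summation formula\<close>

lemma finite_one_to [simp]: "finite {1..of_nat m :: nat ^ 'p::finite}"
  unfolding one_to_of_nat by (rule finite_grid) auto

lemma sum_mgam_mpow:
  "(\<Sum>j\<in>{1..of_nat m}. mgam m j * mpow (rvec j) (\<alpha> + 1)) = (\<Prod>r\<in>UNIV. \<Sum>j\<in>{1..m}. gam m j * real j ^ Suc (\<alpha> $ r))"
proof -
  have "mgam m j * mpow (rvec j) (\<alpha> + 1) = (\<Prod>r\<in>UNIV. gam m (j $ r) * real (j $ r) ^ Suc (\<alpha> $ r))" for j
    by (simp add: mgam_def mpow_def rvec_def prod.distrib)
  then show ?thesis
    unfolding one_to_of_nat using sum_grid_prod[of "\<lambda>_. {1..m}" "\<lambda>r j. gam m j * real j ^ Suc (\<alpha> $ r)"] by simp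
qed

text \<open>
  If \<open>\<alpha>\<^sub>r\<close> is odd for some \<open>r\<close>, then the integral of the monomial vanishes by symmetry. If all are even
  and one is positive, then the corresponding factor of the sum over \<open>j\<close> is a vanishing moment.
\<close>

lemma low_order_terms:
  fixes \<alpha> :: "nat ^ 'p::finite"
  assumes "msize \<alpha> < 2 * m"
  shows "(\<Prod>r\<in>UNIV. (1 - (- 1) ^ Suc (\<alpha> $ r)) / real (Suc (\<alpha> $ r))) *
      (\<Sum>j\<in>{1..of_nat m}. mgam m j * mpow (rvec j) (\<alpha> + 1)) = (if \<alpha> = 0 then 2 ^ CARD('p) else 0)"
proof -
  consider "\<alpha> = 0" | r where "odd (\<alpha> $ r)" | r q where "\<alpha> $ r = 2 * q" "q \<noteq> 0"
    by (metis vec_eq_iff zero_index evenE mult_zero_right)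
  then show ?thesis
  proof cases
    case 1
    then show ?thesis
      unfolding sum_mgam_mpow using gam_moment[of 0 m] assms by simp
  next
    case 2
    then have "(\<Prod>r\<in>UNIV. (1 - (- 1) ^ Suc (\<alpha> $ r)) / real (Suc (\<alpha> $ r))) = 0"
      by (intro prod_zero bexI[of _ r]) auto
    moreover have "\<alpha> \<noteq> 0" using 2 by auto
    ultimately show ?thesis by simp
  next
    case 3
    have "\<alpha> $ r \<le> msize \<alpha>" unfolding msize_def by (rule member_le_sum) auto
    then have "q < m" using 3 assms by simp
    then have "(\<Sum>j\<in>{1..m}. gam m j * real j ^ Suc (\<alpha> $ r)) = 0"
      using gam_moment[of q m] 3 by simp
    then have "(\<Sum>j\<in>{1..of_nat m}. mgam m j * mpow (rvec j) (\<alpha> + 1)) = 0"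
      unfolding sum_mgam_mpow by (intro prod_zero bexI[of _ r]) auto
    moreover have "\<alpha> \<noteq> 0" using 3 by auto
    ultimately show ?thesis by simp
  qed
qed

lemma mpow_mult: "mpow (u * v) \<alpha> = mpow u \<alpha> * mpow v \<alpha>"
  by (simp add: mpow_def power_mult_distrib prod.distrib)

lemma mpow_half: "mpow ((1/2) *\<^sub>R u) \<alpha> = mpow u \<alpha> / 2 ^ msize \<alpha>"
  by (simp add: mpow_def msize_def power_mult_distrib prod.distrib power_sum prod_dividef power_divide)

lemma mpow_add: "mpow u (\<alpha> + \<beta>) = mpow u \<alpha> * mpow u \<beta>"
  by (simp add: mpow_def power_add prod.distrib)

text \<open>
  Taylor's formula for \<open>f (x + j v / 2)\<close> is integrated over \<open>v \<in> [-1, 1]\<^sup>p\<close> and summed with the weights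
  \<open>\<gamma>\<^sub>j\<close>. The left side comes from the fundamental theorem on boxes, the terms of order less than \<open>2 m\<close>
  collapse to \<open>f x\<close>, and in the last one the integrals over \<open>s\<close> and \<open>v\<close> are exchanged.
\<close>

lemma local_formula:
  fixes f F :: "real ^ 'p::{finite,linorder} \<Rightarrow> real"
  assumes m: "m \<ge> 1" and f: "cont_diff (2 * m) f" and F: "is_antiderivative F f"
  shows "(\<Sum>j\<in>{1..of_nat m}. mgam m j * box_diff (x - (1/2) *\<^sub>R rvec j) (x + (1/2) *\<^sub>R rvec j) F)
    = f x + rem_fun m (\<lambda>\<alpha> u. mpartial \<alpha> f (x + u))"
proof -
  let ?p = "CARD('p)"
  define I where "I \<alpha> = (\<Prod>r\<in>UNIV. (1 - (- 1) ^ Suc (\<alpha> $ r)) / real (Suc (\<alpha> $ r)))" for \<alpha> :: "(nat, 'p) vec"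
  define P where "P \<alpha> = mpartial \<alpha> f" for \<alpha>
  define E where "E n Q j = (\<Sum>\<alpha> | msize \<alpha> = n. mpow (rvec j) \<alpha> / 2 ^ n / mfact \<alpha> * Q \<alpha>)" for n Q and j :: "(nat, 'p) vec"
  define W where "W j \<alpha> = ray_integral m \<alpha> j (\<lambda>u. P \<alpha> (x + u))" for j \<alpha>
  have Pcont: "continuous_on UNIV (P \<alpha>)" if "msize \<alpha> \<le> 2 * m" for \<alpha>
    unfolding P_def by (rule continuous_mpartial[OF f that])
  have box: "box_diff (x - (1/2) *\<^sub>R rvec j) (x + (1/2) *\<^sub>R rvec j) F = mpow (rvec j) 1 / 2 ^ ?p *
      ((\<Sum>n<2 * m. E n (\<lambda>\<alpha>. P \<alpha> x * I \<alpha>) j)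
       + real (2 * m) * E (2 * m) (W j) j)"
    if j: "j \<in> {1..of_nat m}" for j :: "(nat, 'p) vec"
  proof -
    define d where "d = (1/2) *\<^sub>R rvec j"
    \<comment> \<open>The integral in the Taylor remainder at \<open>v\<close>.\<close>
    define rest where "rest \<alpha> v = integral {0..1} (\<lambda>s. (1 - s) ^ (2 * m - 1) * P \<alpha> (x + s *\<^sub>R (d * v)))" for \<alpha> and v :: "(real, 'p) vec"
    have rs: "has_iter_partial (deriv_list 1) F f"
      using F by (simp add: is_antiderivative_def has_mpartial_def)
    have dl: "deriv_list (1 :: (nat, 'p) vec) = sorted_list_of_set UNIV"
      by (simp add: deriv_list_def)
    have d1: "(\<Prod>r\<in>UNIV. d $ r) = mpow (rvec j) 1 / 2 ^ ?p"
      by (simp add: d_def mpow_def prod_dividef)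
    have B: "((\<lambda>v. (\<Prod>r\<in>UNIV. d $ r) * f (x + d * v)) has_integral box_diff (x - d) (x + d) F) (cbox (- 1) 1)"
      by (rule box_FTC_affine[OF rs]) (auto simp: dl cont_diff_continuous[OF f])
    have taylor: "f (x + d * v) = (\<Sum>n<2 * m. E n (\<lambda>\<alpha>. P \<alpha> x * mpow v \<alpha>) j)
       + real (2 * m) * E (2 * m) (\<lambda>\<alpha>. mpow v \<alpha> * rest \<alpha> v) j" for v
    proof -
      have pw: "mpow (d * v) \<alpha> = mpow (rvec j) \<alpha> / 2 ^ msize \<alpha> * mpow v \<alpha>" for \<alpha>
        by (simp add: mpow_mult d_def mpow_half)
      have "0 < 2 * m" using m by simp
      have "f (x + d * v) = (\<Sum>n<2 * m. \<Sum>\<alpha> | msize \<alpha> = n. mpow (d * v) \<alpha> / mfact \<alpha> * P \<alpha> x)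
         + real (2 * m) * (\<Sum>\<alpha> | msize \<alpha> = 2 * m. mpow (d * v) \<alpha> / mfact \<alpha> * rest \<alpha> v)"
        unfolding P_def rest_def by (rule taylor_mpartial[OF f \<open>0 < 2 * m\<close>])
      moreover have "(\<Sum>\<alpha> | msize \<alpha> = n. mpow (d * v) \<alpha> / mfact \<alpha> * Q \<alpha>)
          = E n (\<lambda>\<alpha>. mpow v \<alpha> * Q \<alpha>) j" for n Q
        unfolding E_def by (rule sum.cong) (auto simp: pw)
      ultimately show ?thesis by (simp add: mult_ac)
    qed
    have W: "((\<lambda>v. mpow v \<alpha> * rest \<alpha> v) has_integral W j \<alpha>) (cbox (- 1) 1)" if \<alpha>: "msize \<alpha> = 2 * m" for \<alpha>
    proof -
      have Pa: "continuous_on UNIV (P \<alpha>)" using Pcont \<alpha> by simp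
      define g where "g s v = (1 - s) ^ (2 * m - 1) * (mpow v \<alpha> * P \<alpha> (x + (s / 2) *\<^sub>R (rvec j * v)))" for s :: real and v :: "(real, 'p) vec"
      have eq: "mpow v \<alpha> * rest \<alpha> v = integral (cbox 0 1) (\<lambda>s. g s v)" for v
      proof -
        have "s *\<^sub>R (d * v) = (s / 2) *\<^sub>R (rvec j * v)" for s by (simp add: d_def vec_eq_iff)
        then show ?thesis by (simp add: rest_def g_def mult_ac flip: integral_mult_right)
      qed
      have contg: "continuous_on (cbox ((- 1 :: (real, 'p) vec), 0 :: real) (1, 1)) (\<lambda>(v, s). g s v)"
        unfolding g_def split_def by (intro continuous_intros continuous_on_compose2[OF Pa]) auto
      have contg': "continuous_on (UNIV \<times> cbox (0 :: real) 1) (\<lambda>(v, s). g s v)"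
        unfolding g_def split_def by (intro continuous_intros continuous_on_compose2[OF Pa]) auto
      have "(\<lambda>v. mpow v \<alpha> * rest \<alpha> v) integrable_on cbox (- 1) 1"
        unfolding eq
        by (intro integrable_continuous continuous_on_subset[OF integral_continuous_on_param[OF contg']]) auto
      moreover have "integral (cbox (- 1) 1) (\<lambda>v. mpow v \<alpha> * rest \<alpha> v) = W j \<alpha>"
        unfolding eq integral_swap_continuous[OF contg] W_def ray_integral_def
        by (simp add: g_def[abs_def])
      ultimately show ?thesis by (metis integrable_integral)
    qed
    have "((\<lambda>v. (\<Prod>r\<in>UNIV. d $ r) * f (x + d * v)) has_integral (\<Prod>r\<in>UNIV. d $ r) *
      ((\<Sum>n<2 * m. E n (\<lambda>\<alpha>. P \<alpha> x * I \<alpha>) j)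
       + real (2 * m) * E (2 * m) (W j) j)) (cbox (- 1) 1)"
      unfolding taylor I_def E_def
      by (intro has_integral_mult_right has_integral_add has_integral_sum finite_lessThan finite_msize integral_mpow W) simp
    from has_integral_unique[OF B this] show ?thesis unfolding d1 unfolding d_def .
  qed
  define K where "K n Q = (\<Sum>\<alpha> | msize \<alpha> = n. 1 / (2 ^ ?p * 2 ^ n * mfact \<alpha>) * Q \<alpha>)" for n and Q :: "(nat, 'p) vec \<Rightarrow> real"
  define c where "c j \<alpha> = mgam m j * mpow (rvec j) (\<alpha> + 1)" for j \<alpha> :: "(nat, 'p) vec"
  have collect: "(\<Sum>j\<in>{1..of_nat m}. mgam m j * (mpow (rvec j) 1 / 2 ^ ?p * E n (Q j) j))
      = K n (\<lambda>\<alpha>. \<Sum>j\<in>{1..of_nat m}. c j \<alpha> * Q j \<alpha>)" for n Q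
  proof -
    have "mgam m j * (mpow (rvec j) 1 / 2 ^ ?p * E n (Q j) j)
        = (\<Sum>\<alpha> | msize \<alpha> = n. 1 / (2 ^ ?p * 2 ^ n * mfact \<alpha>) * (c j \<alpha> * Q j \<alpha>))" for j
      unfolding E_def c_def sum_distrib_left mpow_add by (intro sum.cong refl) (simp add: field_simps)
    then show ?thesis unfolding K_def by (simp only: sum_distrib_left) (rule sum.swap)
  qed
  have "(\<Sum>j\<in>{1..of_nat m}. mgam m j * box_diff (x - (1/2) *\<^sub>R rvec j) (x + (1/2) *\<^sub>R rvec j) F)
      = (\<Sum>j\<in>{1..of_nat m}. (\<Sum>n<2 * m. mgam m j * (mpow (rvec j) 1 / 2 ^ ?p * E n (\<lambda>\<alpha>. P \<alpha> x * I \<alpha>) j))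
        + real (2 * m) * (mgam m j * (mpow (rvec j) 1 / 2 ^ ?p * E (2 * m) (W j) j)))"
    by (intro sum.cong refl) (simp only: box distrib_left sum_distrib_left mult_ac)
  also have "\<dots> = (\<Sum>n<2 * m. K n (\<lambda>\<alpha>. \<Sum>j\<in>{1..of_nat m}. c j \<alpha> * (P \<alpha> x * I \<alpha>)))
      + real (2 * m) * K (2 * m) (\<lambda>\<alpha>. \<Sum>j\<in>{1..of_nat m}. c j \<alpha> * W j \<alpha>)"
    unfolding sum.distrib collect[symmetric] by (subst sum.swap) (simp only: sum_distrib_left)
  also have "(\<Sum>n<2 * m. K n (\<lambda>\<alpha>. \<Sum>j\<in>{1..of_nat m}. c j \<alpha> * (P \<alpha> x * I \<alpha>))) = (\<Sum>n<2 * m. if n = 0 then f x else 0)"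
  proof (rule sum.cong[OF refl])
    fix n assume n: "n \<in> {..<2 * m}"
    have "(\<Sum>j\<in>{1..of_nat m}. c j \<alpha> * (P \<alpha> x * I \<alpha>)) = (if \<alpha> = 0 then 2 ^ ?p * f x else 0)" if "msize \<alpha> = n" for \<alpha>
    proof -
      have "(\<Sum>j\<in>{1..of_nat m}. c j \<alpha> * (P \<alpha> x * I \<alpha>)) = P \<alpha> x * (I \<alpha> * (\<Sum>j\<in>{1..of_nat m}. c j \<alpha>))"
        by (simp add: sum_distrib_left mult_ac)
      also have "I \<alpha> * (\<Sum>j\<in>{1..of_nat m}. c j \<alpha>) = (if \<alpha> = 0 then 2 ^ ?p else 0)"
        unfolding c_def I_def using that n by (intro low_order_terms) simp
      finally show ?thesis by (simp add: P_def mpartial_0)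
    qed
    then have "K n (\<lambda>\<alpha>. \<Sum>j\<in>{1..of_nat m}. c j \<alpha> * (P \<alpha> x * I \<alpha>))
        = (\<Sum>\<alpha>\<in>{\<alpha> :: (nat, 'p) vec. msize \<alpha> = n}. 1 / (2 ^ ?p * 2 ^ n * mfact \<alpha>) * (if \<alpha> = 0 then 2 ^ ?p * f x else 0))"
      unfolding K_def by (auto intro!: sum.cong)
    also have "\<dots> = (if n = 0 then f x else 0)"
    proof (cases "n = 0")
      case False
      then have "\<alpha> \<noteq> 0" if "msize \<alpha> = n" for \<alpha> :: "(nat, 'p) vec"
        using that by (metis msize_0_iff)
      then show ?thesis using False by (auto intro!: sum.neutral)
    qed simp
    finally show "K n (\<lambda>\<alpha>. \<Sum>j\<in>{1..of_nat m}. c j \<alpha> * (P \<alpha> x * I \<alpha>)) = (if n = 0 then f x else 0)" .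
  qed
  also have "\<dots> = f x" using m by simp
  also have "real (2 * m) * K (2 * m) (\<lambda>\<alpha>. \<Sum>j\<in>{1..of_nat m}. c j \<alpha> * W j \<alpha>)
      = real (2 * m) / (2 ^ ?p * 2 ^ (2 * m)) * (\<Sum>\<alpha> | msize \<alpha> = 2 * m. 1 / mfact \<alpha> * (\<Sum>j\<in>{1..of_nat m}. c j \<alpha> * W j \<alpha>))"
    unfolding K_def sum_distrib_left[of "real (2 * m)"] sum_distrib_left[of "real (2 * m) / _"]
    by (intro sum.cong refl) simp
  also have "real (2 * m) / (2 ^ ?p * 2 ^ (2 * m)) = real m / 2 ^ (2 * m + ?p - 1)"
  proof -
    have "(2::real) ^ (2 * m + ?p) = 2 * 2 ^ (2 * m + ?p - 1)"
      using m by (metis power_Suc Suc_diff_1 add_gr_0 zero_less_card_finite)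
    then show ?thesis by (simp add: power_add mult.commute)
  qed
  finally show ?thesis unfolding rem_fun_def W_def P_def c_def .
qed

lemma rem_fun_sum:
  fixes S :: "'k \<Rightarrow> nat ^ 'p::finite \<Rightarrow> real ^ 'p \<Rightarrow> real"
  assumes X: "finite X" and S: "\<And>k \<alpha>. k \<in> X \<Longrightarrow> msize \<alpha> = 2 * m \<Longrightarrow> continuous_on (cube m) (S k \<alpha>)"
  shows "(\<Sum>k\<in>X. rem_fun m (S k)) = rem_fun m (\<lambda>\<alpha> u. \<Sum>k\<in>X. S k \<alpha> u)"
proof -
  define c where "c = real m / 2 ^ (2 * m + CARD('p) - 1)"
  have "rem_fun m (\<lambda>\<alpha> u. \<Sum>k\<in>X. S k \<alpha> u) = c * (\<Sum>\<alpha> | msize \<alpha> = 2 * m. 1 / mfact \<alpha> *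
      (\<Sum>j\<in>{1..of_nat m}. mgam m j * mpow (rvec j) (\<alpha> + 1) * (\<Sum>k\<in>X. ray_integral m \<alpha> j (S k \<alpha>))))"
    unfolding rem_fun_def c_def
    using ray_integral_sum[OF _ X, of _ m "\<lambda>k. S k \<alpha>" \<alpha> "\<lambda>_. 1" for \<alpha>] S
    by (intro arg_cong2[where f = "(*)"] sum.cong refl) simp
  also have "\<dots> = (\<Sum>\<alpha> | msize \<alpha> = 2 * m. \<Sum>k\<in>X. c * (1 / mfact \<alpha> *
      (\<Sum>j\<in>{1..of_nat m}. mgam m j * mpow (rvec j) (\<alpha> + 1) * ray_integral m \<alpha> j (S k \<alpha>))))"
    unfolding sum_distrib_left by (intro sum.cong refl) (rule sum.swap)
  also have "\<dots> = (\<Sum>k\<in>X. \<Sum>\<alpha> | msize \<alpha> = 2 * m. c * (1 / mfact \<alpha> *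
      (\<Sum>j\<in>{1..of_nat m}. mgam m j * mpow (rvec j) (\<alpha> + 1) * ray_integral m \<alpha> j (S k \<alpha>))))"
    by (rule sum.swap)
  also have "\<dots> = (\<Sum>k\<in>X. rem_fun m (S k))"
    unfolding rem_fun_def c_def by (simp only: sum_distrib_left)
  finally show ?thesis by simp
qed

lemma rem_fun_diff:
  fixes S T :: "nat ^ 'p::finite \<Rightarrow> real ^ 'p \<Rightarrow> real"
  assumes "\<And>\<alpha>. msize \<alpha> = 2 * m \<Longrightarrow> continuous_on (cube m) (S \<alpha>)" "\<And>\<alpha>. msize \<alpha> = 2 * m \<Longrightarrow> continuous_on (cube m) (T \<alpha>)"
  shows "rem_fun m (\<lambda>\<alpha> u. S \<alpha> u - T \<alpha> u) = rem_fun m S - rem_fun m T"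
proof -
  define c where "c = real m / 2 ^ (2 * m + CARD('p) - 1)"
  have "rem_fun m (\<lambda>\<alpha> u. S \<alpha> u - T \<alpha> u) = c * (\<Sum>\<alpha> | msize \<alpha> = 2 * m. 1 / mfact \<alpha> *
      (\<Sum>j\<in>{1..of_nat m}. mgam m j * mpow (rvec j) (\<alpha> + 1) * (ray_integral m \<alpha> j (S \<alpha>) - ray_integral m \<alpha> j (T \<alpha>))))"
    unfolding rem_fun_def c_def
    by (intro arg_cong2[where f = "(*)"] sum.cong refl ray_integral_diff assms) auto
  then show ?thesis
    unfolding rem_fun_def c_def[symmetric] by (simp only: right_diff_distrib sum_subtractf)
qed

lemma continuous_sum_shift:
  fixes f :: "real ^ 'p::{finite,linorder} \<Rightarrow> real"
  assumes "cont_diff (2 * m) f" "msize \<alpha> = 2 * m"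
  shows "continuous_on A (\<lambda>u. \<Sum>k\<in>X. mpartial \<alpha> f (rvec k + u))"
  using assms by (intro continuous_intros continuous_on_compose2[OF continuous_mpartial[OF assms(1)]]) auto

theorem summation_formula:
  fixes f F :: "real ^ 'p::{finite,linorder} \<Rightarrow> real" and n :: "nat ^ 'p::{finite,linorder}"
  assumes m: "m \<ge> 1" and f: "cont_diff (2 * m) f" and F: "is_antiderivative F f"
  shows "(\<Sum>k\<in>below n. f (rvec k)) =
    (\<Sum>J\<in>UNIV. (- 1) ^ (CARD('p) - card J) * A_term m F J n)
    - rem_fun m (\<lambda>\<alpha> u. \<Sum>k\<in>below n. mpartial \<alpha> f (rvec k + u))"
proof -
  have fin: "finite (below n)" unfolding below_eq_grid by (rule finite_grid) auto
  have "(\<Sum>J\<in>UNIV. (- 1) ^ (CARD('p) - card J) * A_term m F J n)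
      = (\<Sum>j\<in>{1..of_nat m}. mgam m j * (\<Sum>k\<in>below n. box_diff (rvec k - (1/2) *\<^sub>R rvec j) (rvec k + (1/2) *\<^sub>R rvec j) F))"
    by (rule sum_boxes_eq_A_terms[symmetric])
  also have "\<dots> = (\<Sum>k\<in>below n. \<Sum>j\<in>{1..of_nat m}. mgam m j * box_diff (rvec k - (1/2) *\<^sub>R rvec j) (rvec k + (1/2) *\<^sub>R rvec j) F)"
    unfolding sum_distrib_left by (rule sum.swap)
  also have "\<dots> = (\<Sum>k\<in>below n. f (rvec k)) + (\<Sum>k\<in>below n. rem_fun m (\<lambda>\<alpha> u. mpartial \<alpha> f (rvec k + u)))"
    unfolding local_formula[OF m f F] sum.distrib ..
  also have "(\<Sum>k\<in>below n. rem_fun m (\<lambda>\<alpha> u. mpartial \<alpha> f (rvec k + u)))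
      = rem_fun m (\<lambda>\<alpha> u. \<Sum>k\<in>below n. mpartial \<alpha> f (rvec k + u))"
    using continuous_sum_shift[OF f, where X = "{k}" for k] by (intro rem_fun_sum fin) simp
  finally show ?thesis by simp
qed

section \<open>Passing to the limit\<close>

lemma min_at_top_neq_bot: "min_at_top \<noteq> (bot :: (nat ^ 'p::finite) filter)"
  unfolding min_at_top_def
proof (rule filtercomap_neq_bot)
  fix P :: "nat \<Rightarrow> bool" assume "eventually P at_top"
  then obtain n where "P n" by (auto simp: eventually_sequentially)
  moreover have "Min (range (\<lambda>r::'p. (\<chi> i. n) $ r)) = n" by simp
  ultimately show "\<exists>x :: nat ^ 'p. P (Min (range (\<lambda>r. x $ r)))" by metis
qed

lemma R_inf_eq_rem_fun:
  fixes f :: "real ^ 'p::{finite,linorder} \<Rightarrow> real"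
  assumes L: "\<And>\<alpha>. msize \<alpha> = 2 * m \<Longrightarrow> continuous_on (cube m) (\<lambda>u. infsum_box (\<lambda>k. mpartial \<alpha> f (rvec k + u)))"
  shows "R_inf m f = rem_fun m (\<lambda>\<alpha> u. infsum_box (\<lambda>k. mpartial \<alpha> f (rvec k + u)))"
  unfolding R_inf_def rem_fun_def
proof (intro arg_cong2[where f = "(*)"] sum.cong refl)
  fix \<alpha> :: "(nat, 'p) vec" assume "\<alpha> \<in> {\<alpha>. msize \<alpha> = 2 * m}"
  then show "integral {0..1} (\<lambda>s. (1 - s) ^ (2 * m - 1) * integral (cbox (- 1) 1) (\<lambda>v. mpow v \<alpha> *
      (\<Sum>j\<in>{1..of_nat m}. mgam m j * mpow (rvec j) (\<alpha> + 1) *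
         infsum_box (\<lambda>k. mpartial \<alpha> f (rvec k + (s / 2) *\<^sub>R (rvec j * v))))))
    = (\<Sum>j\<in>{1..of_nat m}. mgam m j * mpow (rvec j) (\<alpha> + 1) *
        ray_integral m \<alpha> j (\<lambda>u. infsum_box (\<lambda>k. mpartial \<alpha> f (rvec k + u))))"
    by (intro ray_integral_sum_general L) auto
qed

lemma rem_const_nonneg: "rem_const m TYPE('p::finite) \<ge> 0"
  unfolding rem_const_def
  by (intro mult_nonneg_nonneg sum_nonneg) (auto simp: mpow_def rvec_def prod_nonneg less_imp_le)

text \<open>
  By linearity, the bound for the functional applies to the difference.
\<close>

lemma rem_fun_limit:
  fixes S :: "nat ^ 'p::finite \<Rightarrow> nat ^ 'p \<Rightarrow> real ^ 'p \<Rightarrow> real"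
  assumes m: "m \<ge> 1"
    and S: "\<And>n \<alpha>. msize \<alpha> = 2 * m \<Longrightarrow> continuous_on (cube m) (S n \<alpha>)"
    and L: "\<And>\<alpha>. msize \<alpha> = 2 * m \<Longrightarrow> continuous_on (cube m) (L \<alpha>)"
    and lim: "\<And>\<alpha>. msize \<alpha> = 2 * m \<Longrightarrow> uniform_limit (cube m) (\<lambda>n. S n \<alpha>) (L \<alpha>) Fl"
  shows "((\<lambda>n. rem_fun m (S n)) \<longlongrightarrow> rem_fun m L) Fl"
proof (rule tendstoI)
  fix e :: real assume e: "e > 0"
  define C where "C = rem_const m TYPE('p)"
  \<comment> \<open>Dividing by \<open>C + 1\<close> avoids a case distinction for \<open>C = 0\<close>.\<close>
  define d where "d = e / (C + 1)"
  have C: "C \<ge> 0" unfolding C_def by (rule rem_const_nonneg)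
  then have d: "d > 0" "d * C < e" using e by (simp_all add: d_def field_simps)
  have "\<forall>\<^sub>F n in Fl. \<forall>\<alpha>\<in>{\<alpha>. msize \<alpha> = 2 * m}. \<forall>u\<in>cube m. dist (S n \<alpha> u) (L \<alpha> u) < d"
    using lim d(1) by (intro eventually_ball_finite) (auto simp: uniform_limit_iff)
  then show "\<forall>\<^sub>F n in Fl. dist (rem_fun m (S n)) (rem_fun m L) < e"
  proof eventually_elim
    case (elim n)
    have "\<bar>rem_fun m (\<lambda>\<alpha> u. S n \<alpha> u - L \<alpha> u)\<bar> \<le> d * C"
      unfolding C_def using elim
      by (intro rem_fun_bound m continuous_on_diff S L) (auto simp: dist_real_def less_imp_le)
    then show ?case using d(2) by (simp add: rem_fun_diff[OF S L] dist_real_def)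
  qed
qed

lemma summation_limit:
  fixes f F :: "real ^ 'p::{finite,linorder} \<Rightarrow> real"
  assumes m: "m0 \<ge> 1" "m \<ge> m0" and f: "cont_diff (2 * m) f" and F: "is_antiderivative F f"
    and decay: "\<And>\<alpha>. msize \<alpha> = 2 * m0 \<Longrightarrow> \<exists>G. has_mpartial \<alpha> F G \<and> (G \<longlongrightarrow> 0) max_at_top"
    and unif: "\<And>\<alpha>. msize \<alpha> = 2 * m \<Longrightarrow> \<exists>L. uniform_limit (cube m) (\<lambda>n u. \<Sum>k\<in>below n. mpartial \<alpha> f (rvec k + u)) L min_at_top"
  shows "((\<lambda>n. (\<Sum>k\<in>below n. f (rvec k)) - A_tilde m0 F n)
        \<longlongrightarrow> (- 1) ^ CARD('p) * A_term m F {} 0 - R_inf m f) min_at_top"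
    and "(\<And>n \<alpha> u. msize \<alpha> = 2 * m \<Longrightarrow> (\<forall>r. - (real m / 2) < u $ r \<and> u $ r \<le> real m / 2)
           \<Longrightarrow> \<bar>\<Sum>k\<in>below n. mpartial \<alpha> f (rvec k + u)\<bar> \<le> M) \<Longrightarrow> \<bar>R_inf m f\<bar> \<le> M * rem_const m TYPE('p)"
proof -
  have m1: "m \<ge> 1" using m by simp
  define S where "S n \<alpha> u = (\<Sum>k\<in>below n. mpartial \<alpha> f (rvec k + u))" for n \<alpha> u
  define L where "L \<alpha> u = infsum_box (\<lambda>k. mpartial \<alpha> f (rvec k + u))" for \<alpha> u
  have S: "continuous_on A (S n \<alpha>)" if "msize \<alpha> = 2 * m" for n \<alpha> A
    unfolding S_def by (rule continuous_sum_shift[OF f that])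
  have lim: "uniform_limit (cube m) (\<lambda>n. S n \<alpha>) (L \<alpha>) min_at_top" if \<alpha>: "msize \<alpha> = 2 * m" for \<alpha>
  proof -
    obtain L' where L': "uniform_limit (cube m) (\<lambda>n. S n \<alpha>) L' min_at_top"
      using unif[OF \<alpha>] unfolding S_def by blast
    have "L \<alpha> u = L' u" if "u \<in> cube m" for u
      unfolding L_def infsum_box_def
      using tendsto_Lim[OF min_at_top_neq_bot tendsto_uniform_limitI[OF L' that]] by (simp add: S_def)
    then show ?thesis using uniform_limit_cong'[of "cube m" "\<lambda>n. S n \<alpha>" "\<lambda>n. S n \<alpha>" "L \<alpha>" L' min_at_top] L' by auto
  qed
  have Lc: "continuous_on (cube m) (L \<alpha>)" if "msize \<alpha> = 2 * m" for \<alpha>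
    by (rule uniform_limit_theorem[OF _ lim[OF that] min_at_top_neq_bot]) (simp add: S[OF that])
  have R: "R_inf m f = rem_fun m L"
    using R_inf_eq_rem_fun[of m f] Lc by (simp add: L_def[abs_def])
  have Rlim: "((\<lambda>n. rem_fun m (S n)) \<longlongrightarrow> R_inf m f) min_at_top"
    unfolding R by (intro rem_fun_limit m1 S Lc lim)
  have "\<exists>G. has_iter_partial (replicate (2 * m0) r) F G \<and> (G \<longlongrightarrow> 0) max_at_top" for r
  proof -
    have "msize (axis r (2 * m0)) = 2 * m0" by (simp add: msize_def axis_def)
    from decay[OF this] show ?thesis by (simp only: has_mpartial_def deriv_list_unit)
  qed
  then have change: "((\<lambda>n. A_term m F J n - A_term m0 F J n) \<longlongrightarrow> 0) min_at_top" if "J \<noteq> {}" for J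
    by (intro A_term_order_change m that)
  have eq: "(\<Sum>k\<in>below n. f (rvec k)) - A_tilde m0 F n = (- 1) ^ CARD('p) * A_term m F {} 0
      + (\<Sum>J\<in>{J. J \<noteq> {}}. (- 1) ^ (CARD('p) - card J) * (A_term m F J n - A_term m0 F J n)) - rem_fun m (S n)" for n
  proof -
    have "UNIV - {{}} = {J :: 'p set. J \<noteq> {}}" by auto
    then have "(\<Sum>J\<in>UNIV. (- 1) ^ (CARD('p) - card J) * A_term m F J n)
        = (- 1) ^ CARD('p) * A_term m F {} 0 + (\<Sum>J\<in>{J. J \<noteq> {}}. (- 1) ^ (CARD('p) - card J) * A_term m F J n)"
      by (subst sum.remove[of _ "{}"]) (simp_all add: A_term_empty[of m F n "{}"])
    then show ?thesis
      unfolding summation_formula[OF m1 f F] A_tilde_def S_def[abs_def]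
      by (simp add: right_diff_distrib sum_subtractf)
  qed
  have "((\<lambda>n. (- 1) ^ CARD('p) * A_term m F {} 0
      + (\<Sum>J\<in>{J. J \<noteq> {}}. (- 1) ^ (CARD('p) - card J) * (A_term m F J n - A_term m0 F J n)) - rem_fun m (S n))
      \<longlongrightarrow> (- 1) ^ CARD('p) * A_term m F {} 0 + 0 - R_inf m f) min_at_top"
    using change by (intro tendsto_intros Rlim tendsto_null_sum tendsto_mult_right_zero) auto
  then show "((\<lambda>n. (\<Sum>k\<in>below n. f (rvec k)) - A_tilde m0 F n)
        \<longlongrightarrow> (- 1) ^ CARD('p) * A_term m F {} 0 - R_inf m f) min_at_top"
    unfolding eq by simp
  show "\<bar>R_inf m f\<bar> \<le> M * rem_const m TYPE('p)"
    if bound: "\<And>n \<alpha> u. msize \<alpha> = 2 * m \<Longrightarrow> (\<forall>r. - (real m / 2) < u $ r \<and> u $ r \<le> real m / 2)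
           \<Longrightarrow> \<bar>\<Sum>k\<in>below n. mpartial \<alpha> f (rvec k + u)\<bar> \<le> M"
  proof -
    have SM: "\<bar>S n \<alpha> u\<bar> \<le> M" if \<alpha>: "msize \<alpha> = 2 * m" and u: "u \<in> cube m" for n \<alpha> u
    proof -
      \<comment> \<open>The bound is given on a half-open cube; closed cubes are reached by shrinking towards the origin.\<close>
      have "\<bar>S n \<alpha> ((1 - 1 / real (Suc i)) *\<^sub>R u)\<bar> \<le> M" for i
        unfolding S_def
      proof (rule bound[OF \<alpha>], rule allI)
        fix r
        define t where "t = 1 - 1 / real (Suc i)"
        have t: "0 \<le> t" "t < 1" by (simp_all add: t_def)
        have "\<bar>u $ r\<bar> \<le> real m / 2" using u unfolding cube_def by (auto dest: spec[of _ r])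
        then have "t * \<bar>u $ r\<bar> \<le> t * (real m / 2)" using t(1) by (rule mult_left_mono)
        also have "\<dots> < 1 * (real m / 2)" using t m1 by (intro mult_strict_right_mono) auto
        finally have "\<bar>t * u $ r\<bar> < real m / 2" using t(1) by (simp add: abs_mult)
        then show "- (real m / 2) < ((1 - 1 / real (Suc i)) *\<^sub>R u) $ r \<and> ((1 - 1 / real (Suc i)) *\<^sub>R u) $ r \<le> real m / 2"
          unfolding t_def[symmetric] by (auto simp: abs_less_iff)
      qed
      moreover have "(\<lambda>i. \<bar>S n \<alpha> ((1 - 1 / real (Suc i)) *\<^sub>R u)\<bar>) \<longlonglongrightarrow> \<bar>S n \<alpha> u\<bar>"
      proof (rule tendsto_rabs, rule isCont_tendsto_compose[where g = "S n \<alpha>"])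
        show "isCont (S n \<alpha>) u" using S[OF \<alpha>, of UNIV] by (simp add: continuous_on_eq_continuous_at)
        have "(\<lambda>i. (1 - 1 / real (Suc i)) *\<^sub>R u) \<longlonglongrightarrow> (1 - 0) *\<^sub>R u"
          by (intro tendsto_intros LIMSEQ_Suc[OF lim_1_over_n])
        then show "(\<lambda>i. (1 - 1 / real (Suc i)) *\<^sub>R u) \<longlonglongrightarrow> u" by simp
      qed
      ultimately show ?thesis by (intro LIMSEQ_le_const2) auto
    qed
    have "\<bar>rem_fun m (S n)\<bar> \<le> M * rem_const m TYPE('p)" for n
      by (intro rem_fun_bound m1 S SM)
    then show ?thesis
      by (intro tendsto_upperbound[OF tendsto_rabs[OF Rlim] _ min_at_top_neq_bot]) simp
  qed
qed


section \<open>The constant \<open>\<Lambda>\<^sub>*\<close>\<close>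

text \<open>
  The logarithm of \<open>Lam_fun\<close>. It is concave, so its maximum is the zero of its derivative, which lies in
  the short interval \<open>(5/6, 17/20)\<close>. The end point \<open>5/6\<close> is chosen since the sixth power of \<open>Lam_fun\<close> is
  rational there, and the derivative is already small.
\<close>

definition ln_Lam :: "real \<Rightarrow> real"
  where "ln_Lam t = (t - 1) * ln (1 - t) - (1 + t) * ln (1 + t) + 2 * ln t"

definition ln_Lam_deriv :: "real \<Rightarrow> real"
  where "ln_Lam_deriv t = ln (1 - t) - ln (1 + t) + 2 / t"

lemma Lam_fun_eq_exp: "t \<in> {0<..<1} \<Longrightarrow> Lam_fun t = exp (ln_Lam t)"
proof -
  assume t: "t \<in> {0<..<1}"
  have "t ^ 2 = exp (2 * ln t)"
    using t by (simp add: exp_of_nat_mult[of 2, simplified])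
  moreover have "(1 - t) powr (t - 1) = exp ((t - 1) * ln (1 - t))" "(1 + t) powr (- 1 - t) = exp ((- 1 - t) * ln (1 + t))"
    using t by (simp_all add: powr_def)
  ultimately have "Lam_fun t = exp ((t - 1) * ln (1 - t) + (- 1 - t) * ln (1 + t) + 2 * ln t)"
    by (simp only: Lam_fun_def exp_add)
  then show ?thesis by (simp add: ln_Lam_def algebra_simps)
qed

lemma DERIV_ln_Lam: "t \<in> {0<..<1} \<Longrightarrow> (ln_Lam has_real_derivative ln_Lam_deriv t) (at t)"
  unfolding ln_Lam_def[abs_def] ln_Lam_deriv_def
  by (rule derivative_eq_intros refl | simp)+ (simp add: field_simps)

lemma ln_Lam_deriv_antimono:
  assumes "0 < s" "s \<le> t" "t < 1"
  shows "ln_Lam_deriv t \<le> ln_Lam_deriv s"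
  unfolding ln_Lam_deriv_def using assms
  by (intro add_mono diff_mono divide_left_mono) auto

text \<open>
  These bounds decide the sign and the size of the derivative at \<open>5/6\<close>, which is \<open>12/5 - ln 11\<close>.
\<close>

lemma exp_12_5: "11 < exp (12 / 5 :: real)" "exp (12 / 5 :: real) < 11025 / 1000"
proof -
  have e: "2718281 / 1000000 \<le> exp (1 :: real)" "exp (1 :: real) \<le> 2718282 / 1000000"
  proof -
    have "exp 1 \<le> 5837465777 / 2147483648 + inverse (2 ^ 32 :: real)"
      "5837465777 / 2147483648 - inverse (2 ^ 32 :: real) \<le> exp 1"
      using e_approx_32 unfolding abs_le_iff by linarith+
    then show "2718281 / 1000000 \<le> exp (1 :: real)" "exp (1 :: real) \<le> 2718282 / 1000000"
      by simp_all
  qed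
  have p: "exp (12 / 5 :: real) ^ 5 = exp 1 ^ 12"
    by (simp add: exp_of_nat_mult[symmetric])
  have "(11 :: real) ^ 5 < (2718281 / 1000000) ^ 12" by (simp add: power_divide)
  also have "\<dots> \<le> exp 1 ^ 12" using e by (intro power_mono) auto
  finally have "11 ^ 5 < exp (12 / 5 :: real) ^ 5" unfolding p .
  then show "11 < exp (12 / 5 :: real)" by (rule power_less_imp_less_base) simp
  have "exp 1 ^ 12 \<le> (2718282 / 1000000 :: real) ^ 12" using e by (intro power_mono) auto
  also have "\<dots> < (11025 / 1000) ^ 5" by (simp add: power_divide)
  finally have "exp (12 / 5 :: real) ^ 5 < (11025 / 1000) ^ 5" unfolding p .
  then show "exp (12 / 5 :: real) < 11025 / 1000" by (rule power_less_imp_less_base) simp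
qed

lemma ln_Lam_deriv_bounds:
  "0 < ln_Lam_deriv (5 / 6)" "ln_Lam_deriv (5 / 6) \<le> 1 / 400" "ln_Lam_deriv (17 / 20) < 0"
proof -
  have 11: "ln_Lam_deriv (5 / 6) = 12 / 5 - ln 11"
    using ln_div[of 1 "6 :: real"] ln_div[of 11 "6 :: real"] by (simp add: ln_Lam_deriv_def)
  have "ln 11 < (12 / 5 :: real)"
  proof -
    have "ln 11 < ln (exp (12 / 5 :: real))" using exp_12_5(1) by (subst ln_less_cancel_iff) auto
    then show ?thesis by simp
  qed
  then show "0 < ln_Lam_deriv (5 / 6)" by (simp add: 11)
  have "1 + 1 / 400 \<le> exp (1 / 400 :: real)" by (rule exp_ge_add_one_self)
  then have "exp (12 / 5 - 1 / 400 :: real) \<le> exp (12 / 5) / (1 + 1 / 400)"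
    unfolding exp_diff by (intro divide_left_mono) (auto simp: add_pos_pos)
  also have "\<dots> \<le> 11" using exp_12_5(2) by simp
  finally have "12 / 5 - 1 / 400 \<le> ln (11 :: real)" by (subst ln_ge_iff) auto
  then show "ln_Lam_deriv (5 / 6) \<le> 1 / 400" by (simp add: 11)
  have "exp (40 / 17 :: real) \<le> exp (12 / 5)" by simp
  also have "\<dots> < 37 / 3" using exp_12_5(2) by simp
  finally have "ln (exp (40 / 17)) < ln (37 / 3 :: real)" by (subst ln_less_cancel_iff) auto
  then have "40 / 17 < ln (37 / 3 :: real)" by simp
  moreover have "ln_Lam_deriv (17 / 20) = 40 / 17 - ln (37 / 3)"
    using ln_div[of "3 :: real" 20] ln_div[of "37 :: real" 20] ln_div[of "37 :: real" 3] by (simp add: ln_Lam_deriv_def)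
  ultimately show "ln_Lam_deriv (17 / 20) < 0" by simp
qed

lemma Lam_fun_5_6: "0.30812 \<le> Lam_fun (5 / 6)" "Lam_fun (5 / 6) \<le> 0.308121"
proof -
  have "Lam_fun (5 / 6) ^ 6 = ((1/6) powr (-1/6)) ^ 6 * ((11/6) powr (-11/6)) ^ 6 * ((5/6)^2) ^ 6"
    by (simp add: Lam_fun_def power_mult_distrib)
  also have "((1/6) powr (-1/6)) ^ 6 = (6 :: real)"
    by (subst powr_power) (simp_all add: powr_minus)
  also have "((11/6) powr (-11/6)) ^ 6 = ((6/11) ^ 11 :: real)"
    by (subst powr_power) (simp_all add: powr_minus power_divide)
  finally have L: "Lam_fun (5 / 6) ^ 6 = 6 * (6/11) ^ 11 * ((5/6)^2) ^ 6" .
  have pos: "Lam_fun (5 / 6) \<ge> 0" by (simp add: Lam_fun_def)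
  have "0.30812 ^ 6 \<le> Lam_fun (5 / 6) ^ 6" unfolding L by (simp add: power_divide)
  then show "0.30812 \<le> Lam_fun (5 / 6)" using pos by (subst (asm) power_mono_iff) auto
  have "Lam_fun (5 / 6) ^ 6 \<le> 0.308121 ^ 6" unfolding L by (simp add: power_divide)
  then show "Lam_fun (5 / 6) \<le> 0.308121" using pos by (subst (asm) power_mono_iff) auto
qed

lemma Lam_star_attained:
  "\<exists>t\<in>{5/6<..<17/20}. Lam_fun t = Lam_star \<and> (\<forall>u\<in>{0<..<1}. Lam_fun u \<le> Lam_star)"
proof -
  have "continuous_on {5/6..17/20} ln_Lam_deriv"
    unfolding ln_Lam_deriv_def[abs_def] by (intro continuous_intros) auto
  then obtain t where t: "5/6 \<le> t" "t \<le> 17/20" "ln_Lam_deriv t = 0"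
    using IVT2'[of ln_Lam_deriv "17/20" 0 "5/6"] ln_Lam_deriv_bounds by (auto simp: less_imp_le)
  then have t': "t \<in> {5/6<..<17/20}"
    using ln_Lam_deriv_bounds by (cases "t = 5/6"; cases "t = 17/20") auto
  have max: "ln_Lam u \<le> ln_Lam t" if u: "u \<in> {0<..<1}" for u
  proof -
    consider "u < t" | "u = t" | "t < u" by linarith
    then show ?thesis
    proof cases
      case 1
      then obtain z where z: "u < z" "z < t" "ln_Lam t - ln_Lam u = (t - u) * ln_Lam_deriv z"
        using MVT2[of u t ln_Lam ln_Lam_deriv] DERIV_ln_Lam u t' by auto
      have "ln_Lam_deriv z \<ge> 0" using ln_Lam_deriv_antimono[of z t] z u t t' by auto
      then have "ln_Lam t - ln_Lam u \<ge> 0" unfolding z(3) using 1 by (intro mult_nonneg_nonneg) auto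
      then show ?thesis by simp
    next
      case 3
      then obtain z where z: "t < z" "z < u" "ln_Lam u - ln_Lam t = (u - t) * ln_Lam_deriv z"
        using MVT2[of t u ln_Lam ln_Lam_deriv] DERIV_ln_Lam u t' by auto
      have "ln_Lam_deriv z \<le> 0" using ln_Lam_deriv_antimono[of t z] z u t t' by auto
      then have "ln_Lam u - ln_Lam t \<le> 0" unfolding z(3) using 3 by (intro mult_nonneg_nonpos) auto
      then show ?thesis by simp
    qed simp
  qed
  have le: "Lam_fun u \<le> Lam_fun t" if "u \<in> {0<..<1}" for u
    using max[OF that] Lam_fun_eq_exp[OF that] Lam_fun_eq_exp[of t] t' by auto
  have "Lam_star = Lam_fun t"
    unfolding Lam_star_def by (rule cSup_eq_maximum) (use t' le in auto)
  with t' le show ?thesis by (intro bexI[of _ t]) auto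
qed

text \<open>
  The upper bound uses that the logarithm grows by at most \<open>1/60 \<cdot> 1/400\<close> between \<open>5/6\<close> and the maximum:
  the interval has length \<open>1/60\<close> and the derivative is at most \<open>1/400\<close>.
\<close>

lemma Lam_star_bounds: "0.30812 \<le> Lam_star" "Lam_star < 0.308136"
proof -
  obtain t where t: "t \<in> {5/6<..<17/20}" "Lam_fun t = Lam_star" "\<And>u. u \<in> {0<..<1} \<Longrightarrow> Lam_fun u \<le> Lam_star"
    using Lam_star_attained by auto
  show "0.30812 \<le> Lam_star" using Lam_fun_5_6(1) t(3)[of "5/6"] by simp
  obtain z where z: "5/6 < z" "z < t" "ln_Lam t - ln_Lam (5/6) = (t - 5/6) * ln_Lam_deriv z"
    using MVT2[of "5/6" t ln_Lam ln_Lam_deriv] DERIV_ln_Lam t(1) by auto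
  have "ln_Lam_deriv z \<le> 1 / 400"
    using ln_Lam_deriv_antimono[of "5/6" z] ln_Lam_deriv_bounds(2) z t by auto
  then have "(t - 5/6) * ln_Lam_deriv z \<le> (t - 5/6) * (1 / 400)" using t by (intro mult_left_mono) auto
  also have "\<dots> \<le> (1 / 60) * (1 / 400)" using t by (intro mult_right_mono) auto
  finally have "ln_Lam t \<le> ln_Lam (5/6) + 1 / 24000" using z(3) by simp
  then have "exp (ln_Lam t) \<le> exp (ln_Lam (5/6) + 1 / 24000)" by simp
  then have "Lam_star \<le> Lam_fun (5/6) * exp (1 / 24000)"
    using t(1,2) Lam_fun_eq_exp[of t] Lam_fun_eq_exp[of "5/6"] unfolding exp_add by simp
  also have "exp (1 / 24000 :: real) \<le> 24000 / 23999"
  proof -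
    have "1 + - (1 / 24000) \<le> exp (- (1 / 24000) :: real)" by (rule exp_ge_add_one_self)
    then show ?thesis by (simp add: exp_minus field_simps)
  qed
  also have "Lam_fun (5/6) * (24000 / 23999) \<le> 0.308121 * (24000 / 23999)"
    using Lam_fun_5_6(2) by (intro mult_right_mono) auto
  also have "\<dots> < 0.308136" by simp
  finally show "Lam_star < 0.308136" by (simp add: Lam_fun_def mult_left_mono)
qed

lemma kap_bounds: "0.27754 \<le> kap" "kap < 0.27755"
proof -
  have "sqrt (0.27754 ^ 2) \<le> sqrt (Lam_star / 4)"
    using Lam_star_bounds(1) by (intro real_sqrt_le_mono) (simp add: power2_eq_square)
  then show "0.27754 \<le> kap" by (simp add: kap_def)
  have "sqrt (Lam_star / 4) < sqrt (0.27755 ^ 2)"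
    using Lam_star_bounds(2) by (intro real_sqrt_less_mono) (simp add: power2_eq_square)
  then show "kap < 0.27755" by (simp add: kap_def)
qed

lemma kap_power: "kap ^ (2 * m) = Lam_star ^ m / 2 ^ (2 * m)"
proof -
  have "kap ^ 2 = Lam_star / 4" unfolding kap_def using Lam_star_bounds(1) by simp
  then show ?thesis unfolding power_mult by (simp only: power_divide) simp
qed

section \<open>Bounds on central binomial sums\<close>

lemma central_binomial_Suc:
  "real (2 * Suc m choose Suc m) = real (2 * m choose m) * (2 * (2 * real m + 1) / (real m + 1))"
proof -
  define C where "C = real (2 * m choose m)"
  define B where "B = real (2 * Suc m choose Suc m)"
  have f1: "fact m * fact m * C = fact (2 * m)"
    using binomial_fact_lemma[of m "2 * m"] unfolding C_def
    by (metis diff_add_inverse2 le_add2 mult_2 of_nat_fact of_nat_mult)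
  have "fact (Suc m) * fact (Suc m) * B = fact (2 * Suc m)"
    using binomial_fact_lemma[of "Suc m" "2 * Suc m"] unfolding B_def
    by (metis diff_add_inverse2 le_add2 mult_2 of_nat_fact of_nat_mult)
  also have "(fact (2 * Suc m) :: real) = (2 * real m + 2) * (2 * real m + 1) * fact (2 * m)"
    by (simp add: algebra_simps)
  finally have "(fact m * fact m) * ((real m + 1) * ((real m + 1) * B))
      = (fact m * fact m) * ((real m + 1) * (2 * (2 * real m + 1) * C))"
    unfolding f1[symmetric] by (simp add: algebra_simps)
  then have "(real m + 1) * ((real m + 1) * B) = (real m + 1) * (2 * (2 * real m + 1) * C)"
    by (simp only: mult_left_cancel[OF fact_nonzero] mult_cancel_left) simp
  then have "(real m + 1) * B = 2 * (2 * real m + 1) * C"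
    by (subst (asm) mult_left_cancel) (auto simp: add_eq_0_iff)
  then have "B = C * (2 * (2 * real m + 1) / (real m + 1))" by (simp add: field_simps)
  then show ?thesis by (simp add: B_def C_def)
qed

lemma central_binomial_Wallis:
  "(4 ^ m / real (2 * m choose m)) ^ 2 = (\<Prod>k=1..m. (4*real k^2) / (4*real k^2 - 1)) * (2 * real m + 1)"
proof (induction m)
  case (Suc m)
  define C where "C = real (2 * m choose m)"
  have C: "C > 0" by (simp add: C_def)
  have "(4 ^ Suc m / real (2 * Suc m choose Suc m)) ^ 2
      = (4 ^ m / C) ^ 2 * ((2 * (real m + 1)) ^ 2 / (2 * real m + 1) ^ 2)"
  proof -
    define a b where "a = 2 * real m + 1" and "b = real m + 1"
    have "a > 0" "b > 0" by (simp_all add: a_def b_def)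
    then have "4 ^ Suc m / (C * (2 * a / b)) = (4 ^ m / C) * (2 * b / a)"
      using C by (simp add: field_simps)
    then show ?thesis unfolding central_binomial_Suc C_def[symmetric] a_def[symmetric] b_def[symmetric]
      by (simp only: power_mult_distrib power_divide)
  qed
  also have "\<dots> = (\<Prod>k=1..m. (4*real k^2) / (4*real k^2 - 1)) * ((2 * (real m + 1)) ^ 2 / (2 * real m + 1))"
    unfolding C_def Suc.IH by (simp add: power2_eq_square)
  also have "(2 * (real m + 1)) ^ 2 / (2 * real m + 1)
      = (4*real (Suc m)^2) / (4*real (Suc m)^2 - 1) * (2 * real (Suc m) + 1)"
  proof -
    have "4*real (Suc m)^2 - 1 = (2 * real m + 1) * (2 * real (Suc m) + 1)"
      by (simp add: power2_eq_square algebra_simps)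
    moreover have "(2 * (real m + 1)) ^ 2 = 4 * real (Suc m) ^ 2"
      by (simp add: power2_eq_square algebra_simps)
    moreover have "2 * real (Suc m) + 1 \<noteq> 0" by (simp add: add_eq_0_iff)
    ultimately show ?thesis by (simp del: of_nat_Suc)
  qed
  finally show ?case by simp
qed simp

text \<open>
  The partial products in Wallis's formula increase to \<open>\<pi> / 2\<close>.
\<close>

lemma central_binomial_lower: "4 ^ m / real (2 * m choose m) \<le> sqrt (pi * (real m + 1 / 2))"
proof -
  define P where "P n = (\<Prod>k=1..n. (4*real k^2) / (4*real k^2 - 1))" for n
  have pos: "4*real (Suc n)^2 - 1 > 0" for n by (simp add: power2_eq_square algebra_simps add_pos_nonneg)
  have P0: "P n > 0" for n
  proof (induction n)
    case (Suc n)
    then show ?case using pos[of n] by (simp add: P_def del: of_nat_Suc)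
  qed (simp add: P_def)
  have inc: "P n \<le> P (Suc n)" for n
  proof -
    have "1 \<le> (4*real (Suc n)^2) / (4*real (Suc n)^2 - 1)" using pos[of n] by (simp add: le_divide_eq del: of_nat_Suc)
    then have "P n * 1 \<le> P n * ((4*real (Suc n)^2) / (4*real (Suc n)^2 - 1))"
      using P0[of n] by (intro mult_left_mono) auto
    then show ?thesis by (simp add: P_def)
  qed
  have "P \<longlonglongrightarrow> pi / 2" unfolding P_def[abs_def] by (rule wallis)
  then have "P m \<le> pi / 2" by (rule incseq_le[OF incseq_SucI[of P, OF inc]])
  then have "(4 ^ m / real (2 * m choose m)) ^ 2 \<le> (pi / 2) * (2 * real m + 1)"
    unfolding central_binomial_Wallis P_def[symmetric] by (intro mult_right_mono) auto
  also have "\<dots> = pi * (real m + 1 / 2)" by (simp add: field_simps)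
  finally show ?thesis by (rule real_le_rsqrt)
qed

lemma half_row_sum: "2 * (\<Sum>j\<in>{1..m}. real (2 * m choose (m + j))) = 4 ^ m - real (2 * m choose m)"
proof -
  have "(\<Sum>i\<le>2 * m. real (2 * m choose i)) = 4 ^ m"
  proof -
    have "(\<Sum>i\<le>2 * m. real (2 * m choose i)) = real (2 ^ (2 * m))"
      by (simp only: choose_row_sum flip: of_nat_sum)
    then show ?thesis by (simp add: power_mult)
  qed
  moreover have "{..2 * m} = {..<m} \<union> ({m} \<union> {m<..2 * m})" by auto
  moreover have "(\<Sum>i\<in>{..<m} \<union> ({m} \<union> {m<..2 * m}). real (2 * m choose i))
      = (\<Sum>i<m. real (2 * m choose i)) + (real (2 * m choose m) + (\<Sum>i\<in>{m<..2 * m}. real (2 * m choose i)))"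
    by (subst sum.union_disjoint, (auto)[3], subst sum.union_disjoint, auto)
  moreover have "(\<Sum>i<m. real (2 * m choose i)) = (\<Sum>j\<in>{1..m}. real (2 * m choose (m + j)))"
  proof (rule sum.reindex_bij_witness[where i = "\<lambda>j. m - j" and j = "\<lambda>i. m - i"])
    fix i assume "i \<in> {..<m}"
    then show "real (2 * m choose (m + (m - i))) = real (2 * m choose i)"
      using binomial_symmetric[of i "2 * m"] by (simp add: mult_2)
  qed auto
  moreover have "(\<Sum>i\<in>{m<..2 * m}. real (2 * m choose i)) = (\<Sum>j\<in>{1..m}. real (2 * m choose (m + j)))"
    by (rule sum.reindex_bij_witness[where i = "\<lambda>j. m + j" and j = "\<lambda>i. i - m"]) auto
  ultimately show ?thesis by simp
qed

lemma abs_gam_mult: "j \<ge> 1 \<Longrightarrow> \<bar>gam m j\<bar> * real j = 2 * real (2 * m choose (m + j)) / real (2 * m choose m)"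
  by (simp add: gam_def abs_mult)

text \<open>
  The sum is \<open>4\<^sup>m / (2m choose m) - 1\<close>, and subtracting \<open>1\<close> more than makes up for the \<open>1/2\<close> in
  \<open>central_binomial_lower\<close>.
\<close>

lemma gam_mass:
  assumes "m \<ge> 1"
  shows "(\<Sum>j\<in>{1..m}. \<bar>gam m j\<bar> * real j) \<le> sqrt (pi * real m)"
proof -
  define C where "C = real (2 * m choose m)"
  have C: "C > 0" by (simp add: C_def)
  have "(\<Sum>j\<in>{1..m}. \<bar>gam m j\<bar> * real j) = (\<Sum>j\<in>{1..m}. 2 * real (2 * m choose (m + j)) / C)"
    by (intro sum.cong refl) (simp add: abs_gam_mult C_def)
  also have "\<dots> = (4 ^ m - C) / C"
    unfolding C_def half_row_sum[symmetric] by (simp add: sum_distrib_left sum_divide_distrib)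
  also have "\<dots> = 4 ^ m / C - 1" using C by (simp add: field_simps)
  also have "\<dots> \<le> sqrt (pi * (real m + 1 / 2)) - 1" unfolding C_def using central_binomial_lower[of m] by simp
  also have "\<dots> \<le> sqrt (pi * real m)"
  proof -
    define r where "r = sqrt (pi * real m)"
    have "1 \<le> pi * real m" using assms pi_gt3 mult_mono[of 1 pi 1 "real m"] by simp
    then have r: "1 \<le> r" "r ^ 2 = pi * real m" by (simp_all add: r_def)
    have "(r + 1) ^ 2 = pi * real m + 2 * r + 1" by (simp add: power2_sum r(2))
    then have "pi * (real m + 1 / 2) \<le> (r + 1) ^ 2"
      using pi_less_4 r(1) by (simp add: distrib_left)
    then have "pi * (real m + 1 / 2) \<le> (sqrt (pi * real m) + 1) ^ 2" unfolding r_def .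
    then have "sqrt (pi * (real m + 1 / 2)) \<le> sqrt ((sqrt (pi * real m) + 1) ^ 2)" by (rule real_sqrt_le_mono)
    then show ?thesis by simp
  qed
  finally show ?thesis .
qed


section \<open>The one-dimensional error sum\<close>

text \<open>
  The logarithm of \<open>n! e\<^sup>n / n\<^bsup>n+1/2\<^esup>\<close>. It decreases with explicitly
  bounded steps, and the ratios of factorials below only involve differences of its values.
\<close>

definition stirling_defect :: "nat \<Rightarrow> real"
  where "stirling_defect n = ln (fact n) - (real n + 1 / 2) * ln (real n) + real n"

text \<open>
  The step is \<open>(n + 1/2) (ln (n + 1) - ln n) - 1\<close>, which the midpoint and trapezoidal estimates of
  \<open>\<integral> 1/x\<close> over \<open>[n, n + 1]\<close> bound from below and above.
\<close>

lemma stirling_defect_step: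
  assumes "n \<ge> 1"
  shows "stirling_defect (Suc n) \<le> stirling_defect n"
    and "stirling_defect n - stirling_defect (Suc n) \<le> (1 / real n - 1 / real (Suc n)) / 4"
proof -
  define d where "d = ln (real n + 1) - ln (real n)"
  have n: "real n > 0" using assms by simp
  have "ln (fact (Suc n) :: real) = ln (real n + 1) + ln (fact n)"
    using n by (simp add: ln_mult add.commute)
  then have eq: "stirling_defect n - stirling_defect (Suc n) = (real n + 1 / 2) * d - 1"
    by (simp add: stirling_defect_def d_def algebra_simps)
  have "2 * ((real n + 1) - real n) / (real n + (real n + 1)) \<le> d"
    unfolding d_def using n by (intro ln_inverse_approx_ge) auto
  then have "(real n + 1 / 2) * (2 / (2 * real n + 1)) \<le> (real n + 1 / 2) * d"
    using n by (intro mult_left_mono) (auto simp: mult_2[symmetric] add.assoc[symmetric])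
  also have "(real n + 1 / 2) * (2 / (2 * real n + 1)) = 1"
    using n by (simp add: field_simps)
  finally show "stirling_defect (Suc n) \<le> stirling_defect n" using eq by simp
  have "d \<le> 1 * (inverse (real n) + inverse (real n + 1)) / 2"
    unfolding d_def using n by (intro ln_inverse_approx_le) auto
  then have "(real n + 1 / 2) * d \<le> (real n + 1 / 2) * ((inverse (real n) + inverse (real n + 1)) / 2)"
    using n by (intro mult_left_mono) auto
  also have "\<dots> = 1 + (1 / real n - 1 / real (Suc n)) / 4"
    using n by (simp add: divide_simps) (simp add: algebra_simps)
  finally show "stirling_defect n - stirling_defect (Suc n) \<le> (1 / real n - 1 / real (Suc n)) / 4"
    using eq by linarith
qed

lemma stirling_defect_between:
  assumes "1 \<le> a" "a \<le> b"
  shows "stirling_defect b \<le> stirling_defect a \<and> stirling_defect a - stirling_defect b \<le> (1 / real a - 1 / real b) / 4"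
  using assms(2)
proof (induction b rule: dec_induct)
  case (step n)
  with stirling_defect_step[of n] assms(1) show ?case by (auto simp: diff_divide_distrib)
qed simp

text \<open>
  The ratio of binomial coefficients is \<open>m!\<^sup>2 / ((m + j)! (m - j)!)\<close>. In its logarithm, the main terms of
  Stirling's formula give the exponent of \<open>\<Lambda>(t)\<^sup>m\<close> together with \<open>- ln (1 - t\<^sup>2) / 2\<close>. Of the defects,
  the pair \<open>m - j, m\<close> has the favourable sign and the pair \<open>m, m + j\<close> costs at most \<open>1 / (8 m)\<close>.
\<close>

lemma central_ratio_bound:
  assumes "1 \<le> j" "j < m"
  defines "t \<equiv> real j / real m"
  shows "real (2 * m choose (m + j)) / real (2 * m choose m) * t ^ (2 * m)
    \<le> exp (1 / (8 * real m)) * Lam_star ^ m * (1 / sqrt (1 - t ^ 2))"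
proof -
  define M where "M = real m"
  have M: "M > 0" using assms by (simp add: M_def)
  have t: "0 < t" "t < 1" using assms by (simp_all add: t_def)
  have eqs: "real (m + j) = M * (1 + t)" "real (m - j) = M * (1 - t)"
    using assms by (simp_all add: t_def M_def field_simps of_nat_diff)
  define B where "B = real (2 * m choose (m + j)) / real (2 * m choose m)"
  have "B = (fact m * fact m) / (fact (m + j) * fact (m - j))"
  proof -
    have "m + j \<le> 2 * m" "m \<le> 2 * m" using assms by auto
    moreover have "2 * m - (m + j) = m - j" "2 * m - m = m" by auto
    ultimately show ?thesis
      unfolding B_def binomial_fact[OF \<open>m + j \<le> 2 * m\<close>] binomial_fact[OF \<open>m \<le> 2 * m\<close>] by (simp add: field_simps)
  qed
  then have lnB: "ln B = 2 * ln (fact m) - ln (fact (m + j)) - ln (fact (m - j))" and B: "B > 0"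
    by (simp_all add: ln_div ln_mult)
  have lnf: "ln (fact n) = stirling_defect n + (real n + 1 / 2) * ln (real n) - real n" for n
    by (simp add: stirling_defect_def)
  have "stirling_defect m - stirling_defect (m + j) \<le> (1 / real m - 1 / real (m + j)) / 4"
    using stirling_defect_between[of m "m + j"] assms by auto
  also have "\<dots> \<le> 1 / (8 * M)"
  proof -
    have "1 / (2 * M) \<le> 1 / real (m + j)" using assms by (intro divide_left_mono) (auto simp: M_def)
    then show ?thesis by (simp add: M_def)
  qed
  finally have d1: "stirling_defect m - stirling_defect (m + j) \<le> 1 / (8 * M)" .
  have d2: "stirling_defect m \<le> stirling_defect (m - j)"
    using stirling_defect_between[of "m - j" m] assms by auto
  have "ln B = (stirling_defect m - stirling_defect (m + j)) + (stirling_defect m - stirling_defect (m - j))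
      + 2 * (M + 1 / 2) * ln M - (M * (1 + t) + 1 / 2) * (ln M + ln (1 + t)) - (M * (1 - t) + 1 / 2) * (ln M + ln (1 - t))"
  proof -
    have l: "ln (M * (1 + t)) = ln M + ln (1 + t)" "ln (M * (1 - t)) = ln M + ln (1 - t)"
      using M t by (simp_all add: ln_mult)
    show ?thesis unfolding lnB lnf eqs l M_def[symmetric] by (simp add: algebra_simps)
  qed
  also have "\<dots> \<le> 1 / (8 * M) + 2 * (M + 1 / 2) * ln M - (M * (1 + t) + 1 / 2) * (ln M + ln (1 + t)) - (M * (1 - t) + 1 / 2) * (ln M + ln (1 - t))"
    using d1 d2 by simp
  also have "\<dots> = 1 / (8 * M) - M * ((1 + t) * ln (1 + t) + (1 - t) * ln (1 - t)) - (ln (1 + t) + ln (1 - t)) / 2"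
    by (simp add: algebra_simps)
  finally have "ln B + 2 * M * ln t \<le> 1 / (8 * M) + M * ln_Lam t - ln (1 - t ^ 2) / 2"
  proof -
    have "1 - t ^ 2 = (1 + t) * (1 - t)" by (simp add: power2_eq_square algebra_simps)
    then have "ln (1 - t ^ 2) = ln (1 + t) + ln (1 - t)" using t by (simp add: ln_mult)
    moreover assume "ln B \<le> 1 / (8 * M) - M * ((1 + t) * ln (1 + t) + (1 - t) * ln (1 - t)) - (ln (1 + t) + ln (1 - t)) / 2"
    ultimately show ?thesis by (simp add: ln_Lam_def algebra_simps)
  qed
  then have "exp (ln B + 2 * M * ln t) \<le> exp (1 / (8 * M) + M * ln_Lam t - ln (1 - t ^ 2) / 2)"
    by simp
  also have "exp (ln B + 2 * M * ln t) = B * t ^ (2 * m)"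
  proof -
    have "exp (2 * M * ln t) = t ^ (2 * m)"
      using t exp_of_nat_mult[of "2 * m" "ln t"] by (simp add: M_def)
    then show ?thesis using B by (simp add: exp_add)
  qed
  also have "exp (1 / (8 * M) + M * ln_Lam t - ln (1 - t ^ 2) / 2) = exp (1 / (8 * M)) * Lam_fun t ^ m * (1 / sqrt (1 - t ^ 2))"
  proof -
    have "1 - t ^ 2 > 0" using t by (simp add: power_less_one_iff abs_square_less_1)
    then have "exp (ln (1 - t ^ 2) / 2) = sqrt (1 - t ^ 2)"
      by (simp add: powr_half_sqrt[symmetric] powr_def)
    moreover have "exp (M * ln_Lam t) = Lam_fun t ^ m"
      using t Lam_fun_eq_exp[of t] exp_of_nat_mult[of m "ln_Lam t"] by (simp add: M_def)
    ultimately show ?thesis by (simp add: exp_add exp_diff)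
  qed
  also have "\<dots> \<le> exp (1 / (8 * M)) * Lam_star ^ m * (1 / sqrt (1 - t ^ 2))"
  proof -
    have "Lam_fun t \<le> Lam_star" using Lam_star_attained t by auto
    moreover have "Lam_fun t \<ge> 0" by (simp add: Lam_fun_def)
    moreover have "0 \<le> 1 - t ^ 2" using t by (simp add: power_le_one)
    ultimately show ?thesis by (intro mult_right_mono mult_left_mono power_mono) auto
  qed
  finally show ?thesis by (simp add: B_def M_def)
qed

text \<open>
  Since \<open>1 / sqrt (1 - t\<^sup>2)\<close> increases, the lower Riemann sum is at most the integral, which is \<open>arcsin 1\<close>.
  The term \<open>j = 0\<close>, which equals \<open>1\<close>, is taken off.
\<close>

lemma arcsine_sum:
  assumes "m \<ge> 1"
  shows "(\<Sum>j\<in>{1..<m}. 1 / sqrt (1 - (real j / real m) ^ 2)) \<le> real m * pi / 2 - 1"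
proof -
  define x where "x j = real j / real m" for j
  have m: "real m > 0" using assms by simp
  have step: "1 / real m * (1 / sqrt (1 - x j ^ 2)) \<le> arcsin (x (Suc j)) - arcsin (x j)" if j: "j < m" for j
  proof -
    have x: "0 \<le> x j" "x j < x (Suc j)" "x (Suc j) \<le> 1" "x (Suc j) - x j = 1 / real m"
      using j m by (auto simp: x_def divide_simps)
    obtain z where z: "x j < z" "z < x (Suc j)"
      "arcsin (x (Suc j)) - arcsin (x j) = (x (Suc j) - x j) * inverse (sqrt (1 - z ^ 2))"
    proof -
      have "\<exists>l z. x j < z \<and> z < x (Suc j) \<and> DERIV arcsin z :> l \<and> arcsin (x (Suc j)) - arcsin (x j) = (x (Suc j) - x j) * l"
        using x by (intro MVT continuous_on_arcsin' continuous_intros) (auto simp: real_differentiable_def intro!: DERIV_arcsin exI)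
      then obtain l z where lz: "x j < z" "z < x (Suc j)" "DERIV arcsin z :> l"
        "arcsin (x (Suc j)) - arcsin (x j) = (x (Suc j) - x j) * l" by auto
      have "DERIV arcsin z :> inverse (sqrt (1 - z ^ 2))" using lz x by (intro DERIV_arcsin) auto
      then have "l = inverse (sqrt (1 - z ^ 2))" using lz(3) DERIV_unique by blast
      with lz that show ?thesis by blast
    qed
    have "x j ^ 2 \<le> z ^ 2" "z ^ 2 < 1" using z x by (auto intro!: power_mono simp: abs_square_less_1)
    then have "1 / sqrt (1 - x j ^ 2) \<le> 1 / sqrt (1 - z ^ 2)"
      by (intro divide_left_mono) auto
    then have "1 / real m * (1 / sqrt (1 - x j ^ 2)) \<le> 1 / real m * inverse (sqrt (1 - z ^ 2))"
      using m by (intro mult_left_mono) (auto simp: inverse_eq_divide)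
    then show ?thesis unfolding z(3) x(4) .
  qed
  have "(\<Sum>j<m. 1 / real m * (1 / sqrt (1 - x j ^ 2))) \<le> (\<Sum>j<m. arcsin (x (Suc j)) - arcsin (x j))"
    by (intro sum_mono step) auto
  also have "\<dots> = arcsin (x m) - arcsin (x 0)" by (rule sum_lessThan_telescope)
  also have "\<dots> = pi / 2" using m by (simp add: x_def)
  finally have "1 / real m * (\<Sum>j<m. 1 / sqrt (1 - x j ^ 2)) \<le> pi / 2"
    by (simp only: sum_distrib_left)
  then have "(\<Sum>j<m. 1 / sqrt (1 - x j ^ 2)) \<le> real m * pi / 2"
    using m by (simp add: field_simps)
  moreover have "(\<Sum>j<m. 1 / sqrt (1 - x j ^ 2)) = 1 + (\<Sum>j\<in>{1..<m}. 1 / sqrt (1 - x j ^ 2))"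
  proof -
    have "{..<m} = insert 0 {1..<m}" using assms by auto
    then show ?thesis by (simp add: x_def)
  qed
  ultimately show ?thesis by (simp add: x_def)
qed

text \<open>
  The term \<open>j = m\<close>, not covered by \<open>central_ratio_bound\<close>. The left side shrinks by a factor of nearly
  \<open>1/4\<close> in each step, which is less than \<open>\<Lambda>\<^sub>*\<close>.
\<close>

lemma central_binomial_reciprocal:
  "m \<ge> 7 \<Longrightarrow> 2 / real (2 * m choose m) \<le> 111 / 50 * Lam_star ^ m"
proof (induction m rule: dec_induct)
  case base
  have "real (14 choose 7) = 3432" by (subst binomial_fact) (simp_all add: fact_numeral)
  moreover have "0.30812 ^ 7 \<le> Lam_star ^ 7" using Lam_star_bounds(1) by (intro power_mono) auto
  ultimately show ?case by (simp add: power_divide)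
next
  case (step n)
  have "2 / real (2 * Suc n choose Suc n) = 2 / real (2 * n choose n) * ((real n + 1) / (2 * (2 * real n + 1)))"
    unfolding central_binomial_Suc by (simp add: field_simps)
  also have "\<dots> \<le> (111 / 50 * Lam_star ^ n) * Lam_star"
  proof (rule mult_mono[OF step.IH])
    have "(real n + 1) / (2 * (2 * real n + 1)) \<le> 0.30812" using step by (simp add: field_simps)
    from this Lam_star_bounds(1) show "(real n + 1) / (2 * (2 * real n + 1)) \<le> Lam_star" by (rule order_trans)
  qed (use Lam_star_bounds(1) in auto)
  finally show ?case by (simp add: mult_ac)
qed

text \<open>
  With these terms, \<open>\<Sum>\<^sub>j |\<gamma>\<^sub>j| j\<^bsup>2m+1\<^esup> = m\<^bsup>2m\<^esup> \<Sum>\<^sub>j error_term m j\<close>.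
\<close>

definition error_term :: "nat \<Rightarrow> nat \<Rightarrow> real"
  where "error_term m j = 2 * real (2 * m choose (m + j)) / real (2 * m choose m) * (real j / real m) ^ (2 * m)"

text \<open>
  After division by \<open>\<Lambda>\<^sub>*\<^sup>m\<close>, the terms \<open>j < m\<close> contribute at most \<open>e\<^bsup>1/(8m)\<^esup> (\<pi> m - 2)\<close>, which is at
  most \<open>\<pi> m - 1.6\<close>, and the term \<open>j = m\<close> at most \<open>2.22\<close>. The excess \<open>0.62\<close> over \<open>\<pi> m\<close> is covered by
  \<open>0.0331 \<pi> m\<close> as soon as \<open>m \<ge> 7\<close>.
\<close>

lemma error_sum_large:
  assumes m: "m \<ge> 7"
  shows "(\<Sum>j\<in>{1..m}. error_term m j)
    \<le> 1.0331 * pi * real m * Lam_star ^ m"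
proof -
  define E where "E = exp (1 / (8 * real m))"
  have L: "Lam_star ^ m > 0" using Lam_star_bounds(1) by simp
  have split: "{1..m} = insert m {1..<m}" using m by auto
  have "(\<Sum>j\<in>{1..m}. error_term m j)
      = 2 / real (2 * m choose m) + 2 * (\<Sum>j\<in>{1..<m}. real (2 * m choose (m + j)) / real (2 * m choose m) * (real j / real m) ^ (2 * m))"
    unfolding split using m by (simp add: error_term_def sum_distrib_left mult_2[symmetric] mult_ac)
  also have "\<dots> \<le> 111 / 50 * Lam_star ^ m + 2 * (\<Sum>j\<in>{1..<m}. E * Lam_star ^ m * (1 / sqrt (1 - (real j / real m) ^ 2)))"
    unfolding E_def using m
    by (intro add_mono mult_left_mono sum_mono central_binomial_reciprocal central_ratio_bound) auto
  also have "\<dots> = 111 / 50 * Lam_star ^ m + 2 * (E * Lam_star ^ m) * (\<Sum>j\<in>{1..<m}. 1 / sqrt (1 - (real j / real m) ^ 2))"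
    by (simp add: sum_distrib_left)
  also have "\<dots> \<le> 111 / 50 * Lam_star ^ m + 2 * (E * Lam_star ^ m) * (real m * pi / 2 - 1)"
    using m L by (intro add_left_mono mult_left_mono arcsine_sum) (auto simp: E_def)
  also have "\<dots> = (111 / 50 + E * (pi * real m - 2)) * Lam_star ^ m"
    by (simp add: field_simps)
  also have "\<dots> \<le> (10331 / 10000 * pi * real m) * Lam_star ^ m"
  proof (rule mult_right_mono)
    have "1 + - (1 / (8 * real m)) \<le> exp (- (1 / (8 * real m)))" by (rule exp_ge_add_one_self)
    then have "E * (1 - 1 / (8 * real m)) \<le> E * inverse E"
      unfolding E_def by (intro mult_left_mono) (auto simp: exp_minus)
    also have "\<dots> = 1" by (simp add: E_def)
    finally have "E * (1 - 1 / (8 * real m)) \<le> 1" .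
    then have "E * (8 * real m - 1) \<le> 8 * real m" using m by (simp add: field_simps)
    then have E: "E \<le> 1 + 1 / (8 * real m - 1)" using m by (simp add: field_simps)
    have "pi \<le> 16 / 5" "157 / 50 \<le> pi" using pi_approx by simp_all
    then have pim: "pi * real m \<le> 16 / 5 * real m" "157 / 50 * real m \<le> pi * real m"
      by (intro mult_right_mono; simp)+
    have m7: "real m \<ge> 7" using m by simp
    have pos: "pi * real m - 2 \<ge> 0" using pim(2) m7 by linarith
    have "E * (pi * real m - 2) \<le> (1 + 1 / (8 * real m - 1)) * (pi * real m - 2)"
      using E pos by (rule mult_right_mono)
    also have "\<dots> = pi * real m - 2 + (pi * real m - 2) / (8 * real m - 1)" by (simp add: distrib_right)
    also have "(pi * real m - 2) / (8 * real m - 1) \<le> 2 / 5"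
    proof (subst pos_divide_le_eq)
      show "0 < 8 * real m - 1" using m7 by linarith
      show "pi * real m - 2 \<le> 2 / 5 * (8 * real m - 1)" using pim(1) unfolding right_diff_distrib by linarith
    qed
    finally have "111 / 50 + E * (pi * real m - 2) \<le> pi * real m + 31 / 50" by simp
    also have "\<dots> \<le> 10331 / 10000 * (pi * real m)" using pim(2) m7 by linarith
    finally show "111 / 50 + E * (pi * real m - 2) \<le> 10331 / 10000 * pi * real m" by simp
  qed (use L in simp)
  finally show ?thesis by simp
qed

lemma sum_upto_6:
  fixes f :: "nat \<Rightarrow> real"
  shows "sum f {Suc 0..Suc 0} = f 1" "sum f {Suc 0..2} = f 1 + f 2" "sum f {Suc 0..3} = f 1 + f 2 + f 3"
    "sum f {Suc 0..4} = f 1 + f 2 + f 3 + f 4" "sum f {Suc 0..5} = f 1 + f 2 + f 3 + f 4 + f 5"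
    "sum f {Suc 0..6} = f 1 + f 2 + f 3 + f 4 + f 5 + f 6"
  by (simp_all add: eval_nat_numeral)

text \<open>
  A finite computation with \<open>\<Lambda>\<^sub>*\<close> and \<open>\<pi>\<close> replaced by rational lower bounds. For \<open>m = 1\<close> the sum is \<open>1\<close>
  and the right side about \<open>1.00003\<close>, so these bounds have to be sharp.
\<close>

lemma error_sum_small:
  assumes "m \<in> {1..6}"
  shows "(\<Sum>j\<in>{1..m}. error_term m j)
    \<le> 1.0331 * pi * real m * Lam_star ^ m"
proof -
  have "(1.0331 * 3.14159) * real m * 0.30812 ^ m \<le> (1.0331 * pi) * real m * Lam_star ^ m"
    using pi_approx(1) Lam_star_bounds(1) by (intro mult_mono power_mono) auto
  moreover have "(\<Sum>j\<in>{1..m}. error_term m j)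
      \<le> (1.0331 * 3.14159) * real m * 0.30812 ^ m"
  proof -
    from assms consider "m = 1" | "m = 2" | "m = 3" | "m = 4" | "m = 5" | "m = 6" by fastforce
    then show ?thesis
      by cases (simp_all add: error_term_def sum_upto_6 binomial_fact fact_numeral power_divide)
  qed
  ultimately show ?thesis by simp
qed

lemma gam_top_moment:
  assumes "m \<ge> 1"
  shows "(\<Sum>j\<in>{1..m}. \<bar>gam m j\<bar> * real j * real j ^ (2 * m)) \<le> 1.0331 * pi * real m * real m ^ (2 * m) * Lam_star ^ m"
proof -
  have "(\<Sum>j\<in>{1..m}. \<bar>gam m j\<bar> * real j * real j ^ (2 * m))
      = real m ^ (2 * m) * (\<Sum>j\<in>{1..m}. error_term m j)"
    unfolding sum_distrib_left using assms
    by (intro sum.cong refl) (simp add: error_term_def abs_gam_mult power_divide)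
  also have "\<dots> \<le> real m ^ (2 * m) * (1.0331 * pi * real m * Lam_star ^ m)"
    using error_sum_small[of m] error_sum_large[of m] assms
    by (intro mult_left_mono) (cases "m \<ge> 7", auto)
  finally show ?thesis by (simp add: mult_ac)
qed


section \<open>The explicit error bound\<close>

lemma sum_power_le:
  fixes x :: "'a \<Rightarrow> real"
  assumes "finite A" "A \<noteq> {}" "even N" "N > 0"
  shows "(\<Sum>r\<in>A. x r) ^ N \<le> real (card A) ^ (N - 1) * (\<Sum>r\<in>A. x r ^ N)"
proof -
  define p where "p = real (card A)"
  have p: "p > 0" using assms by (simp add: p_def card_gt_0_iff)
  have "(\<Sum>r\<in>A. (1 / p) *\<^sub>R x r) ^ N \<le> (\<Sum>r\<in>A. (1 / p) * x r ^ N)"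
    using assms p by (intro convex_on_sum[where C = UNIV] convex_power_even) (auto simp: p_def)
  then have "((\<Sum>r\<in>A. x r) / p) ^ N \<le> (\<Sum>r\<in>A. x r ^ N) / p"
    by (simp add: sum_divide_distrib)
  then have "(\<Sum>r\<in>A. x r) ^ N \<le> p ^ N * ((\<Sum>r\<in>A. x r ^ N) / p)"
    using p by (simp add: power_divide pos_divide_le_eq mult.commute)
  also have "\<dots> = p ^ (N - 1) * (\<Sum>r\<in>A. x r ^ N)"
    using p assms(4) by (simp add: power_eq_if)
  finally show ?thesis by (simp add: p_def)
qed

lemma integral_unit_mpow:
  "((\<lambda>u. mpow u \<alpha>) has_integral (\<Prod>r\<in>UNIV. 1 / real (Suc (\<alpha> $ r)))) (cbox 0 (1 :: real ^ 'p::finite))"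
proof -
  have D: "((\<lambda>t::real. t ^ Suc n / real (Suc n)) has_real_derivative t ^ n) (at t)" for n t
    using DERIV_cdivide[OF DERIV_pow[of "Suc n" t UNIV], of "real (Suc n)"] by (simp del: power_Suc of_nat_Suc)
  have "((\<lambda>u. \<Prod>r\<in>UNIV. (u $ r) ^ (\<alpha> $ r)) has_integral
      (\<Prod>r\<in>UNIV. (1 :: real ^ 'p) $ r ^ Suc (\<alpha> $ r) / real (Suc (\<alpha> $ r))
        - (0 :: real ^ 'p) $ r ^ Suc (\<alpha> $ r) / real (Suc (\<alpha> $ r)))) (cbox 0 1)"
    by (rule has_integral_prod_box[OF D]) (auto intro!: continuous_intros)
  then show ?thesis by (simp add: mpow_def)
qed

lemma mpow_axis: "mpow u (axis r n) = u $ r ^ n"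
proof -
  have "mpow u (axis r n) = (\<Prod>q\<in>UNIV. if q = r then u $ r ^ n else 1)"
    unfolding mpow_def axis_def by (intro prod.cong) auto
  then show ?thesis by simp
qed

text \<open>
  Integrating the multinomial expansion of \<open>(\<Sum>\<^sub>r x\<^sub>r u\<^sub>r)\<^sup>N / N!\<close> over the unit cube gives the left side, because
  \<open>u\<^sup>\<alpha>\<close> integrates to \<open>\<Prod> 1 / (\<alpha>\<^sub>r + 1)\<close>. The power mean inequality bounds the integrand by a sum of powers
  of single variables.
\<close>

lemma sum_mpow_over_factorials:
  fixes x :: "real ^ 'p::finite"
  assumes N: "even N" "N > 0"
  shows "(\<Sum>\<alpha> | msize \<alpha> = N. mpow x \<alpha> / mfact (\<alpha> + 1))
    \<le> real CARD('p) ^ (N - 1) / fact (N + 1) * (\<Sum>r\<in>UNIV. x $ r ^ N)"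
proof -
  let ?p = "real CARD('p)"
  have A: "((\<lambda>u. \<Sum>\<alpha> | msize \<alpha> = N. mpow x \<alpha> / mfact \<alpha> * mpow u \<alpha>) has_integral
      (\<Sum>\<alpha> | msize \<alpha> = N. mpow x \<alpha> / mfact \<alpha> * (\<Prod>r\<in>UNIV. 1 / real (Suc (\<alpha> $ r))))) (cbox 0 1)"
    by (intro has_integral_sum finite_msize has_integral_mult_right integral_unit_mpow)
  have B: "((\<lambda>u. ?p ^ (N - 1) / fact N * (\<Sum>r\<in>UNIV. x $ r ^ N * mpow u (axis r N))) has_integral
      ?p ^ (N - 1) / fact N * (\<Sum>r\<in>UNIV. x $ r ^ N * (\<Prod>q\<in>UNIV. 1 / real (Suc (axis r N $ q))))) (cbox 0 1)"
    by (intro has_integral_mult_right has_integral_sum finite_class.finite_UNIV integral_unit_mpow)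
  \<comment> \<open>The pure power of degree \<open>N\<close> in direction \<open>r\<close> integrates to \<open>1 / (N + 1)\<close>.\<close>
  have unit: "(\<Prod>q\<in>UNIV. 1 / real (Suc (axis r N $ q))) = 1 / real (Suc N)" for r :: 'p
  proof -
    have "(\<Prod>q\<in>UNIV. 1 / real (Suc (axis r N $ q))) = (\<Prod>q\<in>UNIV. if q = r then 1 / real (Suc N) else 1)"
      by (intro prod.cong) (auto simp: axis_def)
    then show ?thesis by simp
  qed
  have le: "(\<Sum>\<alpha> | msize \<alpha> = N. mpow x \<alpha> / mfact \<alpha> * mpow u \<alpha>)
      \<le> ?p ^ (N - 1) / fact N * (\<Sum>r\<in>UNIV. x $ r ^ N * mpow u (axis r N))" for u
  proof -
    have "(\<Sum>\<alpha> | msize \<alpha> = N. mpow x \<alpha> / mfact \<alpha> * mpow u \<alpha>) = (\<Sum>\<alpha> | msize \<alpha> = N. mpow (x * u) \<alpha> / mfact \<alpha>)"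
      by (simp add: mpow_mult)
    also have "\<dots> = (\<Sum>r\<in>UNIV. (x * u) $ r) ^ N / fact N" by (rule multinomial)
    also have "\<dots> \<le> ?p ^ (N - 1) * (\<Sum>r\<in>UNIV. ((x * u) $ r) ^ N) / fact N"
      using N by (intro divide_right_mono sum_power_le) auto
    finally show ?thesis by (simp add: mpow_axis power_mult_distrib)
  qed
  have "(\<Sum>\<alpha> | msize \<alpha> = N. mpow x \<alpha> / mfact \<alpha> * (\<Prod>r\<in>UNIV. 1 / real (Suc (\<alpha> $ r))))
    \<le> ?p ^ (N - 1) / fact N * (\<Sum>r\<in>UNIV. x $ r ^ N * (\<Prod>q\<in>UNIV. 1 / real (Suc (axis r N $ q))))"
    using le by (intro has_integral_le[OF A B]) auto
  also have "(\<Sum>\<alpha> | msize \<alpha> = N. mpow x \<alpha> / mfact \<alpha> * (\<Prod>r\<in>UNIV. 1 / real (Suc (\<alpha> $ r))))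
    = (\<Sum>\<alpha> | msize \<alpha> = N. mpow x \<alpha> / mfact (\<alpha> + 1))"
    by (simp add: mfact_Suc prod_dividef)
  finally show ?thesis unfolding unit by (simp add: sum_divide_distrib[symmetric] mult.commute)
qed

text \<open>
  Once the variables are separated, the sum over \<open>j\<close> factorises: coordinate \<open>q\<close> gives the moment of order
  \<open>2 m\<close> and each of the other \<open>p - 1\<close> coordinates the total mass, of size \<open>sqrt (\<pi> m)\<close>. Together with the
  factor \<open>\<pi> m\<close> of the former this yields the exponent \<open>(p + 1) / 2\<close>.
\<close>

lemma rem_const_bound:
  assumes m: "m \<ge> 1"
  shows "rem_const m TYPE('p::finite)
    \<le> 1.0331 * (pi * real m) powr ((real CARD('p) + 1) / 2) / fact (2 * m + 1) * (kap * real CARD('p) * real m) ^ (2 * m)"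
proof -
  let ?p = "CARD('p)"
  define g where "g j = \<bar>gam m j\<bar> * real j" for j
  define G where "G = (\<Sum>j\<in>{1..m}. g j)"
  define H where "H = (\<Sum>j\<in>{1..m}. g j * real j ^ (2 * m))"
  define c where "c = real ?p ^ (2 * m - 1) / fact (2 * m + 1)"
  have g0: "g j \<ge> 0" for j by (simp add: g_def)
  have p: "?p \<ge> 1" by (simp add: Suc_leI)
  have "(\<Sum>\<alpha>\<in>{\<alpha> :: (nat, 'p) vec. msize \<alpha> = 2 * m}. 1 / mfact (\<alpha> + 1) *
            (\<Sum>j\<in>{1..of_nat m}. \<bar>mgam m j\<bar> * mpow (rvec j) (\<alpha> + 1)))
      = (\<Sum>j\<in>{1..of_nat m}. (\<Prod>r\<in>UNIV. g (j $ r)) * (\<Sum>\<alpha>\<in>{\<alpha> :: (nat, 'p) vec. msize \<alpha> = 2 * m}. mpow (rvec j) \<alpha> / mfact (\<alpha> + 1)))"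
  proof -
    have eq: "\<bar>mgam m j\<bar> * mpow (rvec j) (\<alpha> + 1) = (\<Prod>r\<in>UNIV. g (j $ r)) * mpow (rvec j) \<alpha>" for j \<alpha> :: "(nat, 'p) vec"
      by (simp add: mgam_def abs_prod mpow_def rvec_def g_def prod.distrib mult_ac)
    show ?thesis
      unfolding eq sum_distrib_left by (subst sum.swap) (simp add: mult_ac)
  qed
  also have "\<dots> \<le> (\<Sum>j\<in>{1..of_nat m :: (nat, 'p) vec}. (\<Prod>r\<in>UNIV. g (j $ r)) * (c * (\<Sum>q\<in>UNIV. real (j $ q) ^ (2 * m))))"
  proof (intro sum_mono mult_left_mono)
    fix j :: "(nat, 'p) vec"
    show "(\<Sum>\<alpha>\<in>{\<alpha> :: (nat, 'p) vec. msize \<alpha> = 2 * m}. mpow (rvec j) \<alpha> / mfact (\<alpha> + 1)) \<le> c * (\<Sum>q\<in>UNIV. real (j $ q) ^ (2 * m))"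
      using sum_mpow_over_factorials[of "2 * m" "rvec j"] m by (simp add: c_def rvec_def)
  qed (auto intro: prod_nonneg g0)
  also have "\<dots> = c * (\<Sum>q\<in>UNIV. \<Sum>j\<in>{1..of_nat m :: (nat, 'p) vec}. (\<Prod>r\<in>UNIV. g (j $ r)) * real (j $ q) ^ (2 * m))"
    by (subst sum.swap) (simp add: sum_distrib_left mult_ac)
  also have "\<dots> = c * (\<Sum>q\<in>(UNIV :: 'p set). G ^ (?p - 1) * H)"
  proof (intro arg_cong2[where f = "(*)"] sum.cong refl)
    fix q :: 'p
    have "(\<Sum>j\<in>{1..of_nat m :: (nat, 'p) vec}. (\<Prod>r\<in>UNIV. g (j $ r)) * real (j $ q) ^ (2 * m))
        = (\<Sum>j\<in>grid (\<lambda>_::'p. {1..m}). \<Prod>r\<in>UNIV. g (j $ r) * (if r = q then real (j $ r) ^ (2 * m) else 1))"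
      unfolding one_to_of_nat by (simp add: prod.distrib)
    also have "\<dots> = (\<Prod>r\<in>UNIV. \<Sum>j\<in>{1..m}. g j * (if r = q then real j ^ (2 * m) else 1))"
      by (rule sum_grid_prod) simp
    also have "\<dots> = (\<Prod>r\<in>UNIV. if r = q then H else G)"
      by (intro prod.cong refl) (auto simp: G_def H_def)
    also have "\<dots> = H * G ^ (?p - 1)"
      by (subst prod.remove[of _ q]) (auto simp: card_Diff_singleton)
    finally show "(\<Sum>j\<in>{1..of_nat m :: (nat, 'p) vec}. (\<Prod>r\<in>UNIV. g (j $ r)) * real (j $ q) ^ (2 * m)) = G ^ (?p - 1) * H"
      by (simp add: mult.commute)
  qed
  also have "\<dots> = c * real ?p * (G ^ (?p - 1) * H)" by simp
  also have "\<dots> \<le> c * real ?p * (sqrt (pi * real m) ^ (?p - 1) * (1.0331 * pi * real m * real m ^ (2 * m) * Lam_star ^ m))"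
    using gam_mass[OF m] gam_top_moment[OF m]
    by (intro mult_left_mono mult_mono power_mono) (auto simp: G_def H_def g_def c_def intro!: sum_nonneg)
  also have "\<dots> = 1.0331 * (sqrt (pi * real m) ^ (?p - 1) * (pi * real m)) * (real ?p ^ (2 * m) * real m ^ (2 * m) * Lam_star ^ m) / fact (2 * m + 1)"
  proof -
    have "real ?p ^ (2 * m - 1) * real ?p = real ?p ^ (2 * m)"
      using m by (metis power_minus_mult mult_pos_pos zero_less_numeral less_le_trans zero_less_one)
    then show ?thesis by (simp add: c_def mult_ac)
  qed
  also have "sqrt (pi * real m) ^ (?p - 1) * (pi * real m) = (pi * real m) powr ((real ?p + 1) / 2)"
  proof -
    have pos: "pi * real m > 0" using m by simp
    have "sqrt (pi * real m) ^ (?p - 1) * (pi * real m) = sqrt (pi * real m) ^ (?p + 1)"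
    proof -
      have "?p + 1 = (?p - 1) + 2" using p by simp
      then show ?thesis using pos by (simp only: power_add) simp
    qed
    also have "\<dots> = ((pi * real m) powr (1 / 2)) ^ (?p + 1)"
      using pos by (simp only: powr_half_sqrt)
    also have "\<dots> = (pi * real m) powr ((real ?p + 1) / 2)"
      using m by (subst powr_power) (auto simp: add.commute)
    finally show ?thesis .
  qed
  finally have "rem_const m TYPE('p) \<le> 1 / 2 ^ (2 * m) * (1.0331 * (pi * real m) powr ((real ?p + 1) / 2) *
      (real ?p ^ (2 * m) * real m ^ (2 * m) * Lam_star ^ m) / fact (2 * m + 1))"
    unfolding rem_const_def by (intro mult_left_mono) auto
  also have "\<dots> = 1.0331 * (pi * real m) powr ((real ?p + 1) / 2) / fact (2 * m + 1) * (kap * real ?p * real m) ^ (2 * m)"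
    unfolding power_mult_distrib kap_power by (simp add: mult_ac)
  finally show ?thesis .
qed

section \<open>The theorem\<close>

theorem theorem3p1:
  fixes m m0 :: nat
    and f F :: "real ^ 'p::{finite,linorder} \<Rightarrow> real"
  assumes "m0 \<ge> 1" and "m \<ge> m0"
    and "cont_diff (2 * m) f"
    and "is_antiderivative F f"
    and "\<And>\<alpha>. msize \<alpha> = 2 * m0 \<Longrightarrow> \<exists>G. has_mpartial \<alpha> F G \<and> (G \<longlongrightarrow> 0) max_at_top"
    and "\<And>\<alpha>. msize \<alpha> = 2 * m \<Longrightarrow>
      \<exists>L. uniform_limit {u. \<forall>r. - (real m / 2) \<le> u $ r \<and> u $ r \<le> real m / 2}
        (\<lambda>n u. \<Sum>k\<in>below n. mpartial \<alpha> f (rvec k + u)) L min_at_top"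
  shows
    "((\<lambda>n. (\<Sum>k\<in>below n. f (rvec k)) - A_tilde m0 F n)
        \<longlongrightarrow> (- 1) ^ CARD('p) * A_term m F {} 0 - R_inf m f) min_at_top
     \<and>
     (\<forall>M\<in>{m, m0}. \<forall>J n.
        A_term M F J n =
          (\<Sum>\<beta>\<in>{1 - of_nat M..of_nat M - 1}.
            mtau M (1 + mabs \<beta>) * F (rvec n * indvec J - (1/2) *\<^sub>R 1 - (1/2) *\<^sub>R ivec \<beta>))
        \<and>
        A_term M F J n =
          (\<Sum>\<alpha>\<in>{0..of_nat (M - 1)}. mtau M (1 + \<alpha>) *
            (\<Sum>\<beta>\<in>{\<beta>. mabs \<beta> = \<alpha>}.
              F (rvec n * indvec J - (1/2) *\<^sub>R 1 - (1/2) *\<^sub>R ivec \<beta>))))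
     \<and>
     (\<forall>M :: real.
        (\<forall>n \<alpha> u. msize \<alpha> = 2 * m \<longrightarrow> (\<forall>r. - (real m / 2) < u $ r \<and> u $ r \<le> real m / 2)
           \<longrightarrow> \<bar>\<Sum>k\<in>below n. mpartial \<alpha> f (rvec k + u)\<bar> \<le> M)
        \<longrightarrow>
        \<bar>R_inf m f\<bar> \<le> M / 2 ^ (2 * m) *
          (\<Sum>\<alpha>\<in>{\<alpha> :: (nat, 'p) vec. msize \<alpha> = 2 * m}. 1 / mfact (\<alpha> + 1) *
            (\<Sum>j\<in>{1..of_nat m}. \<bar>mgam m j\<bar> * mpow (rvec j) (\<alpha> + 1)))
        \<and>
        M / 2 ^ (2 * m) *
          (\<Sum>\<alpha>\<in>{\<alpha> :: (nat, 'p) vec. msize \<alpha> = 2 * m}. 1 / mfact (\<alpha> + 1) *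
            (\<Sum>j\<in>{1..of_nat m}. \<bar>mgam m j\<bar> * mpow (rvec j) (\<alpha> + 1)))
        \<le> M * (1.0331 * (pi * real m) powr ((real CARD('p) + 1) / 2) / fact (2 * m + 1))
            * (kap * real CARD('p) * real m) ^ (2 * m))
     \<and>
     (\<exists>t\<in>{0<..<1}. Lam_fun t = Lam_star) \<and> (\<forall>t\<in>{0<..<1}. Lam_fun t \<le> Lam_star)
     \<and> 0.3081 \<le> Lam_star \<and> Lam_star < 0.3082 \<and> 0.27754 \<le> kap \<and> kap < 0.27755
     \<and>
     (\<forall>n J.
        A_term m F {} 0 = A_term m F {} n \<and>
        A_term m F {} n = A_term m F J 0 \<and>
        A_term m F J 0 =
          (\<Sum>\<alpha>\<in>{0..of_nat (m - 1)}. mtau m (1 + \<alpha>) *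
            (\<Sum>\<beta>\<in>{\<beta>. mabs \<beta> = \<alpha>}. F ((1/2) *\<^sub>R ivec \<beta> - (1/2) *\<^sub>R 1))))"
proof (intro conjI allI ballI impI, goal_cases)
  have m: "m \<ge> 1" using assms(1,2) by simp
  note limit = summation_limit[OF assms(1-5) assms(6)[folded cube_def]]
  let ?C = "rem_const m TYPE('p)"
  have const: "M / 2 ^ (2 * m) *
      (\<Sum>\<alpha>\<in>{\<alpha> :: (nat, 'p) vec. msize \<alpha> = 2 * m}. 1 / mfact (\<alpha> + 1) *
        (\<Sum>j\<in>{1..of_nat m}. \<bar>mgam m j\<bar> * mpow (rvec j) (\<alpha> + 1))) = M * ?C" for M :: real
    by (simp add: rem_const_def)
  {
    case 1 show ?case by (rule limit(1))
  next
    case 2 show ?case by (rule A_term_tau_int)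
  next
    case 3 then show ?case using assms(1) m by (intro A_term_tau_nat) auto
  next
    case (4 M)
    have bound: "\<bar>\<Sum>k\<in>below n. mpartial \<alpha> f (rvec k + u)\<bar> \<le> M"
      if "msize \<alpha> = 2 * m" "\<forall>r. - (real m / 2) < u $ r \<and> u $ r \<le> real m / 2"
      for n \<alpha> :: "(nat, 'p) vec" and u :: "(real, 'p) vec"
      using 4 that by simp
    show ?case unfolding const by (rule limit(2)) (assumption | erule (1) bound)+
  next
    case (5 M)
    \<comment> \<open>An empty sum shows that \<open>M\<close> is nonnegative; any multi-index of the right size serves.\<close>
    have "msize (axis undefined (2 * m) :: (nat, 'p) vec) = 2 * m" by (simp add: msize_def axis_def)
    moreover have "\<forall>r. - (real m / 2) < (0 :: (real, 'p) vec) $ r \<and> (0 :: (real, 'p) vec) $ r \<le> real m / 2"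
      using m by simp
    ultimately have "\<bar>\<Sum>k\<in>below 0. mpartial (axis undefined (2 * m)) f (rvec k + 0)\<bar> \<le> M"
      using 5 by blast
    then have "0 \<le> M" by (simp add: below_def)
    then show ?case unfolding const mult.assoc[of M] by (intro mult_left_mono rem_const_bound m)
  next
    case 6 show ?case using Lam_star_attained by auto
  next
    case 7 then show ?case using Lam_star_attained by auto
  next
    case 8 show ?case using Lam_star_bounds(1) by simp
  next
    case 9 show ?case using Lam_star_bounds(2) by simp
  next
    case 10 show ?case by (rule kap_bounds(1))
  next
    case 11 show ?case by (rule kap_bounds(2))
  next
    case 12 show ?case by (rule A_term_empty[symmetric])
  next
    case 13 show ?case by (rule A_term_empty)
  next
    case 14 show ?case by (rule A_term_at_origin[OF m])
  }
qed

end
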